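(* Let $G=G_1\ast\cdots\ast G_k\ast F_N$ be a countable group ($F_N$ free of rank $N$), $\mathcal{F}=\{[G_1],\dots,[G_k]\}$, and let $T$ be a minimal $(G,\mathcal{F})$-tree. Then there exists a sequence $(T_n)_{n\in\mathbb{N}}$ of minimal geometric $(G,\mathcal{F})$-trees that strongly converges towards $T$. If in addition $H$ is a subgroup of $G$ of finite Kurosh rank that is elliptic in $T$, then the sequence can be chosen so that $H$ is elliptic in every $T_n$.
   Context: Peripheral: conjugate into some $G_i$. $(G,\mathcal{F})$-tree: $\mathbb{R}$-tree with isometric $G$-action in which every peripheral subgroup fixes a unique point; minimal: no proper nonempty invariant subtree. $H$ elliptic in $T$: $H$ fixes a point of $T$. Kurosh rank of $H$: from a Kurosh decomposition $H=\ast_{j\in J}g_jH_jg_j^{-1}\ast F'$ ($H_j$ nontrivial subgroups of some $G_{i_j}$, $F'$ free), $\mathrm{rk}_K(H)=\mathrm{rk}(F')+|J|$. A morphism of $\mathbb{R}$-trees $f:T\to T'$ is a map such that every segment of $T$ can be subdivided into finitely many subsegments on each of which $f$ is an isometry. $(T_n)$ strongly converges to $T$ if there are $G$-equivariant morphisms $j_{n,n'}:T_n\to T_{n'}$ ($n\le n'$) and $j_n:T_n\to T$ with $j_{n'}\circ j_{n,n'}=j_n$, such that for every $n$ and every segment $I\subseteq T_n$ there is $n'\ge n$ such that $j_{n'}$ restricted to $j_{n,n'}(I)$ is an isometry. Geometric trees: fix a free basis $b_1,\dots,b_N$ of $F_N$; let $S$ be the Bass–Serre tree of the graph of groups with a vertex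 $v_0$ with trivial group, $N$ loops at it (for the $b_j$) and $k$ edges joining it to vertices with groups $G_1,\dots,G_k$, all edge groups trivial; let $v_1,\dots,v_k$ be the neighbours of $v_0$ with stabilizers $G_i$. For a $(G,\mathcal{F})$-tree $T$ and a finite subtree $K$ containing the fixed point of each $G_i$ with $K\cap b_jK\neq\emptyset$ for all $j$: for $v$ in the orbit of $v_i$ put $K_v=\bigcup_{g:\,gv_i=v}gK$; $\Sigma\subseteq T\times S$ is the set of $(x,y)$ with $y$ a vertex and $x\in K_y$, or $y$ interior to an edge $[v,v']$ and $x\in K_v\cap K_{v'}$, with diagonal $G$-action; $\Sigma_0=\Sigma\cap(T\times Gv_0)$; for $p,q\in\Sigma_0$, $\delta(p,q)$ is the infimum of $\sum_i d_T(\pi_T(u'_i),\pi_T(u_{i+1}))$ over sequences $p=u'_0,u_1,u'_1,\dots,u_m=q$ in $\Sigma$ with $u'_i,u_{i+1}$ of equal $S$-coordinate and $u_i,u'_i$ joined by a path in $\Sigma$ with constant $T$-coordinate. $T_K$ is the metric quotient of $(\Sigma_0,\delta)$ with induced $G$-action; a tree is geometric if it is $G$-equivariantly isometric to $T_K$ for some such $T$ and $K$. *)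

theory Defs
  imports Complex_Main "HOL-Algebra.Coset" "HOL-Library.Countable_Set"
begin

definition cyc :: "('g, 'm) monoid_scheme \<Rightarrow> 'g \<Rightarrow> 'g set" where
  "cyc G b = {b [^]\<^bsub>G\<^esub> (n::int) | n. True}"

definition infinite_order :: "('g, 'm) monoid_scheme \<Rightarrow> 'g \<Rightarrow> bool" where
  "infinite_order G b \<longleftrightarrow> b \<in> carrier G \<and> (\<forall>n::int. b [^]\<^bsub>G\<^esub> n = \<one>\<^bsub>G\<^esub> \<longrightarrow> n = 0)"

definition reduced_word :: "('g, 'm) monoid_scheme \<Rightarrow> 'g set list \<Rightarrow> (nat \<times> 'g) list \<Rightarrow> bool" where
  "reduced_word G Ks w \<longleftrightarrow>
     (\<forall>(i,h)\<in>set w. i < length Ks \<and> h \<in> Ks ! i \<and> h \<noteq> \<one>\<^bsub>G\<^esub>) \<and>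
     (\<forall>i. Suc i < length w \<longrightarrow> fst (w ! i) \<noteq> fst (w ! Suc i))"

definition word_prod :: "('g, 'm) monoid_scheme \<Rightarrow> (nat \<times> 'g) list \<Rightarrow> 'g" where
  "word_prod G w = foldr (\<lambda>(i,h) acc. h \<otimes>\<^bsub>G\<^esub> acc) w \<one>\<^bsub>G\<^esub>"

definition is_free_product :: "('g, 'm) monoid_scheme \<Rightarrow> 'g set list \<Rightarrow> 'g set \<Rightarrow> bool" where
  "is_free_product G Ks H \<longleftrightarrow>
     (\<forall>K\<in>set Ks. subgroup K G) \<and> H \<subseteq> carrier G \<and>
     (\<forall>w. reduced_word G Ks w \<longrightarrow> word_prod G w \<in> H) \<and>
     (\<forall>x\<in>H. \<exists>!w. reduced_word G Ks w \<and> word_prod G w = x)"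

(* G = G_1 * ... * G_k * F_N, where F_N is free with free basis bs = [b_1,...,b_N] *)
definition free_product_decomp :: "('g, 'm) monoid_scheme \<Rightarrow> 'g set list \<Rightarrow> 'g list \<Rightarrow> bool" where
  "free_product_decomp G Gs bs \<longleftrightarrow>
     (\<forall>b\<in>set bs. infinite_order G b) \<and>
     is_free_product G (Gs @ map (cyc G) bs) (carrier G)"

definition conj_set :: "('g, 'm) monoid_scheme \<Rightarrow> 'g \<Rightarrow> 'g set \<Rightarrow> 'g set" where
  "conj_set G g A = {g \<otimes>\<^bsub>G\<^esub> a \<otimes>\<^bsub>G\<^esub> inv\<^bsub>G\<^esub> g | a. a \<in> A}"

(* A Kurosh decomposition H = *_j g_j H_j g_j^{-1} * F' given by a list cs of triples
   (g_j, i_j, H_j) with H_j a nontrivial subgroup of G_{i_j}, and a free basis fs of F'.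
   Its Kurosh rank is rk(F') + |J| = length fs + length cs. *)
definition kurosh_decomp ::
  "('g, 'm) monoid_scheme \<Rightarrow> 'g set list \<Rightarrow> 'g set \<Rightarrow> ('g \<times> nat \<times> 'g set) list \<Rightarrow> 'g list \<Rightarrow> bool" where
  "kurosh_decomp G Gs H cs fs \<longleftrightarrow>
     (\<forall>(g,i,Hj)\<in>set cs. g \<in> carrier G \<and> i < length Gs \<and> subgroup Hj G \<and> Hj \<subseteq> Gs ! i
                          \<and> Hj \<noteq> {\<one>\<^bsub>G\<^esub>}) \<and>
     (\<forall>f\<in>set fs. infinite_order G f) \<and>
     is_free_product G (map (\<lambda>(g,i,Hj). conj_set G g Hj) cs @ map (cyc G) fs) H"

(* finite Kurosh rank: H admits a Kurosh decomposition with finitely many factors and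
   finitely generated free part (by finiteness of the lists). *)
definition finite_kurosh_rank :: "('g, 'm) monoid_scheme \<Rightarrow> 'g set list \<Rightarrow> 'g set \<Rightarrow> bool" where
  "finite_kurosh_rank G Gs H \<longleftrightarrow> subgroup H G \<and> (\<exists>cs fs. kurosh_decomp G Gs H cs fs)"

definition is_metric :: "'p set \<Rightarrow> ('p \<Rightarrow> 'p \<Rightarrow> real) \<Rightarrow> bool" where
  "is_metric X d \<longleftrightarrow>
     (\<forall>x\<in>X. \<forall>y\<in>X. d x y = d y x \<and> (d x y = 0 \<longleftrightarrow> x = y)) \<and>
     (\<forall>x\<in>X. \<forall>y\<in>X. \<forall>z\<in>X. d x z \<le> d x y + d y z)"

definition geodesic_segments :: "'p set \<Rightarrow> ('p \<Rightarrow> 'p \<Rightarrow> real) \<Rightarrow> 'p \<Rightarrow> 'p \<Rightarrow> 'p set set" where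
  "geodesic_segments X d x y =
     {\<gamma> ` {0..d x y} | \<gamma>. \<gamma> 0 = x \<and> \<gamma> (d x y) = y \<and> \<gamma> ` {0..d x y} \<subseteq> X \<and>
        (\<forall>s\<in>{0..d x y}. \<forall>t\<in>{0..d x y}. d (\<gamma> s) (\<gamma> t) = \<bar>s - t\<bar>)}"

definition seg :: "'p set \<Rightarrow> ('p \<Rightarrow> 'p \<Rightarrow> real) \<Rightarrow> 'p \<Rightarrow> 'p \<Rightarrow> 'p set" where
  "seg X d x y = (THE S. S \<in> geodesic_segments X d x y)"

definition R_tree :: "'p set \<Rightarrow> ('p \<Rightarrow> 'p \<Rightarrow> real) \<Rightarrow> bool" where
  "R_tree X d \<longleftrightarrow> X \<noteq> {} \<and> is_metric X d \<and>
     (\<forall>x\<in>X. \<forall>y\<in>X. \<exists>!S. S \<in> geodesic_segments X d x y) \<and>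
     (\<forall>x\<in>X. \<forall>y\<in>X. \<forall>z\<in>X. seg X d x y \<inter> seg X d y z = {y} \<longrightarrow>
          seg X d x y \<union> seg X d y z = seg X d x z)"

definition isometric_action ::
  "('g, 'm) monoid_scheme \<Rightarrow> 'p set \<Rightarrow> ('p \<Rightarrow> 'p \<Rightarrow> real) \<Rightarrow> ('g \<Rightarrow> 'p \<Rightarrow> 'p) \<Rightarrow> bool" where
  "isometric_action G X d act \<longleftrightarrow>
     (\<forall>g\<in>carrier G. \<forall>x\<in>X. act g x \<in> X) \<and>
     (\<forall>g\<in>carrier G. \<forall>x\<in>X. \<forall>y\<in>X. d (act g x) (act g y) = d x y) \<and>
     (\<forall>x\<in>X. act \<one>\<^bsub>G\<^esub> x = x) \<and>
     (\<forall>g\<in>carrier G. \<forall>h\<in>carrier G. \<forall>x\<in>X. act (g \<otimes>\<^bsub>G\<^esub> h) x = act g (act h x))"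

definition fixes_point :: "('g \<Rightarrow> 'p \<Rightarrow> 'p) \<Rightarrow> 'g set \<Rightarrow> 'p \<Rightarrow> bool" where
  "fixes_point act H x \<longleftrightarrow> (\<forall>h\<in>H. act h x = x)"

definition GF_tree ::
  "('g, 'm) monoid_scheme \<Rightarrow> 'g set list \<Rightarrow> 'p set \<Rightarrow> ('p \<Rightarrow> 'p \<Rightarrow> real) \<Rightarrow> ('g \<Rightarrow> 'p \<Rightarrow> 'p) \<Rightarrow> bool" where
  "GF_tree G Gs X d act \<longleftrightarrow> R_tree X d \<and> isometric_action G X d act \<and>
     (\<forall>i<length Gs. \<forall>g\<in>carrier G. \<exists>!x. x \<in> X \<and> fixes_point act (conj_set G g (Gs ! i)) x)"

definition subtree :: "'p set \<Rightarrow> ('p \<Rightarrow> 'p \<Rightarrow> real) \<Rightarrow> 'p set \<Rightarrow> bool" where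
  "subtree X d Y \<longleftrightarrow> Y \<noteq> {} \<and> Y \<subseteq> X \<and> (\<forall>x\<in>Y. \<forall>y\<in>Y. seg X d x y \<subseteq> Y)"

definition minimal_tree ::
  "('g, 'm) monoid_scheme \<Rightarrow> 'p set \<Rightarrow> ('p \<Rightarrow> 'p \<Rightarrow> real) \<Rightarrow> ('g \<Rightarrow> 'p \<Rightarrow> 'p) \<Rightarrow> bool" where
  "minimal_tree G X d act \<longleftrightarrow>
     (\<forall>Y. subtree X d Y \<and> (\<forall>g\<in>carrier G. act g ` Y \<subseteq> Y) \<longrightarrow> Y = X)"

definition elliptic :: "'p set \<Rightarrow> ('g \<Rightarrow> 'p \<Rightarrow> 'p) \<Rightarrow> 'g set \<Rightarrow> bool" where
  "elliptic X act H \<longleftrightarrow> (\<exists>x\<in>X. fixes_point act H x)"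

definition finite_subtree :: "'p set \<Rightarrow> ('p \<Rightarrow> 'p \<Rightarrow> real) \<Rightarrow> 'p set \<Rightarrow> bool" where
  "finite_subtree X d K \<longleftrightarrow>
     (\<exists>P. finite P \<and> P \<noteq> {} \<and> P \<subseteq> X \<and> K = (\<Union>x\<in>P. \<Union>y\<in>P. seg X d x y))"

definition isometric_on :: "('p \<Rightarrow> 'p \<Rightarrow> real) \<Rightarrow> ('q \<Rightarrow> 'q \<Rightarrow> real) \<Rightarrow> ('p \<Rightarrow> 'q) \<Rightarrow> 'p set \<Rightarrow> bool" where
  "isometric_on d d' f S \<longleftrightarrow> (\<forall>u\<in>S. \<forall>v\<in>S. d' (f u) (f v) = d u v)"

definition tree_morphism ::
  "'p set \<Rightarrow> ('p \<Rightarrow> 'p \<Rightarrow> real) \<Rightarrow> 'q set \<Rightarrow> ('q \<Rightarrow> 'q \<Rightarrow> real) \<Rightarrow> ('p \<Rightarrow> 'q) \<Rightarrow> bool" where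
  "tree_morphism X d X' d' f \<longleftrightarrow> f ` X \<subseteq> X' \<and>
     (\<forall>x\<in>X. \<forall>y\<in>X. \<exists>ps. ps \<noteq> [] \<and> hd ps = x \<and> last ps = y \<and> set ps \<subseteq> seg X d x y \<and>
        seg X d x y = (\<Union>i\<in>{i. Suc i < length ps}. seg X d (ps ! i) (ps ! Suc i)) \<and>
        (\<forall>i. Suc i < length ps \<longrightarrow> isometric_on d d' f (seg X d (ps ! i) (ps ! Suc i))))"

definition equivariant_on ::
  "('g, 'm) monoid_scheme \<Rightarrow> 'p set \<Rightarrow> ('g \<Rightarrow> 'p \<Rightarrow> 'p) \<Rightarrow> ('g \<Rightarrow> 'q \<Rightarrow> 'q) \<Rightarrow> ('p \<Rightarrow> 'q) \<Rightarrow> bool" where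
  "equivariant_on G X act act' f \<longleftrightarrow> (\<forall>g\<in>carrier G. \<forall>x\<in>X. f (act g x) = act' g (f x))"

definition strongly_converges ::
  "('g, 'm) monoid_scheme \<Rightarrow>
   (nat \<Rightarrow> 'q set) \<Rightarrow> (nat \<Rightarrow> 'q \<Rightarrow> 'q \<Rightarrow> real) \<Rightarrow> (nat \<Rightarrow> 'g \<Rightarrow> 'q \<Rightarrow> 'q) \<Rightarrow>
   'p set \<Rightarrow> ('p \<Rightarrow> 'p \<Rightarrow> real) \<Rightarrow> ('g \<Rightarrow> 'p \<Rightarrow> 'p) \<Rightarrow> bool" where
  "strongly_converges G Xs ds acts X d act \<longleftrightarrow>
     (\<exists>(j :: nat \<Rightarrow> nat \<Rightarrow> 'q \<Rightarrow> 'q) (jl :: nat \<Rightarrow> 'q \<Rightarrow> 'p).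
        (\<forall>n n'. n \<le> n' \<longrightarrow> tree_morphism (Xs n) (ds n) (Xs n') (ds n') (j n n') \<and>
                            equivariant_on G (Xs n) (acts n) (acts n') (j n n')) \<and>
        (\<forall>n. tree_morphism (Xs n) (ds n) X d (jl n) \<and> equivariant_on G (Xs n) (acts n) act (jl n)) \<and>
        (\<forall>n n'. n \<le> n' \<longrightarrow> (\<forall>x\<in>Xs n. jl n' (j n n' x) = jl n x)) \<and>
        (\<forall>n. \<forall>x\<in>Xs n. \<forall>y\<in>Xs n. \<exists>n'\<ge>n.
            isometric_on (ds n') d (jl n') (j n n' ` seg (Xs n) (ds n) x y)))"

(* Vertices of the Bass-Serre tree S: Inl g stands for g v_0 (trivial stabilizer),
   Inr (i, g G_i) stands for g v_{i} (stabilizer g G_i g^{-1}); indices i are 0-based. *)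
type_synonym 'g vertex = "'g + (nat \<times> 'g set)"

definition S_vertices :: "('g, 'm) monoid_scheme \<Rightarrow> 'g set list \<Rightarrow> 'g vertex set" where
  "S_vertices G Gs = Inl ` carrier G \<union>
     {Inr (i, g <#\<^bsub>G\<^esub> (Gs ! i)) | i g. i < length Gs \<and> g \<in> carrier G}"

definition S_adj :: "('g, 'm) monoid_scheme \<Rightarrow> 'g set list \<Rightarrow> 'g list \<Rightarrow> 'g vertex \<Rightarrow> 'g vertex \<Rightarrow> bool" where
  "S_adj G Gs bs v w \<longleftrightarrow>
     (\<exists>g\<in>carrier G. \<exists>i<length Gs. {v, w} = {Inl g, Inr (i, g <#\<^bsub>G\<^esub> (Gs ! i))}) \<or>
     (\<exists>g\<in>carrier G. \<exists>j<length bs. {v, w} = {Inl g, Inl (g \<otimes>\<^bsub>G\<^esub> (bs ! j))})"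

definition K_at :: "('g \<Rightarrow> 'p \<Rightarrow> 'p) \<Rightarrow> 'p set \<Rightarrow> 'g vertex \<Rightarrow> 'p set" where
  "K_at act K v = (case v of Inl g \<Rightarrow> act g ` K | Inr (i, C) \<Rightarrow> (\<Union>h\<in>C. act h ` K))"

(* one step of a path in Sigma with constant T-coordinate, crossing a whole edge of S *)
definition const_step ::
  "('g, 'm) monoid_scheme \<Rightarrow> 'g set list \<Rightarrow> 'g list \<Rightarrow> ('g \<Rightarrow> 'p \<Rightarrow> 'p) \<Rightarrow> 'p set \<Rightarrow>
   'p \<times> 'g vertex \<Rightarrow> 'p \<times> 'g vertex \<Rightarrow> bool" where
  "const_step G Gs bs act K u u' \<longleftrightarrow>
     fst u = fst u' \<and> S_adj G Gs bs (snd u) (snd u') \<and>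
     fst u \<in> K_at act K (snd u) \<and> fst u \<in> K_at act K (snd u')"

(* Sigma_0, with (x, g) standing for (x, g v_0) *)
definition Sigma0 :: "('g, 'm) monoid_scheme \<Rightarrow> ('g \<Rightarrow> 'p \<Rightarrow> 'p) \<Rightarrow> 'p set \<Rightarrow> ('p \<times> 'g) set" where
  "Sigma0 G act K = {(x, g) | x g. g \<in> carrier G \<and> x \<in> act g ` K}"

(* admissible chains: a nonempty list of "jumps" (v_i, a_i, b_i) at vertices v_i from (a_i,v_i) to
   (b_i,v_i), consecutive jumps connected by constant-T-coordinate paths in Sigma *)
definition admissible_chain ::
  "('g, 'm) monoid_scheme \<Rightarrow> 'g set list \<Rightarrow> 'g list \<Rightarrow> ('g \<Rightarrow> 'p \<Rightarrow> 'p) \<Rightarrow> 'p set \<Rightarrow>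
   ('p \<times> 'g) \<Rightarrow> ('p \<times> 'g) \<Rightarrow> ('g vertex \<times> 'p \<times> 'p) list \<Rightarrow> bool" where
  "admissible_chain G Gs bs act K p q js \<longleftrightarrow> js \<noteq> [] \<and>
     (\<forall>(v,a,b)\<in>set js. v \<in> S_vertices G Gs \<and> a \<in> K_at act K v \<and> b \<in> K_at act K v) \<and>
     (case hd js of (v,a,b) \<Rightarrow> v = Inl (snd p) \<and> a = fst p) \<and>
     (case last js of (v,a,b) \<Rightarrow> v = Inl (snd q) \<and> b = fst q) \<and>
     (\<forall>i. Suc i < length js \<longrightarrow>
        (const_step G Gs bs act K)\<^sup>*\<^sup>*
          (case js ! i of (v,a,b) \<Rightarrow> (b, v)) (case js ! Suc i of (v,a,b) \<Rightarrow> (a, v)))"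

definition delta ::
  "('g, 'm) monoid_scheme \<Rightarrow> 'g set list \<Rightarrow> 'g list \<Rightarrow> ('p \<Rightarrow> 'p \<Rightarrow> real) \<Rightarrow> ('g \<Rightarrow> 'p \<Rightarrow> 'p) \<Rightarrow>
   'p set \<Rightarrow> ('p \<times> 'g) \<Rightarrow> ('p \<times> 'g) \<Rightarrow> real" where
  "delta G Gs bs d act K p q =
     Inf {sum_list (map (\<lambda>(v,a,b). d a b) js) | js. admissible_chain G Gs bs act K p q js}"

definition TK_carrier ::
  "('g, 'm) monoid_scheme \<Rightarrow> 'g set list \<Rightarrow> 'g list \<Rightarrow> ('p \<Rightarrow> 'p \<Rightarrow> real) \<Rightarrow> ('g \<Rightarrow> 'p \<Rightarrow> 'p) \<Rightarrow>
   'p set \<Rightarrow> ('p \<times> 'g) set set" where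
  "TK_carrier G Gs bs d act K = Sigma0 G act K //
     {(p, q). p \<in> Sigma0 G act K \<and> q \<in> Sigma0 G act K \<and> delta G Gs bs d act K p q = 0}"

definition TK_dist ::
  "('g, 'm) monoid_scheme \<Rightarrow> 'g set list \<Rightarrow> 'g list \<Rightarrow> ('p \<Rightarrow> 'p \<Rightarrow> real) \<Rightarrow> ('g \<Rightarrow> 'p \<Rightarrow> 'p) \<Rightarrow>
   'p set \<Rightarrow> ('p \<times> 'g) set \<Rightarrow> ('p \<times> 'g) set \<Rightarrow> real" where
  "TK_dist G Gs bs d act K C C' = delta G Gs bs d act K (SOME p. p \<in> C) (SOME q. q \<in> C')"

definition TK_act ::
  "('g, 'm) monoid_scheme \<Rightarrow> ('g \<Rightarrow> 'p \<Rightarrow> 'p) \<Rightarrow> 'g \<Rightarrow> ('p \<times> 'g) set \<Rightarrow> ('p \<times> 'g) set" where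
  "TK_act G act h C = (\<lambda>(x, g). (act h x, h \<otimes>\<^bsub>G\<^esub> g)) ` C"

definition admissible_K ::
  "('g, 'm) monoid_scheme \<Rightarrow> 'g set list \<Rightarrow> 'g list \<Rightarrow> 'p set \<Rightarrow> ('p \<Rightarrow> 'p \<Rightarrow> real) \<Rightarrow>
   ('g \<Rightarrow> 'p \<Rightarrow> 'p) \<Rightarrow> 'p set \<Rightarrow> bool" where
  "admissible_K G Gs bs X d act K \<longleftrightarrow> finite_subtree X d K \<and>
     (\<forall>i<length Gs. \<forall>x\<in>X. fixes_point act (Gs ! i) x \<longrightarrow> x \<in> K) \<and>
     (\<forall>j<length bs. K \<inter> act (bs ! j) ` K \<noteq> {})"

definition geometric ::
  "('g, 'm) monoid_scheme \<Rightarrow> 'g set list \<Rightarrow> 'g list \<Rightarrow> 'p itself \<Rightarrow>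
   'q set \<Rightarrow> ('q \<Rightarrow> 'q \<Rightarrow> real) \<Rightarrow> ('g \<Rightarrow> 'q \<Rightarrow> 'q) \<Rightarrow> bool" where
  "geometric G Gs bs (_ :: 'p itself) Y dY actY \<longleftrightarrow>
     (\<exists>(X :: 'p set) d act K \<phi>. GF_tree G Gs X d act \<and> admissible_K G Gs bs X d act K \<and>
        bij_betw \<phi> Y (TK_carrier G Gs bs d act K) \<and>
        (\<forall>y\<in>Y. \<forall>y'\<in>Y. TK_dist G Gs bs d act K (\<phi> y) (\<phi> y') = dY y y') \<and>
        (\<forall>g\<in>carrier G. \<forall>y\<in>Y. \<phi> (actY g y) = TK_act G act g (\<phi> y)))"

end

theory Submission
  imports Defs
begin

text \<open>
  An \<open>\<real>\<close>-tree is a 0-hyperbolic metric space in which intermediate points exist; in this form all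
  trees are handled by inequalities between distances. The space \<open>\<Sigma>\<close> is a tree of trees over the
  Bass-Serre tree \<open>S\<close>: the trees \<open>K\<^sub>v\<close> are glued along the sets \<open>K\<^sub>v \<inter> K\<^sub>w\<close>, which have
  nearest-point gates. Normal forms in the free product root \<open>S\<close> at \<open>v\<^sub>0\<close>, and the pseudo-distance
  \<open>\<delta>\<close> is computed by retracting the deeper of two points through the gate to its parent; the
  four-point condition follows by induction on the depth. So \<open>T\<^sub>K\<close> is an \<open>\<real>\<close>-tree, and the projection
  to \<open>T\<close> is isometric on translates of \<open>K\<close>, which connect any two points of \<open>T\<^sub>K\<close> by finite chains.

  For the approximation take \<open>x\<^sub>0\<close> on the axis of a hyperbolic element (if there is none, \<open>T\<close> is a point)
  and let \<open>K\<^sub>n\<close> be the hull of \<open>W\<^sub>n x\<^sub>0\<close>, where the finite sets \<open>W\<^sub>n\<close> are closed under suffixes and exhaust \<open>G\<close>.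
  Suffix-closedness identifies \<open>(w x\<^sub>0, w v\<^sub>0)\<close> with \<open>(w x\<^sub>0, v\<^sub>0)\<close>; hence \<open>T\<^sub>K\<close> is the hull of one orbit,
  that of a point on an axis, and is minimal. For every \<open>g\<close>, the translate \<open>g K\<^sub>n\<close> is eventually absorbed
  in \<open>K\<^sub>m\<close> inside \<open>T\<^sub>K\<^sub>m\<close>. Together with the chains this gives strong convergence. If \<open>H\<close> fixes \<open>x\<close>,
  absorbing \<open>x\<close> for the finitely many conjugators and free generators of a Kurosh decomposition makes
  the point of \<open>T\<^sub>K\<^sub>m\<close> over \<open>x\<close> fixed by \<open>H\<close>.
\<close>

section \<open>Real trees as 0-hyperbolic spaces\<close>

text \<open>The obstacle is minimality. Such a path is available once the intermediate translates
  meet K in the right points, whence the closure under suffixes; letters are prepended because left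
  translation acts on T_K. Gates turn the infimum in delta into a minimum. Distances in T_K are thus
  witnessed by finite paths, which stay in Sigma under translation and under enlarging K. Invariance
  and the maps between the T_K rest on these paths, since the recursion for delta depends on the
  root and on K. Finite Kurosh rank suffices although the H_j may be infinitely generated: g v_0 is
  adjacent to a vertex stabilised by all of g G_i g^-1, so identifying (x, g v_0) with (x, v_0)
  treats all elements of g H_j g^-1 at once. If every element of G is elliptic, Serre's argument
  applies, because finitely many pieces with fixed points generate G.\<close>

lemma is_metricD:
  assumes "is_metric X d"
  shows "\<And>x y. x \<in> X \<Longrightarrow> y \<in> X \<Longrightarrow> d x y = d y x"
    "\<And>x y. x \<in> X \<Longrightarrow> y \<in> X \<Longrightarrow> d x y = 0 \<longleftrightarrow> x = y"
    "\<And>x y z. x \<in> X \<Longrightarrow> y \<in> X \<Longrightarrow> z \<in> X \<Longrightarrow> d x z \<le> d x y + d y z"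
    "\<And>x y. x \<in> X \<Longrightarrow> y \<in> X \<Longrightarrow> 0 \<le> d x y"
proof -
  show 1: "\<And>x y. x \<in> X \<Longrightarrow> y \<in> X \<Longrightarrow> d x y = d y x"
    "\<And>x y. x \<in> X \<Longrightarrow> y \<in> X \<Longrightarrow> d x y = 0 \<longleftrightarrow> x = y"
    "\<And>x y z. x \<in> X \<Longrightarrow> y \<in> X \<Longrightarrow> z \<in> X \<Longrightarrow> d x z \<le> d x y + d y z"
    using assms unfolding is_metric_def by blast+
  show "0 \<le> d x y" if "x \<in> X" "y \<in> X" for x y
    using 1(1)[OF that] 1(3)[OF that(1) that(2) that(1)] 1(2)[OF that(1) that(1)] by simp
qed

locale metric_on =
  fixes X :: "'p set" and d :: "'p \<Rightarrow> 'p \<Rightarrow> real"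
  assumes metric: "is_metric X d"
begin

lemma sym: "x \<in> X \<Longrightarrow> y \<in> X \<Longrightarrow> d x y = d y x"
  and zero: "x \<in> X \<Longrightarrow> y \<in> X \<Longrightarrow> d x y = 0 \<longleftrightarrow> x = y"
  and tri: "x \<in> X \<Longrightarrow> y \<in> X \<Longrightarrow> z \<in> X \<Longrightarrow> d x z \<le> d x y + d y z"
  and nonneg: "x \<in> X \<Longrightarrow> y \<in> X \<Longrightarrow> 0 \<le> d x y"
  using is_metricD[OF metric] by blast+

lemma refl0: "x \<in> X \<Longrightarrow> d x x = 0"
  using zero by blast

definition btw :: "'p \<Rightarrow> 'p \<Rightarrow> 'p \<Rightarrow> bool" where
  "btw x m y \<longleftrightarrow> m \<in> X \<and> d x m + d m y = d x y"

lemma btw_in: "btw x m y \<Longrightarrow> m \<in> X"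
  and btw_eq: "btw x m y \<Longrightarrow> d x m + d m y = d x y"
  by (auto simp: btw_def)

lemma btw_sym: "btw x m y \<longleftrightarrow> btw y m x" if "x \<in> X" "y \<in> X"
  using that sym unfolding btw_def by (metis add.commute)

lemma btw_left: "x \<in> X \<Longrightarrow> btw x x y"
  and btw_right: "y \<in> X \<Longrightarrow> btw x y y"
  by (simp_all add: btw_def refl0)

lemma btwI: "m \<in> X \<Longrightarrow> x \<in> X \<Longrightarrow> y \<in> X \<Longrightarrow> d x m + d m y \<le> d x y \<Longrightarrow> btw x m y"
  unfolding btw_def using tri[of x m y] by auto

lemma btw_inner:
  assumes "x \<in> X" "y \<in> X" "btw x m y" "btw x a m"
  shows "btw x a y" "btw a m y"
proof -
  have *: "m \<in> X" "a \<in> X" using assms by (auto simp: btw_def)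
  have "d x a + d a m + d m y = d x y" using assms by (auto simp: btw_def)
  moreover have "d a y \<le> d a m + d m y" "d x y \<le> d x a + d a y" using * assms tri by auto
  ultimately have "d a y = d a m + d m y" by linarith
  then show "btw x a y" "btw a m y"
    using * \<open>d x a + d a m + d m y = d x y\<close> by (auto simp: btw_def)
qed

definition convex_in :: "'p set \<Rightarrow> bool" where
  "convex_in C \<longleftrightarrow> C \<subseteq> X \<and> (\<forall>x\<in>C. \<forall>y\<in>C. \<forall>m. btw x m y \<longrightarrow> m \<in> C)"

text \<open>Geodesics are handled through their points: in a 0-hyperbolic space the intermediate points
  between \<^term>\<open>x\<close> and \<^term>\<open>y\<close> are unique and assemble into a geodesic.\<close>

definition geod :: "'p \<Rightarrow> 'p \<Rightarrow> bool" where
  "geod x y \<longleftrightarrow> (\<forall>t. 0 \<le> t \<and> t \<le> d x y \<longrightarrow> (\<exists>m\<in>X. d x m = t \<and> d m y = d x y - t))"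

end

locale hyperbolic0 = metric_on +
  assumes four_point: "x \<in> X \<Longrightarrow> y \<in> X \<Longrightarrow> z \<in> X \<Longrightarrow> w \<in> X \<Longrightarrow>
    d x y + d z w \<le> max (d x z + d y w) (d x w + d y z)"
begin

text \<open>With \<open>a = d x m\<close>, \<open>a' = d x m'\<close> and \<open>L = d x y\<close>,
  the two alternatives of the four-point condition for x, y, m, m' read L + a - a' and L + a' - a,
  which bounds \<open>d m m'\<close> by the difference of positions. The triangle inequality gives
  the converse.\<close>

lemma btw_dist:
  assumes "x \<in> X" "y \<in> X" "btw x m y" "btw x m' y"
  shows "d m m' = \<bar>d x m - d x m'\<bar>"
proof -
  have i: "m \<in> X" "m' \<in> X" using assms by (auto simp: btw_def)
  have "d x y + d m m' \<le> max (d x m + d y m') (d x m' + d y m)"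
    using four_point i assms by auto
  moreover have "d x m + d m y = d x y" "d x m' + d m' y = d x y" "d y m' = d m' y" "d y m = d m y"
    using assms i by (auto simp: btw_def sym)
  moreover have "d x m \<le> d x m' + d m' m" "d x m' \<le> d x m + d m m'" "d m m' = d m' m"
    using tri[of x m' m] tri[of x m m'] sym[of m m'] i assms by auto
  ultimately show ?thesis by (auto simp: max_def abs_if split: if_splits)
qed

lemma btw_unique:
  assumes "x \<in> X" "y \<in> X" "btw x m y" "btw x m' y" "d x m = d x m'"
  shows "m = m'"
  using btw_dist[OF assms(1-4)] assms zero[of m m'] by (simp add: btw_in)

text \<open>Thinness of triangles: each side is covered by the other two. In the four-point
  condition for x, y, m, c the distance \<open>d x y\<close> splits as \<open>d x m + d m y\<close>
  and cancels.\<close>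

lemma btw_cover:
  assumes "x \<in> X" "y \<in> X" "c \<in> X" "btw x m y"
  shows "btw x m c \<or> btw c m y"
proof -
  have m: "m \<in> X" using assms by (auto simp: btw_def)
  have "d x y + d m c \<le> max (d x m + d y c) (d x c + d y m)"
    using four_point m assms by auto
  moreover have "d x m + d m y = d x y" "d m c = d c m" "d y m = d m y" "d y c = d c y"
    using assms m by (auto simp: btw_def sym)
  ultimately have "d x m + d m c \<le> d x c \<or> d c m + d m y \<le> d c y"
    by (auto simp: max_def split: if_splits)
  then show ?thesis using btwI m assms by blast
qed

text \<open>The overlap [b,c] has positive length, which excludes the alternative
  \<open>d a b + d c e\<close> in the four-point condition: it would force \<open>d b c\<close> to
  vanish.\<close>

lemma btw_local_to_global:
  assumes "a \<in> X" "e \<in> X" "b \<in> X" "btw a b c" "btw b c e" "b \<noteq> c"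
  shows "d a e = d a b + d b c + d c e" "btw a b e" "btw a c e"
proof -
  have i: "c \<in> X" using assms by (auto simp: btw_def)
  have "d a c + d b e \<le> max (d a b + d c e) (d a e + d c b)"
    using four_point i assms by auto
  moreover have "d a b + d b c = d a c" "d b c + d c e = d b e" "d c b = d b c"
    using assms i by (auto simp: btw_def sym)
  moreover have "0 < d b c" using assms i nonneg[of b c] zero[of b c] by linarith
  moreover have "d a e \<le> d a b + d b e" using tri assms by auto
  ultimately show "d a e = d a b + d b c + d c e"
    by (auto simp: max_def split: if_splits)
  then show "btw a b e" "btw a c e"
    using assms i \<open>d b c + d c e = d b e\<close> \<open>d a b + d b c = d a c\<close> by (auto simp: btw_def)
qed

lemma geod_sym: "geod x y \<Longrightarrow> x \<in> X \<Longrightarrow> y \<in> X \<Longrightarrow> geod y x"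
  unfolding geod_def
proof (intro allI impI)
  fix t assume a: "\<forall>t. 0 \<le> t \<and> t \<le> d x y \<longrightarrow> (\<exists>m\<in>X. d x m = t \<and> d m y = d x y - t)"
    "x \<in> X" "y \<in> X" "0 \<le> t \<and> t \<le> d y x"
  then have "0 \<le> d x y - t \<and> d x y - t \<le> d x y" using sym by auto
  then obtain m where "m \<in> X" "d x m = d x y - t" "d m y = d x y - (d x y - t)" using a by blast
  then show "\<exists>m\<in>X. d y m = t \<and> d m x = d y x - t" using a sym by (intro bexI[of _ m]) auto
qed

text \<open>The bound on t is the Gromov product of y and z at x. Up to that length [x,y] and [x,z]
  have to coincide, so the point at distance t on [x,y] serves for z as well.\<close>

lemma geod_trans_aux:
  assumes "x \<in> X" "y \<in> X" "z \<in> X" "geod x y" "0 \<le> t" "2 * t \<le> d x y + d x z - d y z"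
  shows "\<exists>m\<in>X. d x m = t \<and> d m z = d x z - t"
proof -
  have "t \<le> d x y" using assms tri[of x y z] by auto
  then obtain m where m: "m \<in> X" "d x m = t" "d m y = d x y - t"
    using assms unfolding geod_def by blast
  have "d x y + d m z \<le> max (d x m + d y z) (d x z + d y m)"
    using four_point m assms by auto
  moreover have "d y m = d m y" using m assms sym by auto
  moreover have "d x z \<le> d x m + d m z" using tri m assms by auto
  ultimately have "d m z = d x z - t" using m assms by (auto simp: max_def split: if_splits)
  then show ?thesis using m by blast
qed

text \<open>Either t is below the Gromov product at x, or its complement is below the one at z, so
  each new point comes from one of the given geodesics. Geodesics of T_K are assembled in this way
  from chains.\<close>

lemma geod_trans:
  assumes "x \<in> X" "y \<in> X" "z \<in> X" "geod x y" "geod y z"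
  shows "geod x z"
  unfolding geod_def
proof (intro allI impI)
  fix t assume t: "0 \<le> t \<and> t \<le> d x z"
  show "\<exists>m\<in>X. d x m = t \<and> d m z = d x z - t"
  proof (cases "2 * t \<le> d x y + d x z - d y z")
    case True then show ?thesis using geod_trans_aux assms t by blast
  next
    case False
    have s: "d z y = d y z" "d z x = d x z" "d y x = d x y" using assms sym by auto
    have "\<exists>m\<in>X. d z m = d z x - t \<and> d m x = d z x - (d z x - t)"
      by (rule geod_trans_aux[of z y x]) (use assms t s False in \<open>auto intro: geod_sym\<close>)
    then show ?thesis using assms sym s by force
  qed
qed

text \<open>The point x lies on [a,a'] or on [a',b], and [a,a'] is too short to reach it.\<close>

lemma btw_replace_end:
  assumes "a \<in> X" "b \<in> X" "a' \<in> X" "btw a x b" "d a a' < d a x"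
  shows "btw a' x b"
proof -
  have "\<not> btw a x a'"
    using assms nonneg[of x a'] by (auto simp: btw_def)
  then show ?thesis using btw_cover assms by blast
qed

end

locale ztree = hyperbolic0 +
  assumes nonempty: "X \<noteq> {}"
  and geodesic: "x \<in> X \<Longrightarrow> y \<in> X \<Longrightarrow> geod x y"
begin

lemma intermediate:
  assumes "x \<in> X" "y \<in> X" "0 \<le> t" "t \<le> d x y"
  obtains m where "btw x m y" "d x m = t" "d m y = d x y - t"
proof -
  obtain m where "m \<in> X" "d x m = t" "d m y = d x y - t"
    using geodesic[OF assms(1,2)] assms unfolding geod_def by blast
  then show ?thesis by (intro that) (auto simp: btw_def)
qed

lemma median:
  assumes "x \<in> X" "y \<in> X" "z \<in> X"
  obtains c where "btw x c y" "btw y c z" "btw x c z"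
proof -
  \<comment> \<open>The Gromov product of y and z at x, which is the distance from x to the
    median.\<close>
  let ?t = "(d x y + d x z - d y z) / 2"
  have t: "0 \<le> ?t" "?t \<le> d x y" using tri[of y x z] tri[of x y z] assms sym by auto
  then obtain c where c: "btw x c y" "d x c = ?t" "d c y = d x y - ?t"
    using intermediate assms by metis
  have i: "c \<in> X" using c by (auto simp: btw_def)
  have "d x y + d c z \<le> max (d x c + d y z) (d x z + d y c)" using four_point i assms by auto
  moreover have s: "d y c = d c y" using sym i assms by auto
  ultimately have "d c z \<le> d x z - ?t" using c by (auto simp: max_def field_simps split: if_splits)
  then have "btw x c z" "btw y c z"
    using i c s assms by (auto intro!: btwI simp: field_simps)
  then show ?thesis using that c by blast
qed

lemma geodesic_segments_eq:
  assumes "x \<in> X" "y \<in> X"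
  shows "geodesic_segments X d x y = {{m. btw x m y}}"
proof -
  let ?B = "{m. btw x m y}"
  have 1: "S = ?B" if S: "S \<in> geodesic_segments X d x y" for S
  proof -
    obtain \<gamma> where g: "S = \<gamma> ` {0..d x y}" "\<gamma> 0 = x" "\<gamma> (d x y) = y" "\<gamma> ` {0..d x y} \<subseteq> X"
      "\<forall>s\<in>{0..d x y}. \<forall>t\<in>{0..d x y}. d (\<gamma> s) (\<gamma> t) = \<bar>s - t\<bar>"
      using S unfolding geodesic_segments_def by blast
    have n: "0 \<le> d x y" using assms nonneg by auto
    have gb: "btw x (\<gamma> t) y \<and> d x (\<gamma> t) = t" if "t \<in> {0..d x y}" for t
    proof -
      have "d (\<gamma> 0) (\<gamma> t) = t" "d (\<gamma> t) (\<gamma> (d x y)) = d x y - t"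
        using g(5) that n by auto
      then show ?thesis using g that by (auto simp: btw_def)
    qed
    show ?thesis
    proof
      show "S \<subseteq> ?B" using gb g by auto
      show "?B \<subseteq> S"
      proof
        fix m assume m: "m \<in> ?B"
        then have "m \<in> X" "d x m + d m y = d x y" by (auto simp: btw_def)
        then have "d x m \<in> {0..d x y}" using nonneg[of x m] nonneg[of m y] assms by auto
        then have "m = \<gamma> (d x m)" using btw_unique[of x y m "\<gamma> (d x m)"] gb m assms by auto
        then show "m \<in> S" using g \<open>d x m \<in> _\<close> by blast
      qed
    qed
  qed
  have "\<exists>m. btw x m y \<and> d x m = t" if "t \<in> {0..d x y}" for t
    using intermediate assms that by (metis atLeastAtMost_iff)
  then obtain \<gamma> where g: "\<And>t. t \<in> {0..d x y} \<Longrightarrow> btw x (\<gamma> t) y \<and> d x (\<gamma> t) = t" by metis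
  have n: "0 \<le> d x y" using assms nonneg by auto
  have "\<gamma> ` {0..d x y} \<in> geodesic_segments X d x y"
    unfolding geodesic_segments_def
  proof (intro CollectI exI[of _ \<gamma>] conjI)
    show "\<gamma> 0 = x" using g[of 0] n zero[of x "\<gamma> 0"] assms by (auto simp: btw_def)
    show "\<gamma> (d x y) = y" using g[of "d x y"] n zero[of "\<gamma> (d x y)" y] assms by (auto simp: btw_def)
    show "\<gamma> ` {0..d x y} \<subseteq> X" using g by (auto simp: btw_def)
    show "\<forall>s\<in>{0..d x y}. \<forall>t\<in>{0..d x y}. d (\<gamma> s) (\<gamma> t) = \<bar>s - t\<bar>"
      using g btw_dist[OF assms] by metis
  qed simp
  then have "{m. btw x m y} \<in> geodesic_segments X d x y" using 1 by metis
  then show ?thesis using 1 by blast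
qed

lemma seg_eq: "x \<in> X \<Longrightarrow> y \<in> X \<Longrightarrow> seg X d x y = {m. btw x m y}"
  unfolding seg_def by (simp add: geodesic_segments_eq)

lemma R_tree: "R_tree X d"
  unfolding R_tree_def
proof (intro conjI ballI impI)
  show "X \<noteq> {}" by (rule nonempty)
  show "is_metric X d" by (rule metric)
  show "\<exists>!S. S \<in> geodesic_segments X d x y" if "x \<in> X" "y \<in> X" for x y
    using that by (simp add: geodesic_segments_eq)
  fix x y z assume i: "x \<in> X" "y \<in> X" "z \<in> X" and a: "seg X d x y \<inter> seg X d y z = {y}"
  obtain c where c: "btw x c y" "btw y c z" "btw x c z" using median i by blast
  then have "c = y" using a i by (auto simp: seg_eq)
  then have b: "btw x y z" using c by simp
  have "btw x m z" if "btw x m y" for m using btw_inner(1)[OF i(1,3) b that] .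
  moreover have "btw x m z" if "btw y m z" for m
    using btw_inner(1)[of z x y m] that b i btw_sym[of x z y] btw_sym[of y z m] btw_sym[of x z m] by blast
  moreover have "btw x m y \<or> btw y m z" if "btw x m z" for m
    using btw_cover[of x z y m] i that by blast
  ultimately show "seg X d x y \<union> seg X d y z = seg X d x z"
    unfolding seg_eq[OF i(1,2)] seg_eq[OF i(2,3)] seg_eq[OF i(1,3)] by blast
qed

end

text \<open>The point of the classical argument: the common part of \<open>[x,y]\<close> and \<open>[x,z]\<close> is a closed
  segment \<open>[x,c]\<close>, and then \<open>[y,c]\<close> and \<open>[c,z]\<close> meet only in \<open>c\<close>, so they concatenate.\<close>

lemma R_tree_ztree:
  assumes R: "R_tree X d"
  shows "ztree X d"
proof -
  have met: "is_metric X d" and ne: "X \<noteq> {}" using R by (auto simp: R_tree_def)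
  interpret metric_on X d by unfold_locales (rule met)
  have segG: "seg X d x y \<in> geodesic_segments X d x y" if "x \<in> X" "y \<in> X" for x y
  proof -
    have "\<exists>!S. S \<in> geodesic_segments X d x y" using R that by (simp add: R_tree_def)
    then show ?thesis unfolding seg_def by (rule theI')
  qed
  have segU: "S = seg X d x y" if "x \<in> X" "y \<in> X" "S \<in> geodesic_segments X d x y" for x y S
  proof -
    have "\<exists>!S. S \<in> geodesic_segments X d x y" using R that by (simp add: R_tree_def)
    then show ?thesis using that(3) segG[OF that(1,2)] by (metis (no_types))
  qed
  define isg where "isg x y \<gamma> \<longleftrightarrow> seg X d x y = \<gamma> ` {0..d x y} \<and> \<gamma> 0 = x \<and> \<gamma> (d x y) = y \<and> \<gamma> ` {0..d x y} \<subseteq> X \<and>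
        (\<forall>s\<in>{0..d x y}. \<forall>t\<in>{0..d x y}. d (\<gamma> s) (\<gamma> t) = \<bar>s - t\<bar>)" for x y \<gamma>
  define par where "par x y = (SOME \<gamma>. isg x y \<gamma>)" for x y
  have par: "isg x y (par x y)" if xy: "x \<in> X" "y \<in> X" for x y
  proof -
    have "\<exists>\<gamma>. isg x y \<gamma>"
      using segG[OF xy] unfolding isg_def geodesic_segments_def by blast
    then show ?thesis unfolding par_def by (rule someI_ex)
  qed
  have parS: "seg X d x y = par x y ` {0..d x y}" and par0: "par x y 0 = x" and par1: "par x y (d x y) = y"
    and parX: "0 \<le> t \<Longrightarrow> t \<le> d x y \<Longrightarrow> par x y t \<in> X"
    and pard: "0 \<le> s \<Longrightarrow> s \<le> d x y \<Longrightarrow> 0 \<le> t \<Longrightarrow> t \<le> d x y \<Longrightarrow> d (par x y s) (par x y t) = \<bar>s - t\<bar>"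
    if "x \<in> X" "y \<in> X" for x y s t
    using par[OF that] unfolding isg_def by (blast, blast, blast, force, force)
  have pardl: "d x (par x y t) = t" and pardr: "d (par x y t) y = d x y - t"
    if "x \<in> X" "y \<in> X" "0 \<le> t" "t \<le> d x y" for x y t
    using pard[OF that(1,2), of 0 t] pard[OF that(1,2), of t "d x y"] par0[OF that(1,2)] par1[OF that(1,2)]
      nonneg[OF that(1,2)] that(3,4) by simp_all
  have seg_btw: "btw x m y" if ii: "x \<in> X" "y \<in> X" "m \<in> seg X d x y" for x y m
  proof -
    obtain t where "0 \<le> t" "t \<le> d x y" "m = par x y t" using parS[OF ii(1,2)] ii by auto
    then show ?thesis using parX[OF ii(1,2)] pardl[OF ii(1,2)] pardr[OF ii(1,2)] by (simp add: btw_def)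
  qed
  have inter: "\<exists>m. m \<in> seg X d x y \<and> d x m = t" if ii: "x \<in> X" "y \<in> X" "0 \<le> t" "t \<le> d x y" for x y t
  proof (intro exI conjI)
    show "par x y t \<in> seg X d x y" using parS[OF ii(1,2)] ii by simp
    show "d x (par x y t) = t" using pardl ii by blast
  qed
  have geod: "geod x y" if ii: "x \<in> X" "y \<in> X" for x y
    unfolding geod_def
  proof (intro allI impI)
    fix t assume "0 \<le> t \<and> t \<le> d x y"
    then obtain m where "m \<in> seg X d x y" "d x m = t" using inter ii by blast
    then show "\<exists>m\<in>X. d x m = t \<and> d m y = d x y - t"
      using seg_btw[OF ii] by (intro bexI[of _ m]) (force simp: btw_def)+
  qed
  \<comment> \<open>The broken path through m is 1-Lipschitz and its length is the distance of its
    ends, so it is a geodesic. Uniqueness of segments then puts m on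
    \<open>seg X d x y\<close>.\<close>
  have btw_seg: "m \<in> seg X d x y" if i: "x \<in> X" "y \<in> X" "btw x m y" for x y m
  proof -
    have m: "m \<in> X" "d x m + d m y = d x y" using i by (auto simp: btw_def)
    define \<gamma> where "\<gamma> t = (if t \<le> d x m then par x m t else par m y (t - d x m))" for t
    have n: "0 \<le> d x m" "0 \<le> d m y" using m i nonneg by auto
    have g: "\<gamma> t \<in> X" if "t \<in> {0..d x y}" for t
      using parX[OF i(1) m(1), of t] parX[OF m(1) i(2), of "t - d x m"] that m(2) unfolding \<gamma>_def by simp
    have g0: "\<gamma> 0 = x" using n par0[OF i(1) m(1)] by (simp add: \<gamma>_def)
    have g1: "\<gamma> (d x y) = y"
    proof (cases "d m y = 0")
      case True then have "m = y" using zero m i by auto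
      then show ?thesis using par1[OF i(1) m(1)] by (simp add: \<gamma>_def)
    next
      case False
      then have "\<not> d x y \<le> d x m" "d x y - d x m = d m y" using m n by auto
      then show ?thesis using par1[OF m(1) i(2)] by (simp add: \<gamma>_def)
    qed
    have gm: "\<gamma> (d x m) = m" using par1[OF i(1) m(1)] by (simp add: \<gamma>_def)
    have lip: "d (\<gamma> s) (\<gamma> t) \<le> t - s" if "0 \<le> s" "s \<le> t" "t \<le> d x y" for s t
    proof -
      consider "t \<le> d x m" | "d x m < s" | "s \<le> d x m" "d x m < t" by linarith
      then show ?thesis
      proof cases
        case 1 then have "d (par x m s) (par x m t) = \<bar>s - t\<bar>" using pard[OF i(1) m(1), of s t] that by simp
        then show ?thesis using 1 that by (simp add: \<gamma>_def)
      next
        case 2 then have "d (par m y (s - d x m)) (par m y (t - d x m)) = \<bar>(s - d x m) - (t - d x m)\<bar>"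
          using pard[OF m(1) i(2), of "s - d x m" "t - d x m"] that m(2) n by simp
        then show ?thesis using 2 that by (simp add: \<gamma>_def)
      next
        case 3
        have a: "d (\<gamma> s) m = d x m - s" using pardr[OF i(1) m(1), of s] 3 that by (simp add: \<gamma>_def)
        have b: "d m (\<gamma> t) = t - d x m" using pardl[OF m(1) i(2), of "t - d x m"] 3 that m(2) by (simp add: \<gamma>_def)
        have "d (\<gamma> s) (\<gamma> t) \<le> d (\<gamma> s) m + d m (\<gamma> t)" using tri g m that by auto
        then show ?thesis using a b by simp
      qed
    qed
    have iso: "d (\<gamma> s) (\<gamma> t) = t - s" if st: "0 \<le> s" "s \<le> t" "t \<le> d x y" for s t
    proof -
      have i3: "\<gamma> s \<in> X" "\<gamma> t \<in> X" using g st by auto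
      have "d x y \<le> d x (\<gamma> s) + d (\<gamma> s) y" "d (\<gamma> s) y \<le> d (\<gamma> s) (\<gamma> t) + d (\<gamma> t) y"
        using tri i3 i by auto
      moreover have "d x (\<gamma> s) \<le> s" using lip[of 0 s] g0 st by auto
      moreover have "d (\<gamma> t) y \<le> d x y - t" using lip[of t "d x y"] g1 st by auto
      ultimately show ?thesis using lip[OF st] by linarith
    qed
    have "\<gamma> ` {0..d x y} \<in> geodesic_segments X d x y"
      unfolding geodesic_segments_def
    proof (intro CollectI exI[of _ \<gamma>] conjI ballI)
      fix s t assume "s \<in> {0..d x y}" "t \<in> {0..d x y}"
      then show "d (\<gamma> s) (\<gamma> t) = \<bar>s - t\<bar>"
        using iso[of s t] iso[of t s] sym[of "\<gamma> s" "\<gamma> t"] g by (cases "s \<le> t") auto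
    qed (use g0 g1 g in auto)
    then have "\<gamma> ` {0..d x y} = seg X d x y" using segU i by blast
    moreover have "d x m \<in> {0..d x y}" using n m by auto
    then have "\<gamma> (d x m) \<in> \<gamma> ` {0..d x y}" by (rule imageI)
    ultimately show ?thesis using gm by simp
  qed
  have dist: "d m m' = \<bar>d x m - d x m'\<bar>" if ii: "x \<in> X" "y \<in> X" "btw x m y" "btw x m' y" for x y m m'
  proof -
    have "m \<in> par x y ` {0..d x y}" "m' \<in> par x y ` {0..d x y}"
      using btw_seg[OF ii(1,2,3)] btw_seg[OF ii(1,2,4)] by (simp_all add: parS[OF ii(1,2)])
    then obtain t t' where t: "0 \<le> t" "t \<le> d x y" "m = par x y t" "0 \<le> t'" "t' \<le> d x y" "m' = par x y t'"
      by (auto elim!: imageE)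
    then have "d x m = t" "d x m' = t'" using pardl[OF ii(1,2)] by auto
    then show ?thesis using pard[OF ii(1,2) t(1,2,4,5)] t ii by simp
  qed
  have med: "\<exists>c. btw x c y \<and> btw x c z \<and> btw y c z" if i: "x \<in> X" "y \<in> X" "z \<in> X" for x y z
  proof -
    define A where "A = {t. 0 \<le> t \<and> (\<exists>m. btw x m y \<and> btw x m z \<and> d x m = t)}"
    have A0: "0 \<in> A" using i btw_left refl0 by (auto simp: A_def)
    have Ab: "t \<le> d x y \<and> t \<le> d x z" if "t \<in> A" for t
      using that i nonneg unfolding A_def btw_def by (smt (verit) mem_Collect_eq)
    have bdd: "bdd_above A" using Ab by (meson bdd_above.I)
    define s where "s = Sup A"
    have s: "0 \<le> s" "s \<le> d x y" "s \<le> d x z"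
      using A0 Ab bdd cSup_upper[of 0 A] cSup_least[of A "d x y"] cSup_least[of A "d x z"]
      unfolding s_def by auto
    obtain c where c: "btw x c y" "d x c = s" using inter[of x y s] i s seg_btw by blast
    obtain c' where c': "btw x c' z" "d x c' = s" using inter[of x z s] i s seg_btw by blast
    have ci: "c \<in> X" "c' \<in> X" using c c' by (auto simp: btw_def)
    \<comment> \<open>The supremum s is not known to be attained. A common point m at distance more
      than s - e/2 from x is close to both candidates, c on [x,y] and c' on [x,z], which forces them
      to coincide.\<close>
    have "d c c' \<le> e" if e: "0 < e" for e
    proof -
      obtain t where t: "t \<in> A" "s - e / 2 < t"
        using less_cSup_iff[OF _ bdd, of "s - e/2"] A0 \<open>0 < e\<close> unfolding s_def by auto
      then obtain m where m: "btw x m y" "btw x m z" "d x m = t" unfolding A_def by auto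
      have mi: "m \<in> X" using m by (auto simp: btw_def)
      have "t \<le> s" using t bdd cSup_upper unfolding s_def by auto
      then have "d c m \<le> e/2" "d m c' \<le> e/2"
        using dist[of x y c m] dist[of x z m c'] m c c' i t by auto
      then show ?thesis using tri[of c m c'] mi ci by auto
    qed
    then have "d c c' \<le> 0" using field_le_epsilon[of "d c c'" 0] by auto
    then have "c = c'" using zero nonneg ci by (metis order_antisym)
    then have cz: "btw x c z" using c' by simp
    have "seg X d y c \<inter> seg X d c z = {c}"
    proof
      show "{c} \<subseteq> seg X d y c \<inter> seg X d c z"
        using btw_seg ci i btw_left btw_right by auto
      show "seg X d y c \<inter> seg X d c z \<subseteq> {c}"
      proof
        fix m assume "m \<in> seg X d y c \<inter> seg X d c z"
        then have m: "btw y m c" "btw c m z" using seg_btw i ci by auto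
        have mi: "m \<in> X" using m by (auto simp: btw_def)
        have "btw y c x" using c i btw_sym by auto
        then have a: "btw m c x" "btw y m x" using btw_inner[of y x c m] m i by auto
        have "btw z m c" "btw z c x" using m cz i ci btw_sym by auto
        then have b: "btw z m x" using btw_inner[of z x c m] i by auto
        have "btw x m y" "btw x m z" using a b i btw_sym by auto
        then have "d x m \<in> A" using nonneg i mi by (auto simp: A_def)
        then have "d x m \<le> s" unfolding s_def using bdd cSup_upper by auto
        moreover have "d m c + d c x = d m x" using a by (auto simp: btw_def)
        ultimately have "d m c \<le> 0" using c sym mi ci i by auto
        then show "m \<in> {c}" using zero[of m c] nonneg[of m c] mi ci by auto
      qed
    qed
    then have "seg X d y c \<union> seg X d c z = seg X d y z"
      using R i ci unfolding R_tree_def by blast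
    then have "c \<in> seg X d y z" using btw_seg[of y c c] btw_right i ci by blast
    then show ?thesis using seg_btw i c cz by blast
  qed
  show ?thesis
  proof
    show "X \<noteq> {}" by (rule ne)
    show "geod x y" if "x \<in> X" "y \<in> X" for x y using geod that .
    fix x y z w assume i: "x \<in> X" "y \<in> X" "z \<in> X" "w \<in> X"
    obtain c where c: "btw x c y" "btw x c z" "btw y c z" using med[of x y z] i by blast
    obtain e where e: "btw x e y" "btw x e w" "btw y e w" using med[of x y w] i by blast
    have ei: "c \<in> X" "e \<in> X" using c e by (auto simp: btw_def)
    have eqs: "d x c + d c z = d x z" "d x c + d c y = d x y" "d y c + d c z = d y z"
      "d x e + d e y = d x y" "d x e + d e w = d x w" "d y e + d e w = d y w"
      using c e by (auto simp: btw_def)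
    have ce: "d c e = \<bar>d x c - d x e\<bar>" using dist c e i by blast
    have s: "d e c = d c e" "d c z = d z c" "d e y = d y e" "d y c = d c y" using sym ei i by auto
    have t: "d z w \<le> d z c + d c w" "d c w \<le> d c e + d e w"
      "d z w \<le> d z e + d e w" "d z e \<le> d z c + d c e"
      using tri i ei s by auto
    \<comment> \<open>Both medians lie on [x,y]. Their order along it decides which of the two sums
      dominates.\<close>
    show "d x y + d z w \<le> max (d x z + d y w) (d x w + d y z)"
    proof (cases "d x c \<le> d x e")
      case True
      then have "d x y + d z w \<le> d x w + d y z" using eqs s ce t by linarith
      then show ?thesis by simp
    next
      case False
      then have "d x y + d z w \<le> d x z + d y w" using eqs s ce t by linarith
      then show ?thesis by simp
    qed
  qed
qed

section \<open>Gated subsets, finite hulls and subdivisions\<close>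

context ztree begin

text \<open>Gates are asked to be additive for distances rather than nearest, so that a gate enters
  computations as an equation. A convex set with nearest points has them, by
  \<open>nearest_gated\<close>.\<close>

definition gated :: "'a set \<Rightarrow> bool" where
  "gated C \<longleftrightarrow> C \<subseteq> X \<and> C \<noteq> {} \<and> (\<forall>x\<in>X. \<exists>g\<in>C. \<forall>z\<in>C. d x z = d x g + d g z)"

definition gate :: "'a set \<Rightarrow> 'a \<Rightarrow> 'a" where
  "gate C x = (SOME g. g \<in> C \<and> (\<forall>z\<in>C. d x z = d x g + d g z))"

lemma gate_spec:
  assumes "gated C" "x \<in> X"
  shows "gate C x \<in> C" "gate C x \<in> X" "z \<in> C \<Longrightarrow> d x z = d x (gate C x) + d (gate C x) z"
    "z \<in> C \<Longrightarrow> btw x (gate C x) z"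
proof -
  have "\<exists>g. g \<in> C \<and> (\<forall>z\<in>C. d x z = d x g + d g z)"
    using assms unfolding gated_def by blast
  then have *: "gate C x \<in> C \<and> (\<forall>z\<in>C. d x z = d x (gate C x) + d (gate C x) z)"
    unfolding gate_def by (rule someI_ex)
  have "C \<subseteq> X" using assms(1) unfolding gated_def by (rule conjunct1)
  then show 1: "gate C x \<in> C" "gate C x \<in> X" using conjunct1[OF *] by blast+
  show 2: "d x z = d x (gate C x) + d (gate C x) z" if "z \<in> C"
    using bspec[OF conjunct2[OF *] that] .
  show "btw x (gate C x) z" if "z \<in> C"
    using 1 2[OF that] unfolding btw_def by simp
qed

lemma gate_id:
  assumes "gated C" "x \<in> C"
  shows "gate C x = x"
proof -
  have x: "x \<in> X" using assms by (auto simp: gated_def)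
  have g: "gate C x \<in> X" using gate_spec assms x by blast
  have "d x x = d x (gate C x) + d (gate C x) x" using gate_spec(3)[OF assms(1) x assms(2)] .
  then have "d x (gate C x) = 0"
    using refl0[OF x] nonneg[OF x g] nonneg[OF g x] by linarith
  then show ?thesis using zero x g by metis
qed

text \<open>\<open>btw_local_to_global\<close> for x, its gate, the other gate and y: distinctness
  of the gates is the nondegenerate overlap.\<close>

lemma gates_distinct:
  assumes C: "gated C" and xy: "x \<in> X" "y \<in> X" and ne: "gate C x \<noteq> gate C y"
  shows "d x y = d x (gate C x) + d (gate C x) (gate C y) + d (gate C y) y"
    "btw x (gate C x) y" "btw x (gate C y) y"
proof -
  note gx = gate_spec[OF C xy(1)] and gy = gate_spec[OF C xy(2)]
  have 1: "btw x (gate C x) (gate C y)" by (rule gx(4)[OF gy(1)])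
  have 2: "btw (gate C x) (gate C y) y" using gy(4)[OF gx(1)] btw_sym gx(2) xy by blast
  show "d x y = d x (gate C x) + d (gate C x) (gate C y) + d (gate C y) y"
    "btw x (gate C x) y" "btw x (gate C y) y"
    using btw_local_to_global[OF xy gx(2) 1 2 ne] by auto
qed

lemma gated_convex:
  assumes "gated C"
  shows "convex_in C"
  unfolding convex_in_def
proof (intro conjI ballI allI impI)
  show "C \<subseteq> X" using assms by (simp add: gated_def)
  fix x y m assume i: "x \<in> C" "y \<in> C" "btw x m y"
  then have m: "m \<in> X" "x \<in> X" "y \<in> X" using assms by (auto simp: gated_def btw_def)
  note g = gate_spec[OF assms m(1)]
  have "d m x = d m (gate C m) + d (gate C m) x" "d m y = d m (gate C m) + d (gate C m) y"
    using g(3) i by blast+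
  moreover have "d x y \<le> d x (gate C m) + d (gate C m) y" "d x m + d m y = d x y"
    "d x m = d m x" "d x (gate C m) = d (gate C m) x"
    using btw_eq[OF i(3)] tri[OF m(2) g(2) m(3)] sym[OF m(2,1)] sym[OF m(2) g(2)] by simp_all
  ultimately have "d m (gate C m) = 0" using nonneg[OF m(1) g(2)] by linarith
  then show "m \<in> C" using zero[OF m(1) g(2)] g(1) by simp
qed

text \<open>The gate in A followed by the gate in B works: a geodesic from a point of A to a common
  point passes through its B-gate, which therefore stays in A by convexity.\<close>

lemma gated_inter:
  assumes A: "gated A" and B: "gated B" and ne: "A \<inter> B \<noteq> {}"
  shows "gated (A \<inter> B)"
  unfolding gated_def
proof (intro conjI ballI)
  show "A \<inter> B \<subseteq> X" using A by (auto simp: gated_def)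
  show "A \<inter> B \<noteq> {}" by (rule ne)
  fix x assume x: "x \<in> X"
  note a = gate_spec[OF A x]
  let ?a = "gate A x" let ?b = "gate B ?a"
  note b = gate_spec[OF B a(2)]
  have "btw ?a ?b z" if "z \<in> B" for z using b that by blast
  then have bA: "?b \<in> A" using gated_convex[OF A] ne a(1) unfolding convex_in_def by blast
  have "d x z = d x ?b + d ?b z" if z: "z \<in> A \<inter> B" for z
  proof -
    have "d x z = d x ?a + d ?a z" "d ?a z = d ?a ?b + d ?b z" using a(3) b(3) z by blast+
    moreover have "d x ?b = d x ?a + d ?a ?b" by (rule a(3)[OF bA])
    ultimately show ?thesis by simp
  qed
  then show "\<exists>g\<in>A \<inter> B. \<forall>z\<in>A \<inter> B. d x z = d x g + d g z" using bA b(1) by blast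
qed

text \<open>For z in C the median of x, g and z lies on [g,z], hence in C, and is no farther from x
  than g. So it equals g, and g lies on [x,z].\<close>

lemma nearest_gated:
  assumes C: "convex_in C" "C \<noteq> {}" and near: "\<And>x. x \<in> X \<Longrightarrow> \<exists>g\<in>C. \<forall>z\<in>C. d x g \<le> d x z"
  shows "gated C"
  unfolding gated_def
proof (intro conjI ballI)
  show CX: "C \<subseteq> X" using C by (simp add: convex_in_def)
  show "C \<noteq> {}" by (rule C)
  fix x assume x: "x \<in> X"
  obtain g where g: "g \<in> C" "\<forall>z\<in>C. d x g \<le> d x z" using near x by blast
  have "d x z = d x g + d g z" if z: "z \<in> C" for z
  proof -
    have i: "g \<in> X" "z \<in> X" using g z CX by blast+
    obtain m where m: "btw x m g" "btw g m z" "btw x m z" using median x i by blast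
    have "m \<in> C" using C m z g unfolding convex_in_def by blast
    then have "d x g \<le> d x m" using g by blast
    moreover have mi: "m \<in> X" "d x m + d m g = d x g" using m by (auto simp: btw_def)
    ultimately have "d m g = 0" using nonneg[of m g] i by linarith
    then have "m = g" using zero mi i by blast
    then show ?thesis using m btw_eq by fastforce
  qed
  then show "\<exists>g\<in>C. \<forall>z\<in>C. d x z = d x g + d g z" using g by blast
qed

lemma gated_seg:
  assumes "x \<in> X" "y \<in> X"
  shows "gated {m. btw x m y}"
  unfolding gated_def
proof (intro conjI ballI)
  show "{m. btw x m y} \<subseteq> X" by (auto simp: btw_def)
  show "{m. btw x m y} \<noteq> {}" using btw_left assms by blast
  fix z assume z: "z \<in> X"
  obtain c where c: "btw x c y" "btw y c z" "btw x c z" using median assms z by blast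
  have "d z m = d z c + d c m" if m: "btw x m y" for m
  proof -
    have i: "c \<in> X" "m \<in> X" using c m by (auto simp: btw_def)
    have "btw x m c \<or> btw c m y" using btw_cover assms i m by blast
    then have "btw z c m"
    proof
      assume h: "btw x m c"
      then show ?thesis
        using btw_inner(2)[of x z c m] c btw_sym[of m z c] assms z i by blast
    next
      assume "btw c m y"
      then have "btw y m c" using btw_sym assms i by blast
      then show ?thesis
        using btw_inner(2)[of y z c m] c btw_sym[of m z c] assms z i by blast
    qed
    then show ?thesis by (simp add: btw_def)
  qed
  then show "\<exists>g\<in>{m. btw x m y}. \<forall>w\<in>{m. btw x m y}. d z w = d z g + d g w" using c by blast
qed

definition tree_hull :: "'a set \<Rightarrow> 'a set" where
  "tree_hull P = (\<Union>x\<in>P. \<Union>y\<in>P. seg X d x y)"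

lemma tree_hull_iff:
  assumes "P \<subseteq> X"
  shows "m \<in> tree_hull P \<longleftrightarrow> (\<exists>x\<in>P. \<exists>y\<in>P. btw x m y)"
proof -
  have "m \<in> seg X d x y \<longleftrightarrow> btw x m y" if "x \<in> P" "y \<in> P" for x y
    using seg_eq[of x y] that assms by blast
  then show ?thesis unfolding tree_hull_def by blast
qed

lemma tree_hull_superset:
  assumes "P \<subseteq> X"
  shows "P \<subseteq> tree_hull P"
proof
  fix x assume "x \<in> P"
  then show "x \<in> tree_hull P" using tree_hull_iff[OF assms, of x] btw_left[of x x] assms by blast
qed

lemma tree_hull_mono: "P \<subseteq> Q \<Longrightarrow> tree_hull P \<subseteq> tree_hull Q"
  unfolding tree_hull_def by blast

text \<open>Let a lie on [p,q] and b on [r,s]. Thinness moves a point of [a,b] onto [a,p] or [p,b],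
  and in the latter case onto [p,r] or [r,b]; [a,p] and [r,b] are parts of the given
  segments.\<close>

lemma tree_hull_convex:
  assumes P: "P \<subseteq> X"
  shows "convex_in (tree_hull P)"
  unfolding convex_in_def
proof (intro conjI ballI allI impI)
  show "tree_hull P \<subseteq> X" using tree_hull_iff[OF P] by (auto simp: btw_def)
  fix a b m assume a: "a \<in> tree_hull P" and b: "b \<in> tree_hull P" and m: "btw a m b"
  obtain p q where p: "p \<in> P" "q \<in> P" "btw p a q" using a tree_hull_iff[OF P] by blast
  obtain r s where r: "r \<in> P" "s \<in> P" "btw r b s" using b tree_hull_iff[OF P] by blast
  have i: "p \<in> X" "q \<in> X" "r \<in> X" "s \<in> X" "a \<in> X" "b \<in> X" "m \<in> X"
    using p r P btw_in m by blast+
  have *: "m \<in> tree_hull P" if "u \<in> P" "w \<in> P" "btw u m w" for u w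
    using that tree_hull_iff[OF P] by blast
  consider "btw a m p" | "btw p m b" using btw_cover[of a b p m] i m by blast
  then show "m \<in> tree_hull P"
  proof cases
    case 1
    then have "btw p m q" using btw_inner(1)[of p q a m] i p btw_sym[of a p m] by blast
    then show ?thesis using * p by blast
  next
    case 2
    then consider "btw p m r" | "btw r m b" using btw_cover[of p b r m] i by blast
    then show ?thesis
    proof cases
      case 1 then show ?thesis using * p r by blast
    next
      case 2
      then have "btw r m s" using btw_inner(1)[of r s b m] i r by blast
      then show ?thesis using * r by blast
    qed
  qed
qed

text \<open>Finiteness provides nearest points: each segment has its own gate, and the closest of
  these finitely many gates minimises the distance to the hull.\<close>

lemma finite_tree_hull_gated:
  assumes P: "P \<subseteq> X" "finite P" "P \<noteq> {}"
  shows "gated (tree_hull P)"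
proof (rule nearest_gated)
  show "convex_in (tree_hull P)" using tree_hull_convex P by blast
  show "tree_hull P \<noteq> {}" using tree_hull_superset P by blast
  fix x assume x: "x \<in> X"
  define g where "g = (\<lambda>(p, q). gate {m. btw p m q} x)"
  have fin: "finite (P \<times> P)" "P \<times> P \<noteq> {}" using P by auto
  let ?D = "(\<lambda>u. d x (g u)) ` (P \<times> P)"
  have "finite ?D" "?D \<noteq> {}" using fin by blast+
  then have "Min ?D \<in> ?D" "\<forall>w\<in>P \<times> P. Min ?D \<le> d x (g w)" by (blast intro: Min_in, blast intro: Min_le)
  then obtain u where u: "u \<in> P \<times> P" "\<forall>w\<in>P \<times> P. d x (g u) \<le> d x (g w)" by force
  have gs: "g (p, q) \<in> {m. btw p m q}" "z \<in> {m. btw p m q} \<Longrightarrow> d x z = d x (g (p, q)) + d (g (p, q)) z"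
    if "p \<in> P" "q \<in> P" for p q z
  proof -
    have "p \<in> X" "q \<in> X" using that P by blast+
    then have "gated {m. btw p m q}" by (rule gated_seg)
    from gate_spec[OF this x] show "g (p, q) \<in> {m. btw p m q}"
      "z \<in> {m. btw p m q} \<Longrightarrow> d x z = d x (g (p, q)) + d (g (p, q)) z"
      unfolding g_def split by blast+
  qed
  obtain p q where pq: "u = (p, q)" "p \<in> P" "q \<in> P" using u by blast
  have "g u \<in> tree_hull P" using gs(1)[OF pq(2,3)] pq tree_hull_iff[OF P(1)] by blast
  moreover have "d x (g u) \<le> d x z" if z: "z \<in> tree_hull P" for z
  proof -
    obtain r s where rs: "r \<in> P" "s \<in> P" "btw r z s" using z tree_hull_iff[OF P(1), of z] by blast
    then have i: "z \<in> X" "g (r, s) \<in> X" using gs(1)[OF rs(1,2)] by (auto simp: btw_def)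
    have "d x z = d x (g (r, s)) + d (g (r, s)) z" using gs(2)[OF rs(1,2)] rs by blast
    moreover have "d x (g u) \<le> d x (g (r, s))" using u rs by blast
    ultimately show ?thesis using nonneg[OF i(2,1)] by linarith
  qed
  ultimately show "\<exists>g\<in>tree_hull P. \<forall>z\<in>tree_hull P. d x g \<le> d x z" by blast
qed

lemma gated_image:
  assumes C: "gated C" and iso: "\<And>x y. x \<in> X \<Longrightarrow> y \<in> X \<Longrightarrow> d (\<phi> x) (\<phi> y) = d x y" and surj: "\<phi> ` X = X"
  shows "gated (\<phi> ` C)"
  unfolding gated_def
proof (intro conjI ballI)
  have CX: "C \<subseteq> X" using C by (simp add: gated_def)
  then show "\<phi> ` C \<subseteq> X" using surj by blast
  show "\<phi> ` C \<noteq> {}" using C by (simp add: gated_def)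
  fix y assume "y \<in> X"
  then obtain x where x: "x \<in> X" "y = \<phi> x" using surj by blast
  obtain g where g: "g \<in> C" "\<forall>z\<in>C. d x z = d x g + d g z" using C x unfolding gated_def by blast
  have "d y (\<phi> z) = d y (\<phi> g) + d (\<phi> g) (\<phi> z)" if z: "z \<in> C" for z
  proof -
    have "z \<in> X" "g \<in> X" using z g(1) CX by blast+
    then show ?thesis using g(2) z x iso by simp
  qed
  then show "\<exists>g\<in>\<phi> ` C. \<forall>z\<in>\<phi> ` C. d y z = d y g + d g z" using g by blast
qed

lemma seg_cover_list:
  assumes "set qs \<subseteq> X" "length qs \<ge> 2" "btw (hd qs) m (last qs)"
  shows "\<exists>i. Suc i < length qs \<and> btw (qs ! i) m (qs ! Suc i)"
  using assms
proof (induction qs)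
  case (Cons a qs)
  show ?case
  proof (cases "length qs \<ge> 2")
    case False
    then have "length qs = 1" using Cons.prems(2) by simp
    then obtain b where "qs = [b]" by (auto simp: length_Suc_conv)
    then show ?thesis using Cons.prems by (intro exI[of _ 0]) auto
  next
    case True
    have i: "a \<in> X" "last qs \<in> X" "hd qs \<in> X" using True Cons.prems(1) by (cases qs; auto)+
    have "btw a m (last qs)" using Cons.prems True by (cases qs) auto
    then consider "btw a m (hd qs)" | "btw (hd qs) m (last qs)" using btw_cover i by blast
    then show ?thesis
    proof cases
      case 1 then show ?thesis using True by (intro exI[of _ 0]) (cases qs; auto)
    next
      case 2
      then obtain j where "Suc j < length qs" "btw (qs ! j) m (qs ! Suc j)"
        using Cons.IH Cons.prems True by auto
      then show ?thesis by (intro exI[of _ "Suc j"]) auto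
    qed
  qed
qed simp

text \<open>A chain from \<open>x\<close> to \<open>y\<close> on whose links \<open>f\<close> is isometric is projected onto \<open>[x,y]\<close>; each link
  of the projection is a single point or contained in the original link.\<close>

lemma subdivision_of_chain:
  assumes f: "f ` X \<subseteq> X'" and met: "is_metric X' d'"
    and qs: "set qs \<subseteq> X" "length qs \<ge> 2"
    and iso: "\<And>i. Suc i < length qs \<Longrightarrow> isometric_on d d' f (seg X d (qs ! i) (qs ! Suc i))"
  shows "\<exists>ps. ps \<noteq> [] \<and> hd ps = hd qs \<and> last ps = last qs \<and> set ps \<subseteq> seg X d (hd qs) (last qs) \<and>
        seg X d (hd qs) (last qs) = (\<Union>i\<in>{i. Suc i < length ps}. seg X d (ps ! i) (ps ! Suc i)) \<and>
        (\<forall>i. Suc i < length ps \<longrightarrow> isometric_on d d' f (seg X d (ps ! i) (ps ! Suc i)))"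
proof -
  let ?x = "hd qs" and ?y = "last qs"
  have i: "?x \<in> X" "?y \<in> X" using qs by (cases qs; auto)+
  let ?S = "{m. btw ?x m ?y}"
  have S: "gated ?S" using gated_seg i by blast
  define ps where "ps = map (gate ?S) qs"
  have ne: "qs \<noteq> []" using qs by auto
  have hd: "hd ps = ?x" and last: "last ps = ?y"
    using ne gate_id[OF S, of ?x] gate_id[OF S, of ?y] btw_left[OF i(1)] btw_right[OF i(2)]
    by (simp_all add: ps_def hd_map last_map)
  have sub: "set ps \<subseteq> ?S" unfolding ps_def using gate_spec(1)[OF S] qs by auto
  then have psX: "set ps \<subseteq> X" by (auto simp: btw_def)
  have inS: "m \<in> ?S" if "a \<in> ?S" "b \<in> ?S" "btw a m b" for a b m
    using gated_convex[OF S] that unfolding convex_in_def by blast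
  have len: "length ps = length qs" by (simp add: ps_def)
  have cov: "seg X d ?x ?y = (\<Union>i\<in>{i. Suc i < length ps}. seg X d (ps ! i) (ps ! Suc i))"
  proof
    show "seg X d ?x ?y \<subseteq> (\<Union>i\<in>{i. Suc i < length ps}. seg X d (ps ! i) (ps ! Suc i))"
    proof
      fix m assume "m \<in> seg X d ?x ?y"
      then have "btw (hd ps) m (last ps)" using hd last seg_eq i by auto
      then obtain i where "Suc i < length ps" "btw (ps ! i) m (ps ! Suc i)"
        using seg_cover_list[of ps m] psX len qs by auto
      moreover have "ps ! i \<in> X" "ps ! Suc i \<in> X"
        using calculation(1) psX nth_mem[of i ps] nth_mem[of "Suc i" ps] by auto
      ultimately show "m \<in> (\<Union>i\<in>{i. Suc i < length ps}. seg X d (ps ! i) (ps ! Suc i))"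
        using seg_eq by auto
    qed
    show "(\<Union>i\<in>{i. Suc i < length ps}. seg X d (ps ! i) (ps ! Suc i)) \<subseteq> seg X d ?x ?y"
    proof
      fix m assume "m \<in> (\<Union>i\<in>{i. Suc i < length ps}. seg X d (ps ! i) (ps ! Suc i))"
      then obtain j where j: "Suc j < length ps" "m \<in> seg X d (ps ! j) (ps ! Suc j)" by blast
      then have k: "ps ! j \<in> ?S" "ps ! Suc j \<in> ?S" using sub by (auto simp: subset_iff)
      then have "ps ! j \<in> X" "ps ! Suc j \<in> X" by (auto simp: btw_def)
      then have "btw (ps ! j) m (ps ! Suc j)" using seg_eq j by auto
      then have "m \<in> ?S" using inS k by blast
      then show "m \<in> seg X d ?x ?y" using seg_eq i by auto
    qed
  qed
  have "isometric_on d d' f (seg X d (ps ! j) (ps ! Suc j))" if j: "Suc j < length ps" for j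
  proof -
    let ?a = "qs ! j" and ?b = "qs ! Suc j"
    have ab: "?a \<in> X" "?b \<in> X" using j len qs by (auto simp: subset_iff)
    have p: "ps ! j = gate ?S ?a" "ps ! Suc j = gate ?S ?b" using j len by (auto simp: ps_def)
    have gX: "gate ?S ?a \<in> X" "gate ?S ?b \<in> X" using gate_spec[OF S] ab by auto
    show ?thesis
    proof (cases "gate ?S ?a = gate ?S ?b")
      case True
      have "m = gate ?S ?a" if "btw (gate ?S ?a) m (gate ?S ?a)" for m
        using that gX zero nonneg refl0 unfolding btw_def by (smt (verit))
      then have "seg X d (ps ! j) (ps ! Suc j) \<subseteq> {gate ?S ?a}" using True p seg_eq gX by auto
      moreover have "d' (f (gate ?S ?a)) (f (gate ?S ?a)) = d (gate ?S ?a) (gate ?S ?a)"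
        using is_metricD(2)[OF met] f gX refl0 by (simp add: image_subset_iff)
      ultimately show ?thesis unfolding isometric_on_def by auto
    next
      case False
      have "btw ?a m ?b" if "btw (gate ?S ?a) m (gate ?S ?b)" for m
        using gates_distinct[OF S ab False] gated_convex[OF gated_seg[OF ab]] that
        unfolding convex_in_def by blast
      then have "seg X d (ps ! j) (ps ! Suc j) \<subseteq> seg X d ?a ?b" using p seg_eq gX ab by auto
      then show ?thesis using iso[of j] j len unfolding isometric_on_def by auto
    qed
  qed
  then show ?thesis using hd last sub cov seg_eq[OF i] ne by (intro exI[of _ ps]) (auto simp: ps_def)
qed

end

section \<open>Trees of trees\<close>

text \<open>The index tree is given by heights and parents, so that recursion and induction run
  towards the root. Gates are required along edges only: at a coset vertex K_v is a union over a
  coset that may be infinite.\<close>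

locale tree_of_trees = ztree X d for X :: "'a set" and d +
  fixes V :: "'v set" and hgt :: "'v \<Rightarrow> nat" and par :: "'v \<Rightarrow> 'v" and Kv :: "'v \<Rightarrow> 'a set"
  assumes par_V: "v \<in> V \<Longrightarrow> 0 < hgt v \<Longrightarrow> par v \<in> V"
    and par_hgt: "v \<in> V \<Longrightarrow> 0 < hgt v \<Longrightarrow> hgt (par v) < hgt v"
    and root_unique: "v \<in> V \<Longrightarrow> w \<in> V \<Longrightarrow> hgt v = 0 \<Longrightarrow> hgt w = 0 \<Longrightarrow> v = w"
    and Kv_X: "v \<in> V \<Longrightarrow> Kv v \<subseteq> X"
    and edge_gated: "v \<in> V \<Longrightarrow> 0 < hgt v \<Longrightarrow> gated (Kv v \<inter> Kv (par v))"
begin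

definition M :: "('a \<times> 'v) set" where
  "M = {(x, v). v \<in> V \<and> x \<in> Kv v}"

definition ret :: "'a \<times> 'v \<Rightarrow> 'a \<times> 'v" where
  "ret p = (gate (Kv (snd p) \<inter> Kv (par (snd p))) (fst p), par (snd p))"

definition dep :: "'a \<times> 'v \<Rightarrow> real" where
  "dep p = d (fst p) (fst (ret p))"

text \<open>Gluing the trees \<open>Kv v\<close> along the edges of the rooted tree \<open>V\<close>: to leave the deeper of two
  vertices one has to pass through the gate to its parent.\<close>

function D :: "'a \<times> 'v \<Rightarrow> 'a \<times> 'v \<Rightarrow> real" where
  "D p q = (if snd p = snd q then d (fst p) (fst q)
     else if hgt (snd q) \<le> hgt (snd p) \<and> hgt (par (snd p)) < hgt (snd p) then dep p + D (ret p) q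
     else if hgt (par (snd q)) < hgt (snd q) then dep q + D p (ret q) else 0)"
  by pat_completeness auto
text \<open>The guards on \<open>hgt (par _)\<close> make the recursion terminate on arbitrary
  arguments. For two points of \<open>M\<close> over different vertices the deeper one has positive
  height, so the default value 0 does not occur there.\<close>

termination
  by (relation "measure (\<lambda>(p, q). hgt (snd p) + hgt (snd q))") (auto simp: ret_def)

declare D.simps [simp del]

abbreviation ht :: "'a \<times> 'v \<Rightarrow> nat" where "ht p \<equiv> hgt (snd p)"

lemma M_D: "p \<in> M \<Longrightarrow> snd p \<in> V" "p \<in> M \<Longrightarrow> fst p \<in> Kv (snd p)" "p \<in> M \<Longrightarrow> fst p \<in> X"
  using Kv_X[of "snd p"] by (auto simp: M_def)

lemma ret_M:
  assumes "p \<in> M" "0 < ht p"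
  shows "ret p \<in> M" "ht (ret p) < ht p"
    "z \<in> Kv (snd p) \<inter> Kv (par (snd p)) \<Longrightarrow> d (fst p) z = dep p + d (fst (ret p)) z"
    "snd (ret p) = par (snd p)"
proof -
  note m = M_D[OF assms(1)]
  note g = gate_spec[OF edge_gated[OF m(1) assms(2)] m(3)]
  show "ret p \<in> M" "ht (ret p) < ht p" using g(1) par_V[OF m(1) assms(2)] par_hgt[OF m(1) assms(2)]
    by (simp_all add: M_def ret_def)
  show "d (fst p) z = dep p + d (fst (ret p)) z" if "z \<in> Kv (snd p) \<inter> Kv (par (snd p))"
    using g(3)[OF that] by (simp add: dep_def ret_def)
  show "snd (ret p) = par (snd p)" by (simp add: ret_def)
qed

lemma D_same: "snd p = snd q \<Longrightarrow> D p q = d (fst p) (fst q)"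
  by (subst D.simps) simp

lemma D_down:
  assumes "p \<in> M" "q \<in> M" "snd p \<noteq> snd q" "ht q \<le> ht p"
  shows "0 < ht p" "D p q = dep p + D (ret p) q"
proof -
  show "0 < ht p" using root_unique[of "snd p" "snd q"] assms M_D(1) by fastforce
  then have "hgt (par (snd p)) < ht p" using par_hgt M_D(1) assms by blast
  then show "D p q = dep p + D (ret p) q" using assms by (subst D.simps) simp
qed

text \<open>The recursion breaks ties in favour of its first argument. At equal heights both orders
  arrive at the two retractions after two steps, having paid \<open>dep p + dep q\<close>.\<close>

lemma D_sym: "p \<in> M \<Longrightarrow> q \<in> M \<Longrightarrow> D p q = D q p"
proof (induction "ht p + ht q" arbitrary: p q rule: less_induct)
  case less
  show ?case
  proof (cases "snd p = snd q")
    case True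
    then show ?thesis
      using D_same[of p q] D_same[of q p] sym[OF M_D(3)[OF less.prems(1)] M_D(3)[OF less.prems(2)]] by simp
  next
    case ne: False
    have lt: "D a b = D b a" if "a \<in> M" "b \<in> M" "snd a \<noteq> snd b" "ht b < ht a"
      "ht a + ht b \<le> ht p + ht q" for a b
    proof -
      note dn = D_down[OF that(1,2,3)]
      have h: "0 < ht a" "D a b = dep a + D (ret a) b" using dn that by auto
      note r = ret_M[OF that(1) h(1)]
      have "hgt (par (snd a)) < ht a" using r by auto
      then have "D b a = dep a + D b (ret a)" using that by (subst D.simps) auto
      moreover have "D (ret a) b = D b (ret a)" using less.hyps[of "ret a" b] r that by auto
      ultimately show ?thesis using h by simp
    qed
    show ?thesis
    proof (cases "ht p = ht q")
      case False
      then consider "ht q < ht p" | "ht p < ht q" by linarith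
      then show ?thesis using lt[of p q] lt[of q p] ne less.prems by cases (simp_all add: add.commute)
    next
      case True
      note dp = D_down[OF less.prems ne] and dq = D_down[OF less.prems(2,1) not_sym[OF ne]]
      have h: "0 < ht p" "0 < ht q" using dp dq True by auto
      note rp = ret_M[OF less.prems(1) h(1)] and rq = ret_M[OF less.prems(2) h(2)]
      have n: "snd q \<noteq> snd (ret p)" "snd p \<noteq> snd (ret q)" using rp(2) rq(2) True by auto
      have "D q (ret p) = dep q + D (ret q) (ret p)" "D p (ret q) = dep p + D (ret p) (ret q)"
        using D_down(2)[OF less.prems(2) rp(1) n(1)] D_down(2)[OF less.prems(1) rq(1) n(2)] rp rq True by auto
      moreover have "D (ret p) (ret q) = D (ret q) (ret p)"
        "D (ret p) q = D q (ret p)" "D (ret q) p = D p (ret q)"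
        using less.hyps[of "ret p" "ret q"] less.hyps[of "ret p" q] less.hyps[of "ret q" p]
          rp rq less.prems by auto
      ultimately show ?thesis using dp dq True by auto
    qed
  qed
qed

text \<open>Equivalently, the two largest of the three sums agree. Listing all three inequalities
  makes the condition invariant under permutations, so that the induction may put a deepest point
  first.\<close>

definition Q :: "'a \<times> 'v \<Rightarrow> 'a \<times> 'v \<Rightarrow> 'a \<times> 'v \<Rightarrow> 'a \<times> 'v \<Rightarrow> bool" where
  "Q a b c e \<longleftrightarrow>
     D a b + D c e \<le> max (D a c + D b e) (D a e + D b c) \<and>
     D a c + D b e \<le> max (D a b + D c e) (D a e + D b c) \<and>
     D a e + D b c \<le> max (D a b + D c e) (D a c + D b e)"

lemma Q_perm:
  assumes "a \<in> M" "b \<in> M" "c \<in> M" "e \<in> M" "Q a b c e"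
  shows "Q a c b e" "Q a c e b" "Q c a b e" "Q c a e b" "Q c e a b" "Q b a c e" "Q b c a e" "Q b c e a"
proof -
  have s: "D b a = D a b" "D c a = D a c" "D e a = D a e" "D c b = D b c" "D e b = D b e" "D e c = D c e"
    by (rule D_sym; rule assms)+
  show "Q a c b e" "Q a c e b" "Q c a b e" "Q c a e b" "Q c e a b" "Q b a c e" "Q b c a e" "Q b c e a"
    using assms(5) unfolding Q_def s by (auto simp: algebra_simps max.commute)
qed

text \<open>The pairs over the maximal vertex \<open>v\<close> with a common gate are the only ones whose distance is not
  the distance of the retractions plus the two depths.\<close>

lemma Q_holds: "a \<in> M \<Longrightarrow> b \<in> M \<Longrightarrow> c \<in> M \<Longrightarrow> e \<in> M \<Longrightarrow> Q a b c e"
proof (induction "ht a + ht b + ht c + ht e" arbitrary: a b c e rule: less_induct)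
  case less
  let ?N = "ht a + ht b + ht c + ht e"
  have main: "Q x y z w"
    if i: "x \<in> M" "y \<in> M" "z \<in> M" "w \<in> M" and N: "ht x + ht y + ht z + ht w \<le> ?N"
      and mx: "ht y \<le> ht x" "ht z \<le> ht x" "ht w \<le> ht x" for x y z w
  proof (cases "snd y = snd x \<and> snd z = snd x \<and> snd w = snd x")
    case True
    have iX: "fst x \<in> X" "fst y \<in> X" "fst z \<in> X" "fst w \<in> X" using i M_D(3) by blast+
    have "D x y = d (fst x) (fst y)" "D z w = d (fst z) (fst w)" "D x z = d (fst x) (fst z)"
      "D y w = d (fst y) (fst w)" "D x w = d (fst x) (fst w)" "D y z = d (fst y) (fst z)"
      using D_same True by auto
    moreover have "d (fst z) (fst y) = d (fst y) (fst z)" "d (fst w) (fst y) = d (fst y) (fst w)"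
      "d (fst w) (fst z) = d (fst z) (fst w)"
      using sym iX by auto
    ultimately show ?thesis
      using four_point[OF iX] four_point[OF iX(1,3,2,4)] four_point[OF iX(1,4,2,3)] unfolding Q_def
      by (auto simp: max.commute)
  next
    case nall: False
    define v where "v = snd x"
    define r where "r p = (if snd p = v then ret p else p)" for p
    define h where "h p = (if snd p = v then dep p else 0)" for p
    have vpos: "0 < hgt v"
      using nall D_down(1)[OF i(1,2)] D_down(1)[OF i(1,3)] D_down(1)[OF i(1,4)] mx by (auto simp: v_def)
    have rM: "r p \<in> M" "ht (r p) \<le> ht p" if "p \<in> M" for p
      using that ret_M[OF that] vpos by (auto simp: r_def)
    have Dr: "D p q = h p + h q + D (r p) (r q)"
      if pq: "p \<in> M" "q \<in> M" "ht p \<le> hgt v" "ht q \<le> hgt v" and ex: "\<not> (snd p = v \<and> snd q = v \<and> ret p = ret q)" for p q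
    proof -
      consider "snd p = v" "snd q = v" | "snd p = v" "snd q \<noteq> v" | "snd p \<noteq> v" "snd q = v" | "snd p \<noteq> v" "snd q \<noteq> v"
        by blast
      then show ?thesis
      proof cases
        case 1
        let ?C = "Kv v \<inter> Kv (par v)"
        have C: "gated ?C" using edge_gated vpos M_D(1)[OF pq(1)] 1 by simp
        have "gate ?C (fst p) \<noteq> gate ?C (fst q)" using ex 1 by (auto simp: ret_def)
        note g = gates_distinct(1)[OF C M_D(3)[OF pq(1)] M_D(3)[OF pq(2)] this]
        have "D (ret p) (ret q) = d (gate ?C (fst p)) (gate ?C (fst q))"
          using 1 by (subst D_same) (auto simp: ret_def)
        moreover have "d (gate ?C (fst q)) (fst q) = d (fst q) (gate ?C (fst q))"
          using sym gate_spec(2)[OF C] M_D(3) pq by blast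
        ultimately show ?thesis using 1 g D_same[of p q] by (simp add: r_def h_def dep_def ret_def)
      next
        case 2 then show ?thesis using D_down(2)[OF pq(1,2)] pq by (simp add: r_def h_def)
      next
        case 3
        have "D p q = D q p" "D (ret q) p = D p (ret q)"
          using D_sym pq ret_M(1)[OF pq(2)] vpos 3 by auto
        then show ?thesis using 3 D_down(2)[OF pq(2,1)] pq by (simp add: r_def h_def)
      next
        case 4 then show ?thesis by (simp add: r_def h_def)
      qed
    qed
    have IH: "Q (r p1) (r p2) (r p3) (r p4)"
      if "p1 \<in> M" "p2 \<in> M" "p3 \<in> M" "p4 \<in> M" "snd p1 = v" "ht p1 + ht p2 + ht p3 + ht p4 \<le> ?N" for p1 p2 p3 p4
    proof -
      have "ht (r p1) < ht p1" using ret_M(2)[OF that(1)] vpos that by (simp add: r_def)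
      then have "ht (r p1) + ht (r p2) + ht (r p3) + ht (r p4) < ?N"
        using that(6) rM(2)[OF that(2)] rM(2)[OF that(3)] rM(2)[OF that(4)] by linarith
      then show ?thesis using less.hyps rM(1) that by auto
    qed
    let ?ex = "\<lambda>p q. snd p = v \<and> snd q = v \<and> ret p = ret q"
    have exc: "Q p q s t" if ex: "?ex p q" and st: "snd s \<noteq> v \<or> snd t \<noteq> v" and pM: "p \<in> M" "q \<in> M" "s \<in> M" "t \<in> M"
      and N': "ht p + ht q + ht s + ht t \<le> ?N" and hts: "ht s \<le> hgt v" "ht t \<le> hgt v" for p q s t
    proof -
      have htp: "ht p \<le> hgt v" "ht q \<le> hgt v" using ex by auto
      have r0: "D (ret p) (ret p) = 0" using D_same[of "ret p" "ret p"] refl0 M_D(3) rM(1)[OF pM(1)] ex by (simp add: r_def)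
      have ss: "D s p = D p s" "D s q = D q s" "D t p = D p t" "D t q = D q t" "D t s = D s t" "D q p = D p q"
        using D_sym pM by auto
      have rpX: "fst (ret p) \<in> X" "fst p \<in> X" "fst q \<in> X" using M_D(3) rM(1)[OF pM(1)] ex pM by (auto simp: r_def)
      have Dpq: "D p q \<le> dep p + dep q"
      proof -
        have "d (fst p) (fst q) \<le> d (fst p) (fst (ret p)) + d (fst (ret p)) (fst q)" using tri rpX by blast
        moreover have "d (fst (ret p)) (fst q) = dep q" using sym rpX ex by (simp add: dep_def)
        ultimately show ?thesis using D_same[of p q] ex by (simp add: dep_def)
      qed
      \<comment> \<open>Seen from \<open>t'\<close>, three points over v with a common gate differ
        only by their depths. Up to a constant \<open>t'\<close> may thus be replaced by the gate,
        and the claim becomes the four-point condition in X.\<close>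
      have three: "Q p q s' t'" if ex3: "?ex p s'" and t': "snd t' \<noteq> v" "ht t' \<le> hgt v" and sM: "s' \<in> M" "t' \<in> M" for s' t'
      proof -
        let ?\<rho> = "fst (ret p)" let ?c = "D (ret p) t'"
        have "D p t' = dep p + ?c" "D q t' = dep q + ?c" "D s' t' = dep s' + ?c"
          using Dr[of p t'] Dr[of q t'] Dr[of s' t'] ex ex3 t' pM sM htp by (auto simp: r_def h_def)
        moreover have "D p q = d (fst p) (fst q)" "D p s' = d (fst p) (fst s')" "D q s' = d (fst q) (fst s')"
          using D_same ex ex3 by auto
        moreover have sX: "fst s' \<in> X" using M_D sM by blast
        moreover have "dep p = d (fst p) ?\<rho>" "dep q = d (fst q) ?\<rho>" "dep s' = d (fst s') ?\<rho>"
          using ex ex3 by (auto simp: dep_def)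
        moreover have "d ?\<rho> (fst q) = d (fst q) ?\<rho>" "d (fst s') (fst q) = d (fst q) (fst s')"
           "d ?\<rho> (fst s') = d (fst s') ?\<rho>"
          using sym rpX sX by auto
        ultimately show ?thesis
          using four_point[OF rpX(2,3) sX rpX(1)] four_point[OF rpX(2) sX rpX(3,1)]
            four_point[OF rpX(2,1,3) sX]
          unfolding Q_def by (auto simp: max_def split: if_splits)
      qed
      consider "?ex p s" | "?ex p t" | "\<not> ?ex p s" "\<not> ?ex p t" by blast
      then show ?thesis
      proof cases
        case 1 then show ?thesis using three[of s t] st pM hts by auto
      next
        case 2
        then have "Q p q t s" using three[of t s] st pM hts by auto
        then show ?thesis unfolding Q_def using ss by (auto simp: max.commute)
      next
        case 3
        then have nq: "\<not> ?ex q s" "\<not> ?ex q t" "\<not> ?ex s t" using ex st by auto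
        have rr: "r p = ret p" "r q = ret p" "h p = dep p" "h q = dep q" using ex by (auto simp: r_def h_def)
        have "D s t = h s + h t + D (r s) (r t)" using Dr[of s t] nq pM hts by blast
        moreover have "D p s = dep p + h s + D (ret p) (r s)" "D p t = dep p + h t + D (ret p) (r t)"
           "D q s = dep q + h s + D (ret p) (r s)" "D q t = dep q + h t + D (ret p) (r t)"
          using Dr[of p s] Dr[of p t] Dr[of q s] Dr[of q t] 3 nq pM hts htp rr by auto
        \<comment> \<open>As p and q have the same gate, the sums for ps|qt and pt|qs agree. The
          remaining sum is bounded by the triangle inequality at this gate, which is Q with a
          repeated point.\<close>
        moreover have "Q (ret p) (ret p) (r s) (r t)" using IH[of p q s t] pM ex N' rr by auto
        ultimately show ?thesis using Dpq r0 unfolding Q_def by (auto simp: max_def split: if_splits)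
      qed
    qed
    have hv: "ht x \<le> hgt v" "ht y \<le> hgt v" "ht z \<le> hgt v" "ht w \<le> hgt v" using mx by (auto simp: v_def)
    have nn: "snd y \<noteq> v \<or> snd z \<noteq> v \<or> snd w \<noteq> v" "snd x = v" using nall by (auto simp: v_def)
    consider "?ex x y" | "?ex x z" | "?ex x w" | "?ex y z" | "?ex y w" | "?ex z w" |
      "\<not> ?ex x y" "\<not> ?ex x z" "\<not> ?ex x w" "\<not> ?ex y z" "\<not> ?ex y w" "\<not> ?ex z w" by blast
    then show ?thesis
    proof cases
      case 1 then have "Q x y z w" using exc[of x y z w] i N hv nn by auto
      then show ?thesis .
    next
      case 2 then have "Q x z y w" using exc[of x z y w] i N hv nn by auto
      then show ?thesis by (rule Q_perm(1)[OF i(1,3,2,4)])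
    next
      case 3 then have "Q x w y z" using exc[of x w y z] i N hv nn by auto
      then show ?thesis by (rule Q_perm(2)[OF i(1,4,2,3)])
    next
      case 4 then have "Q y z x w" using exc[of y z x w] i N hv nn by auto
      then show ?thesis by (rule Q_perm(3)[OF i(2,3,1,4)])
    next
      case 5 then have "Q y w x z" using exc[of y w x z] i N hv nn by auto
      then show ?thesis by (rule Q_perm(4)[OF i(2,4,1,3)])
    next
      case 6 then have "Q z w x y" using exc[of z w x y] i N hv nn by auto
      then show ?thesis by (rule Q_perm(5)[OF i(3,4,1,2)])
    next
      case 7
      have "D x y = h x + h y + D (r x) (r y)" "D z w = h z + h w + D (r z) (r w)"
        "D x z = h x + h z + D (r x) (r z)" "D y w = h y + h w + D (r y) (r w)"
        "D x w = h x + h w + D (r x) (r w)" "D y z = h y + h z + D (r y) (r z)"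
        using Dr[OF i(1,2)] Dr[OF i(3,4)] Dr[OF i(1,3)] Dr[OF i(2,4)] Dr[OF i(1,4)] Dr[OF i(2,3)] hv 7 by blast+
      moreover have "Q (r x) (r y) (r z) (r w)" using IH[OF i nn(2) N] .
      ultimately show ?thesis unfolding Q_def by (auto simp: max_def split: if_splits)
    qed
  qed
  note l = less.prems
  consider "ht b \<le> ht a" "ht c \<le> ht a" "ht e \<le> ht a" | "ht a \<le> ht b" "ht c \<le> ht b" "ht e \<le> ht b"
    | "ht a \<le> ht c" "ht b \<le> ht c" "ht e \<le> ht c" | "ht a \<le> ht e" "ht b \<le> ht e" "ht c \<le> ht e" by linarith
  then show ?case
  proof cases
    case 1 then show ?thesis using main l by simp
  next
    case 2 then have "Q b a c e" using main l by simp
    then show ?thesis by (rule Q_perm(6)[OF l(2,1,3,4)])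
  next
    case 3 then have "Q c a b e" using main l by simp
    then show ?thesis by (rule Q_perm(7)[OF l(3,1,2,4)])
  next
    case 4 then have "Q e a b c" using main l by simp
    then show ?thesis by (rule Q_perm(8)[OF l(4,1,2,3)])
  qed
qed

lemma D_self: "p \<in> M \<Longrightarrow> D p p = 0"
  using D_same[of p p] refl0 M_D(3) by simp

text \<open>The four-point condition with q repeated.\<close>

lemma D_tri:
  assumes "p \<in> M" "q \<in> M" "r \<in> M"
  shows "D p r \<le> D p q + D q r"
  using Q_holds[OF assms(1,3,2,2)] D_self[OF assms(2)] D_sym[OF assms(2,3)] unfolding Q_def by auto

lemma D_edge:
  assumes "v \<in> V" "0 < hgt v" "z \<in> Kv v" "z \<in> Kv (par v)"
  shows "D (z, v) (z, par v) = 0"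
proof -
  have m: "(z, v) \<in> M" "(z, par v) \<in> M" using assms par_V by (auto simp: M_def)
  have n: "par v \<noteq> v" using par_hgt assms by force
  have "ret (z, v) = (z, par v)" using gate_id[OF edge_gated] assms by (simp add: ret_def)
  moreover have "dep (z, v) = 0" using calculation refl0 m M_D by (force simp: dep_def)
  ultimately show ?thesis using D_down[OF m] D_self m n par_hgt assms by fastforce
qed

text \<open>Every retraction costs a distance of X, so the triangle inequality in X bounds the
  projected path. In particular D is nonnegative on \<open>M\<close>, and D = 0 forces equal
  T-coordinates.\<close>

lemma d_le_D: "p \<in> M \<Longrightarrow> q \<in> M \<Longrightarrow> d (fst p) (fst q) \<le> D p q"
proof (induction "ht p + ht q" arbitrary: p q rule: less_induct)
  case less
  have st: "d (fst a) (fst b) \<le> D a b"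
    if ab: "a \<in> M" "b \<in> M" "snd a \<noteq> snd b" "ht b \<le> ht a" "ht a + ht b = ht p + ht q" for a b
  proof -
    note dn = D_down[OF ab(1,2,3,4)]
    note r = ret_M[OF ab(1) dn(1)]
    have "d (fst (ret a)) (fst b) \<le> D (ret a) b" by (rule less.hyps[OF _ r(1) ab(2)]) (use r(2) ab(5) in linarith)
    moreover have "d (fst a) (fst b) \<le> dep a + d (fst (ret a)) (fst b)"
      unfolding dep_def using tri M_D(3) ab r by blast
    ultimately show ?thesis using dn by linarith
  qed
  show ?case
  proof (cases "snd p = snd q")
    case True then show ?thesis using D_same by simp
  next
    case ne: False
    then show ?thesis
      using st[of p q] st[of q p] D_sym[of p q] sym[of "fst p" "fst q"] M_D(3) less.prems
      by (cases "ht q \<le> ht p") auto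
  qed
qed

text \<open>D is a sum of jumps inside single K_v and of edge crossings at cost 0, so whatever holds
  for these moves and adds up under composition holds with the value D. It is applied to chains, to
  translations and to the enlargement of K.\<close>

lemma D_attained:
  assumes jump: "\<And>x y v. v \<in> V \<Longrightarrow> x \<in> Kv v \<Longrightarrow> y \<in> Kv v \<Longrightarrow> R (x, v) (y, v) (d x y)"
    and up: "\<And>z v. v \<in> V \<Longrightarrow> 0 < hgt v \<Longrightarrow> z \<in> Kv v \<Longrightarrow> z \<in> Kv (par v) \<Longrightarrow> R (z, v) (z, par v) 0"
    and down: "\<And>z v. v \<in> V \<Longrightarrow> 0 < hgt v \<Longrightarrow> z \<in> Kv v \<Longrightarrow> z \<in> Kv (par v) \<Longrightarrow> R (z, par v) (z, v) 0"
    and trans: "\<And>p q r a b. R p q a \<Longrightarrow> R q r b \<Longrightarrow> R p r (a + b)"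
  shows "p \<in> M \<Longrightarrow> q \<in> M \<Longrightarrow> R p q (D p q)"
proof (induction "ht p + ht q" arbitrary: p q rule: less_induct)
  case less
  have ret: "R a (ret a) (dep a)" "R (ret a) a (dep a)" if a: "a \<in> M" "0 < ht a" for a
  proof -
    let ?v = "snd a" let ?g = "fst (ret a)"
    note m = M_D[OF a(1)]
    have g: "?g \<in> Kv ?v" "?g \<in> Kv (par ?v)" "?g \<in> X"
      using gate_spec(1,2)[OF edge_gated[OF m(1) a(2)] m(3)] by (simp_all add: ret_def)
    have e: "a = (fst a, ?v)" "ret a = (?g, par ?v)" by (auto simp: ret_def)
    have "R (fst a, ?v) (?g, ?v) (dep a)" "R (?g, ?v) (fst a, ?v) (dep a)"
      using jump[OF m(1,2) g(1)] jump[OF m(1) g(1) m(2)] sym[OF m(3) g(3)] by (auto simp: dep_def)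
    moreover have "R (?g, ?v) (?g, par ?v) 0" "R (?g, par ?v) (?g, ?v) 0"
      using up down m a g by auto
    ultimately show "R a (ret a) (dep a)" "R (ret a) a (dep a)"
      using trans e by (metis add_0 add.right_neutral)+
  qed
  show ?case
  proof (cases "snd p = snd q")
    case True
    then show ?thesis
      using jump[of "snd p" "fst p" "fst q"] M_D less.prems D_same by (metis prod.collapse)
  next
    case ne: False
    show ?thesis
    proof (cases "ht q \<le> ht p")
      case True
      note dn = D_down[OF less.prems ne True]
      note r = ret_M[OF less.prems(1) dn(1)]
      have "R (ret p) q (D (ret p) q)" using less.hyps[of "ret p" q] r less.prems by auto
      then show ?thesis using trans[OF ret(1)[OF less.prems(1) dn(1)]] dn by simp
    next
      case False
      then have "ht p \<le> ht q" by simp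
      note dn = D_down[OF less.prems(2,1) not_sym[OF ne] this]
      note r = ret_M[OF less.prems(2) dn(1)]
      have "R p (ret q) (D p (ret q))" using less.hyps[of p "ret q"] r less.prems by auto
      then have "R p q (D p (ret q) + dep q)" using trans ret(2)[OF less.prems(2) dn(1)] by blast
      moreover have "D p q = dep q + D p (ret q)" using dn D_sym less.prems r by simp
      ultimately show ?thesis by (simp add: add.commute)
    qed
  qed
qed

end

section \<open>The Bass-Serre tree of a free product\<close>

locale free_product = group G for G (structure) +
  fixes Gs :: "'a set list" and bs :: "'a list"
  assumes decomp: "free_product_decomp G Gs bs"
begin

abbreviation Ks :: "'a set list" where "Ks \<equiv> Gs @ map (cyc G) bs"
abbreviation k :: nat where "k \<equiv> length Gs"

lemma Ks_subgroup: "i < length Ks \<Longrightarrow> subgroup (Ks ! i) G"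
  using decomp nth_mem[of i Ks] unfolding free_product_decomp_def is_free_product_def by blast

lemma Gs_subgroup: "i < k \<Longrightarrow> subgroup (Gs ! i) G"
  using Ks_subgroup[of i] by (simp add: nth_append)

lemma Gs_carrier: "i < k \<Longrightarrow> h \<in> Gs ! i \<Longrightarrow> h \<in> carrier G"
  using Gs_subgroup subgroup.mem_carrier by metis

lemma conj_set_one: "i < k \<Longrightarrow> conj_set G \<one> (Gs ! i) = Gs ! i"
  using Gs_carrier unfolding conj_set_def by force

lemma Ks_carrier: "i < length Ks \<Longrightarrow> h \<in> Ks ! i \<Longrightarrow> h \<in> carrier G"
  using Ks_subgroup subgroup.mem_carrier by metis

lemma bs_infinite: "j < length bs \<Longrightarrow> infinite_order G (bs ! j)"
  using decomp nth_mem[of j bs] unfolding free_product_decomp_def by blast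

lemma bs_carrier: "j < length bs \<Longrightarrow> bs ! j \<in> carrier G"
  using bs_infinite unfolding infinite_order_def by blast

lemma bs_pow_inj:
  assumes "j < length bs" "bs ! j [^] (m::int) = bs ! j [^] (n::int)"
  shows "m = n"
proof -
  have c: "bs ! j \<in> carrier G" using bs_carrier assms by blast
  have "bs ! j [^] (m - n) = bs ! j [^] m \<otimes> inv (bs ! j [^] n)"
    using c by (simp add: int_pow_diff)
  also have "\<dots> = \<one>" using assms c by simp
  finally show ?thesis using bs_infinite[OF assms(1)] unfolding infinite_order_def by force
qed

lemma Ks_nth:
  "i < k \<Longrightarrow> Ks ! i = Gs ! i" "j < length bs \<Longrightarrow> Ks ! (k + j) = cyc G (bs ! j)"
  by (simp_all add: nth_append)

abbreviation reduced where "reduced \<equiv> reduced_word G Ks"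
abbreviation wprod where "wprod \<equiv> word_prod G"

definition nf :: "'a \<Rightarrow> (nat \<times> 'a) list" where
  "nf g = (THE w. reduced w \<and> wprod w = g)"

lemma nf_spec: "g \<in> carrier G \<Longrightarrow> reduced (nf g)" "g \<in> carrier G \<Longrightarrow> wprod (nf g) = g"
proof -
  assume "g \<in> carrier G"
  then have "\<exists>!w. reduced w \<and> wprod w = g"
    using decomp unfolding free_product_decomp_def is_free_product_def by blast
  from theI'[OF this] show "reduced (nf g)" "wprod (nf g) = g" unfolding nf_def by blast+
qed

lemma wprod_carrier: "reduced w \<Longrightarrow> wprod w \<in> carrier G"
  using decomp unfolding free_product_decomp_def is_free_product_def by blast

lemma nf_wprod:
  assumes "reduced w"
  shows "nf (wprod w) = w"
proof -
  have "\<exists>!u. reduced u \<and> wprod u = wprod w"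
    using decomp wprod_carrier[OF assms] unfolding free_product_decomp_def is_free_product_def by blast
  then show ?thesis unfolding nf_def using assms by (intro the1_equality) auto
qed

lemma nf_one: "nf \<one> = []"
  using nf_wprod[of "[]"] by (simp add: reduced_word_def word_prod_def)

lemma nf_inj: "g \<in> carrier G \<Longrightarrow> g' \<in> carrier G \<Longrightarrow> nf g = nf g' \<Longrightarrow> g = g'"
  using nf_spec by metis

lemma wprod_append:
  assumes "\<forall>(i, h)\<in>set u. h \<in> carrier G" "\<forall>(i, h)\<in>set v. h \<in> carrier G"
  shows "wprod (u @ v) = wprod u \<otimes> wprod v" "wprod v \<in> carrier G"
proof -
  have c: "wprod v \<in> carrier G" if "\<forall>(i, h)\<in>set v. h \<in> carrier G" for v
    using that by (induction v) (auto simp: word_prod_def)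
  show "wprod v \<in> carrier G" using c assms by blast
  show "wprod (u @ v) = wprod u \<otimes> wprod v"
    using assms(1)
  proof (induction u)
    case Nil then show ?case using c[OF assms(2)] by (simp add: word_prod_def)
  next
    case (Cons a u)
    obtain i h where a: "a = (i, h)" by (cases a)
    have "wprod u \<in> carrier G" using c[of u] Cons.prems by simp
    moreover have "h \<in> carrier G" using Cons.prems a by simp
    moreover have "wprod (u @ v) = wprod u \<otimes> wprod v" using Cons by simp
    ultimately show ?case using c[OF assms(2)] a by (simp add: word_prod_def m_assoc)
  qed
qed

definition ends_in :: "nat \<Rightarrow> 'a \<Rightarrow> bool" where
  "ends_in i g \<longleftrightarrow> nf g \<noteq> [] \<and> fst (last (nf g)) = i"

lemma reduced_snoc:
  "reduced (w @ [(i, h)]) \<longleftrightarrow> reduced w \<and> i < length Ks \<and> h \<in> Ks ! i \<and> h \<noteq> \<one> \<and> (w = [] \<or> fst (last w) \<noteq> i)"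
proof -
  have "(\<forall>j. Suc j < length (w @ [(i, h)]) \<longrightarrow> fst ((w @ [(i, h)]) ! j) \<noteq> fst ((w @ [(i, h)]) ! Suc j)) \<longleftrightarrow>
     (\<forall>j. Suc j < length w \<longrightarrow> fst (w ! j) \<noteq> fst (w ! Suc j)) \<and> (w = [] \<or> fst (last w) \<noteq> i)" (is "?L \<longleftrightarrow> ?R")
  proof
    assume L: ?L
    show ?R
    proof
      show "\<forall>j. Suc j < length w \<longrightarrow> fst (w ! j) \<noteq> fst (w ! Suc j)"
      proof (intro allI impI)
        fix j assume "Suc j < length w"
        then show "fst (w ! j) \<noteq> fst (w ! Suc j)"
          using L[rule_format, of j] by (simp add: nth_append)
      qed
      show "w = [] \<or> fst (last w) \<noteq> i"
      proof (cases "w = []")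
        case False
        then have "Suc (length w - 1) = length w" by simp
        then show ?thesis using L[rule_format, of "length w - 1"] False
          by (simp add: nth_append last_conv_nth)
      qed simp
    qed
  next
    assume R: ?R
    show ?L
    proof (intro allI impI)
      fix j assume "Suc j < length (w @ [(i, h)])"
      then consider "Suc j < length w" | "Suc j = length w" by force
      then show "fst ((w @ [(i, h)]) ! j) \<noteq> fst ((w @ [(i, h)]) ! Suc j)"
      proof cases
        case 1 then show ?thesis using R by (simp add: nth_append)
      next
        case 2
        then have "w \<noteq> []" "j = length w - 1" by auto
        then show ?thesis using R 2 by (simp add: nth_append last_conv_nth)
      qed
    qed
  qed
  then show ?thesis unfolding reduced_word_def by auto
qed

lemma reduced_letters:
  assumes "reduced w"
  shows "\<forall>(i, h)\<in>set w. h \<in> carrier G"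
proof -
  have "h \<in> carrier G" if "(i, h) \<in> set w" for i h
    using assms that Ks_carrier[of i h] unfolding reduced_word_def by fast
  then show ?thesis by auto
qed

lemma wprod_snoc:
  assumes "reduced w" "h \<in> carrier G"
  shows "wprod (w @ [(i, h)]) = wprod w \<otimes> h"
  using wprod_append(1)[OF reduced_letters[OF assms(1)], of "[(i, h)]"] assms
  by (simp add: word_prod_def)

lemma nf_snoc:
  assumes "g \<in> carrier G" "\<not> ends_in i g" "i < length Ks" "h \<in> Ks ! i" "h \<noteq> \<one>"
  shows "nf (g \<otimes> h) = nf g @ [(i, h)]"
proof -
  have r: "reduced (nf g)" using nf_spec assms by blast
  then have "reduced (nf g @ [(i, h)])" using assms reduced_snoc unfolding ends_in_def by blast
  moreover have "wprod (nf g @ [(i, h)]) = g \<otimes> h"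
    using wprod_snoc[OF r Ks_carrier[OF assms(3,4)]] nf_spec assms by simp
  ultimately show ?thesis using nf_wprod by metis
qed

text \<open>For a peripheral factor \<open>g0\<close> is the shortest representative of the coset of
  g, unique by \<open>split_unique\<close>. It will be the neighbour of the coset vertex on the side
  of the root.\<close>

lemma split_end:
  assumes g: "g \<in> carrier G" and i: "i < length Ks"
  obtains g0 h where "g0 \<in> carrier G" "\<not> ends_in i g0" "h \<in> Ks ! i" "g = g0 \<otimes> h"
proof (cases "ends_in i g")
  case False
  then show ?thesis using that[of g \<one>] g subgroup.one_closed[OF Ks_subgroup[OF i]] by simp
next
  case True
  then obtain w h where w: "nf g = w @ [(i, h)]"
    unfolding ends_in_def by (metis append_butlast_last_id prod.collapse)
  then have r: "reduced w" "h \<in> Ks ! i" "w = [] \<or> fst (last w) \<noteq> i"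
    using nf_spec(1)[OF g] reduced_snoc by auto
  have "g = wprod w \<otimes> h" using wprod_snoc[OF r(1) Ks_carrier[OF i r(2)], of i] nf_spec(2)[OF g] w by simp
  moreover have "\<not> ends_in i (wprod w)" using r nf_wprod by (auto simp: ends_in_def)
  ultimately show ?thesis using that[of "wprod w" h] wprod_carrier r by blast
qed

lemma split_unique:
  assumes "g \<in> carrier G" "\<not> ends_in i g" "g' \<in> carrier G" "\<not> ends_in i g'" "i < length Ks"
    "h \<in> Ks ! i" "h' \<in> Ks ! i" "g \<otimes> h = g' \<otimes> h'"
  shows "g = g'"
proof -
  have c: "h \<in> carrier G" "h' \<in> carrier G" using Ks_carrier assms by auto
  have e: "ends_in i (g \<otimes> h)" if "h \<noteq> \<one>" using nf_snoc[of g i h] that assms by (simp add: ends_in_def)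
  have e': "ends_in i (g' \<otimes> h')" if "h' \<noteq> \<one>" using nf_snoc[of g' i h'] that assms by (simp add: ends_in_def)
  consider "h = \<one>" "h' = \<one>" | "h = \<one>" "h' \<noteq> \<one>" | "h \<noteq> \<one>" "h' = \<one>" | "h \<noteq> \<one>" "h' \<noteq> \<one>" by blast
  then show ?thesis
  proof cases
    case 1 then show ?thesis using assms by simp
  next
    case 2 then show ?thesis using e' assms by simp
  next
    case 3 then show ?thesis using e assms by simp
  next
    case 4
    then have "nf g = nf g'" using nf_snoc[of g i h] nf_snoc[of g' i h'] assms by simp
    then show ?thesis using nf_inj assms by blast
  qed
qed

text \<open>Letters are prepended, since identifications in T_K are transported by left translation.
  A syllable from a cyclic factor is spelled out as a power of b_j or of its inverse.\<close>

lemma free_product_induct [consumes 1, case_names one peripheral basis basis_inv]: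
  assumes "g \<in> carrier G" "P \<one>"
    and per: "\<And>g i h. g \<in> carrier G \<Longrightarrow> P g \<Longrightarrow> i < k \<Longrightarrow> h \<in> Gs ! i \<Longrightarrow> P (h \<otimes> g)"
    and bas: "\<And>g j. g \<in> carrier G \<Longrightarrow> P g \<Longrightarrow> j < length bs \<Longrightarrow> P (bs ! j \<otimes> g)"
    and bai: "\<And>g j. g \<in> carrier G \<Longrightarrow> P g \<Longrightarrow> j < length bs \<Longrightarrow> P (inv (bs ! j) \<otimes> g)"
  shows "P g"
proof -
  have bn: "P (b [^] (n::nat) \<otimes> g) \<and> P (inv b [^] (n::nat) \<otimes> g)" if "b = bs ! j" "j < length bs" "g \<in> carrier G" "P g" for b n g j
  proof (induction n)
    case 0 then show ?case using that by simp
  next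
    case (Suc n)
    have c: "b \<in> carrier G" using bs_carrier that by simp
    have "b [^] Suc n \<otimes> g = b \<otimes> (b [^] n \<otimes> g)" "inv b [^] Suc n \<otimes> g = inv b \<otimes> (inv b [^] n \<otimes> g)"
      unfolding nat_pow_Suc2[OF c] nat_pow_Suc2[OF inv_closed[OF c]]
      by (rule m_assoc; use c that in simp)+
    then show ?case using Suc bas[of "b [^] n \<otimes> g" j] bai[of "inv b [^] n \<otimes> g" j] that c by simp
  qed
  have letter: "P (h \<otimes> g)" if gh: "g \<in> carrier G" "P g" "i < length Ks" "h \<in> Ks ! i" for g i h
  proof (cases "i < k")
    case True then show ?thesis using per gh Ks_nth(1) by auto
  next
    case False
    define j where "j = i - k"
    have j: "i = k + j" "j < length bs" using False gh(3) by (auto simp: j_def)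
    then obtain n :: int where n: "h = bs ! j [^] n" using gh(4) Ks_nth(2)[OF j(2)] by (auto simp: cyc_def)
    have c: "bs ! j \<in> carrier G" using bs_carrier j by simp
    show ?thesis
    proof (cases "n \<ge> 0")
      case True
      then have "h = bs ! j [^] nat n" using n by (metis int_nat_eq int_pow_int)
      then show ?thesis using bn[OF refl j(2) gh(1,2)] by simp
    next
      case False
      then have "h = inv (bs ! j [^] (nat (- n)))" using n c int_pow_neg_int[OF c, of "nat (- n)"] by simp
      then have "h = (inv (bs ! j)) [^] nat (- n)" using nat_pow_inv[OF c] by metis
      then show ?thesis using bn[OF refl j(2) gh(1,2)] by simp
    qed
  qed
  have *: "P (wprod w) \<and> wprod w \<in> carrier G" if "\<forall>(i,h)\<in>set w. i < length Ks \<and> h \<in> Ks ! i" for w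
    using that
  proof (induction w)
    case Nil then show ?case using assms(2) by (simp add: word_prod_def)
  next
    case (Cons a w)
    obtain i h where a: "a = (i, h)" by (cases a)
    then have "i < length Ks" "h \<in> Ks ! i" "P (wprod w) \<and> wprod w \<in> carrier G" using Cons by auto
    then have "P (h \<otimes> wprod w)" "h \<otimes> wprod w \<in> carrier G" using letter Ks_carrier by auto
    then show ?case using a by (simp add: word_prod_def)
  qed
  have "\<forall>(i,h)\<in>set (nf g). i < length Ks \<and> h \<in> Ks ! i"
    using nf_spec(1)[OF assms(1)] unfolding reduced_word_def by blast
  from *[OF this] show ?thesis using nf_spec(2)[OF assms(1)] by simp
qed

section \<open>Heights and parents in the Bass-Serre tree rooted at v_0\<close>

definition expo :: "nat \<Rightarrow> 'a \<Rightarrow> int" where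
  "expo j h = (THE n. bs ! j [^] n = h)"

lemma expo_pow: "j < length bs \<Longrightarrow> expo j (bs ! j [^] (n::int)) = n"
  unfolding expo_def using bs_pow_inj by blast

text \<open>A syllable from a peripheral factor contributes two edges of the Bass-Serre tree, the
  syllable \<open>b\<^sub>j\<^sup>n\<close> contributes \<open>\<bar>n\<bar>\<close> edges.\<close>

definition syl_cost :: "nat \<times> 'a \<Rightarrow> nat" where
  "syl_cost = (\<lambda>(i, h). if i < k then 2 else nat \<bar>expo (i - k) h\<bar>)"

definition depth :: "'a \<Rightarrow> nat" where
  "depth g = sum_list (map syl_cost (nf g))"

definition coset_rep :: "nat \<Rightarrow> 'a set \<Rightarrow> 'a" where
  "coset_rep i C = (THE g. g \<in> C \<and> \<not> ends_in i g)"

definition hgt :: "'a vertex \<Rightarrow> nat" where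
  "hgt v = (case v of Inl g \<Rightarrow> depth g | Inr (i, C) \<Rightarrow> Suc (depth (coset_rep i C)))"

text \<open>The neighbour on the path to v_0. A peripheral last syllable is removed in two steps
  through its coset vertex; otherwise the exponent of b_j moves by one towards 0. The root has no
  last syllable, so only the values at positive height are meaningful.\<close>

definition par :: "'a vertex \<Rightarrow> 'a vertex" where
  "par v = (case v of Inr (i, C) \<Rightarrow> Inl (coset_rep i C)
     | Inl g \<Rightarrow> (let (i, h) = last (nf g) in
          if i < k then Inr (i, g <# (Gs ! i))
          else if expo (i - k) h > 0 then Inl (g \<otimes> inv (bs ! (i - k)))
          else Inl (g \<otimes> bs ! (i - k))))"

lemma depth_snoc:
  assumes "g \<in> carrier G" "\<not> ends_in i g" "i < length Ks" "h \<in> Ks ! i" "h \<noteq> \<one>"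
  shows "depth (g \<otimes> h) = depth g + syl_cost (i, h)"
  using nf_snoc[OF assms] by (simp add: depth_def)

lemma coset_rep:
  assumes "g \<in> carrier G" "\<not> ends_in i g" "i < k" "h \<in> Gs ! i"
  shows "coset_rep i ((g \<otimes> h) <# (Gs ! i)) = g"
  unfolding coset_rep_def
proof (rule the_equality)
  have K: "i < length Ks" "Ks ! i = Gs ! i" using assms Ks_nth by auto
  have c: "h \<in> carrier G" using Gs_carrier assms by blast
  have "inv h \<in> Gs ! i" using subgroup.m_inv_closed[OF Gs_subgroup] assms by blast
  moreover have "g = (g \<otimes> h) \<otimes> inv h" using c assms by (simp add: m_assoc)
  ultimately show "g \<in> (g \<otimes> h) <# (Gs ! i) \<and> \<not> ends_in i g"
    using assms unfolding l_coset_def by blast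
  fix g' assume g': "g' \<in> (g \<otimes> h) <# (Gs ! i) \<and> \<not> ends_in i g'"
  then obtain h' where h': "h' \<in> Gs ! i" "g' = (g \<otimes> h) \<otimes> h'" unfolding l_coset_def by blast
  have c': "h' \<in> carrier G" using Gs_carrier assms h' by blast
  have "g \<otimes> (h \<otimes> h') = g' \<otimes> \<one>" using h' c c' assms by (simp add: m_assoc)
  moreover have "h \<otimes> h' \<in> Gs ! i" "\<one> \<in> Gs ! i"
    using subgroup.m_closed[OF Gs_subgroup] subgroup.one_closed[OF Gs_subgroup] assms h' by auto
  moreover have "g' \<in> carrier G" using h' c c' assms by simp
  ultimately show "g' = g" using split_unique[of g i g' "h \<otimes> h'" \<one>] assms g' K by simp
qed

lemma par_coset:
  assumes "g \<in> carrier G" "\<not> ends_in i g" "i < k" "h \<in> Gs ! i"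
  shows "par (Inr (i, (g \<otimes> h) <# (Gs ! i))) = Inl g"
    "hgt (Inr (i, (g \<otimes> h) <# (Gs ! i))) = Suc (depth g)"
    "h \<noteq> \<one> \<Longrightarrow> par (Inl (g \<otimes> h)) = Inr (i, (g \<otimes> h) <# (Gs ! i))"
    "h \<noteq> \<one> \<Longrightarrow> hgt (Inl (g \<otimes> h)) = depth g + 2"
  using coset_rep[OF assms] nf_snoc[OF assms(1,2), of h] depth_snoc[OF assms(1,2), of h] assms Ks_nth(1)[of i]
  by (simp_all add: par_def hgt_def syl_cost_def)

lemma par_basis:
  assumes "g \<in> carrier G" "\<not> ends_in (k + j) g" "j < length bs" "n \<noteq> 0"
  shows "par (Inl (g \<otimes> bs ! j [^] (n::int))) =
      Inl (if n > 0 then (g \<otimes> bs ! j [^] n) \<otimes> inv (bs ! j) else (g \<otimes> bs ! j [^] n) \<otimes> bs ! j)"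
    "hgt (Inl (g \<otimes> bs ! j [^] n)) = depth g + nat \<bar>n\<bar>"
proof -
  let ?h = "bs ! j [^] n"
  have h: "?h \<in> Ks ! (k + j)" using Ks_nth(2)[OF assms(3)] by (auto simp: cyc_def)
  have "?h \<noteq> \<one>" using bs_infinite[OF assms(3)] assms(4) unfolding infinite_order_def by blast
  then show "par (Inl (g \<otimes> bs ! j [^] (n::int))) =
      Inl (if n > 0 then (g \<otimes> bs ! j [^] n) \<otimes> inv (bs ! j) else (g \<otimes> bs ! j [^] n) \<otimes> bs ! j)"
    "hgt (Inl (g \<otimes> bs ! j [^] n)) = depth g + nat \<bar>n\<bar>"
    using nf_snoc[OF assms(1,2) _ h] depth_snoc[OF assms(1,2) _ h] assms(3) expo_pow[OF assms(3)]
    by (simp_all add: par_def hgt_def syl_cost_def)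
qed

lemma hgt_basis:
  assumes "g \<in> carrier G" "\<not> ends_in (k + j) g" "j < length bs"
  shows "hgt (Inl (g \<otimes> bs ! j [^] (n::int))) = depth g + nat \<bar>n\<bar>"
proof (cases "n = 0")
  case True then show ?thesis using assms by (simp add: hgt_def)
next
  case False then show ?thesis using par_basis(2) assms by blast
qed

abbreviation V where "V \<equiv> S_vertices G Gs"
abbreviation adj where "adj \<equiv> S_adj G Gs bs"

lemma V_cases:
  assumes "v \<in> V"
  obtains (g) g where "v = Inl g" "g \<in> carrier G"
    | (c) i g where "v = Inr (i, g <# (Gs ! i))" "i < k" "g \<in> carrier G"
  using assms unfolding S_vertices_def by blast

lemma adj_cases:
  assumes "adj v w"
  obtains (coset) g i where "g \<in> carrier G" "i < k" "{v, w} = {Inl g, Inr (i, g <# (Gs ! i))}"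
    | (basis) g j where "g \<in> carrier G" "j < length bs" "{v, w} = {Inl g, Inl (g \<otimes> bs ! j)}"
  using assms unfolding S_adj_def by blast

lemma adj_sym: "adj v w \<Longrightarrow> adj w v"
  unfolding S_adj_def by (simp add: insert_commute)

lemma adj_V: "adj v w \<Longrightarrow> v \<in> V"
proof (erule adj_cases)
  fix g i assume "g \<in> carrier G" "i < k" "{v, w} = {Inl g, Inr (i, g <# (Gs ! i))}"
  then show "v \<in> V" unfolding S_vertices_def doubleton_eq_iff by blast
next
  fix g j assume "g \<in> carrier G" "j < length bs" "{v, w} = {Inl g, Inl (g \<otimes> bs ! j)}"
  then show "v \<in> V" using bs_carrier[of j] unfolding S_vertices_def doubleton_eq_iff by auto
qed

text \<open>Split off the last syllable h of g in the factor of the edge. A coset edge at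
  \<open>g0\<close> leads away from the root, at \<open>g0 \<otimes> h\<close> with h nontrivial
  towards it. On the line of the \<open>g0 b^n\<close> the edge from n to n+1 leads away exactly
  when n is nonnegative.\<close>

lemma adj_par:
  assumes "adj v w"
  shows "(0 < hgt v \<and> par v = w) \<or> (0 < hgt w \<and> par w = v)"
  using assms
proof (cases rule: adj_cases)
  case (coset g i)
  obtain g0 h where g0: "g0 \<in> carrier G" "\<not> ends_in i g0" "h \<in> Gs ! i" "g = g0 \<otimes> h"
    using split_end[of g i] coset Ks_nth(1) by auto
  note p = par_coset[OF g0(1,2) coset(2) g0(3), folded g0(4)]
  show ?thesis
  proof (cases "h = \<one>")
    case True
    then have "g0 = g" using g0 by simp
    then show ?thesis using p(1,2) coset(3) unfolding doubleton_eq_iff by auto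
  next
    case False
    then show ?thesis using p(3,4) coset(3) unfolding doubleton_eq_iff by auto
  qed
next
  case (basis g j)
  obtain g0 h where g0: "g0 \<in> carrier G" "\<not> ends_in (k + j) g0" "h \<in> Ks ! (k + j)" "g = g0 \<otimes> h"
    using split_end[of g "k + j"] basis by auto
  obtain n :: int where n: "h = bs ! j [^] n" using g0(3) Ks_nth(2)[OF basis(2)] by (auto simp: cyc_def)
  have c: "bs ! j \<in> carrier G" using bs_carrier basis by blast
  have gb: "g \<otimes> bs ! j = g0 \<otimes> bs ! j [^] (n + 1)"
    using g0 n c by (simp add: int_pow_mult m_assoc)
  show ?thesis
  proof (cases "n \<ge> 0")
    case True
    have "g \<otimes> bs ! j \<otimes> inv (bs ! j) = g" using c basis by (simp add: m_assoc)
    then have "par (Inl (g \<otimes> bs ! j)) = Inl g" "0 < hgt (Inl (g \<otimes> bs ! j))"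
      using par_basis[OF g0(1,2) basis(2), of "n + 1"] True gb by simp_all
    then show ?thesis using basis(3) unfolding doubleton_eq_iff by auto
  next
    case False
    then have "par (Inl g) = Inl (g \<otimes> bs ! j)" "0 < hgt (Inl g)"
      using par_basis[OF g0(1,2) basis(2), of n] n g0(4) by simp_all
    then show ?thesis using basis(3) unfolding doubleton_eq_iff by auto
  qed
qed

lemma par_hgt_adj:
  assumes v: "v \<in> V" and pos: "0 < hgt v"
  shows "adj v (par v)" "hgt (par v) < hgt v"
proof -
  from v have "adj v (par v) \<and> hgt (par v) < hgt v"
  proof (cases rule: V_cases)
    case (c i g)
    obtain g0 h where g0: "g0 \<in> carrier G" "\<not> ends_in i g0" "h \<in> Gs ! i" "g = g0 \<otimes> h"
      using split_end[of g i] c Ks_nth(1) by auto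
    note p = par_coset[OF g0(1,2) c(2) g0(3), folded g0(4)]
    have "g <# (Gs ! i) = g0 <# (Gs ! i)"
      using l_repr_independence[OF _ g0(1) Gs_subgroup[OF c(2)], of g] g0 unfolding l_coset_def by blast
    then have "adj v (par v)" using p c g0 unfolding S_adj_def by (auto simp: insert_commute)
    moreover have "hgt (par v) < hgt v" using p c by (simp add: hgt_def)
    ultimately show ?thesis by blast
  next
    case (g g)
    have "nf g \<noteq> []" using pos g by (auto simp: hgt_def depth_def)
    then obtain w i h where w: "nf g = w @ [(i, h)]" by (metis append_butlast_last_id prod.collapse)
    then have r: "reduced w" "i < length Ks" "h \<in> Ks ! i" "h \<noteq> \<one>" "w = [] \<or> fst (last w) \<noteq> i"
      using nf_spec(1)[OF g(2)] reduced_snoc by auto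
    define g0 where "g0 = wprod w"
    have g0: "g0 \<in> carrier G" "\<not> ends_in i g0" "g = g0 \<otimes> h"
      using wprod_carrier[OF r(1)] nf_wprod[OF r(1)] r wprod_snoc[OF r(1) Ks_carrier[OF r(2,3)], of i] nf_spec(2)[OF g(2)] w
      by (auto simp: g0_def ends_in_def)
    show ?thesis
    proof (cases "i < k")
      case True
      then have hG: "h \<in> Gs ! i" using r Ks_nth by simp
      note p = par_coset[OF g0(1,2) True hG, folded g0(3)]
      have "adj v (par v)" using p(3) r(4) g True unfolding S_adj_def by auto
      then show ?thesis using p r(4) g by simp
    next
      case False
      define j where "j = i - k"
      have j: "i = k + j" "j < length bs" using False r(2) by (auto simp: j_def)
      obtain n :: int where n: "h = bs ! j [^] n" using r(3) j Ks_nth(2)[OF j(2)] by (auto simp: cyc_def)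
      have n0: "n \<noteq> 0" using n r(4) by auto
      have c: "bs ! j \<in> carrier G" using bs_carrier j by blast
      have g0': "\<not> ends_in (k + j) g0" using g0 j by simp
      note p = par_basis[OF g0(1) g0' j(2) n0, folded n g0(3)]
      show ?thesis
      proof (cases "n > 0")
        case True
        let ?g = "g \<otimes> inv (bs ! j)"
        have e: "?g = g0 \<otimes> bs ! j [^] (n - 1)" "?g \<in> carrier G" "?g \<otimes> bs ! j = g"
          using g0 n c g by (simp_all add: int_pow_diff m_assoc)
        have "adj v (par v)"
          using p(1) True e(2,3) g j(2) unfolding S_adj_def by (intro disjI2 bexI[of _ ?g] exI[of _ j]) auto
        moreover have "hgt (Inl ?g) = depth g0 + nat \<bar>n - 1\<bar>" using hgt_basis[OF g0(1) g0' j(2)] e by simp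
        ultimately show ?thesis using p True g by auto
      next
        case False
        let ?g = "g \<otimes> bs ! j"
        have e: "?g = g0 \<otimes> bs ! j [^] (n + 1)"
          using g0 n c g by (simp add: int_pow_mult m_assoc)
        have "adj v (par v)" unfolding S_adj_def using p(1) False g j(2) by auto
        moreover have "hgt (Inl ?g) = depth g0 + nat \<bar>n + 1\<bar>" using hgt_basis[OF g0(1) g0' j(2)] e by simp
        ultimately show ?thesis using p False n0 g by auto
      qed
    qed
  qed
  then show "adj v (par v)" "hgt (par v) < hgt v" by auto
qed

text \<open>Every syllable costs at least one edge: two if it is peripheral, the absolute value of a
  nonzero exponent otherwise.\<close>

lemma hgt_zero:
  assumes "v \<in> V" "hgt v = 0"
  shows "v = Inl \<one>"
proof -
  obtain g where g: "v = Inl g" "g \<in> carrier G"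
    using assms unfolding S_vertices_def by (auto simp: hgt_def)
  have "nf g = []"
  proof (rule ccontr)
    assume "nf g \<noteq> []"
    then obtain w i h where w: "nf g = w @ [(i, h)]" by (metis append_butlast_last_id prod.collapse)
    then have r: "i < length Ks" "h \<in> Ks ! i" "h \<noteq> \<one>"
      using nf_spec(1)[OF g(2)] reduced_snoc by auto
    have z: "syl_cost (i, h) = 0" using assms(2) w g by (simp add: hgt_def depth_def)
    then have ik: "\<not> i < k" by (auto simp: syl_cost_def)
    define j where "j = i - k"
    have j: "i = k + j" "j < length bs" using ik r(1) by (auto simp: j_def)
    obtain n :: int where n: "h = bs ! j [^] n" using r(2) j Ks_nth(2)[OF j(2)] by (auto simp: cyc_def)
    then have "n = 0" using z expo_pow[OF j(2)] j by (simp add: syl_cost_def)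
    then show False using n r(3) by simp
  qed
  then have "g = \<one>" using nf_inj[OF g(2) one_closed] nf_one by simp
  then show ?thesis using g by simp
qed

end

section \<open>The geometric tree of a finite subtree\<close>

locale tree_action = free_product G Gs bs + T: ztree X d
  for G :: "('g, 'm) monoid_scheme" (structure) and Gs :: "'g set list" and bs :: "'g list" and X :: "'p set" and d +
  fixes act :: "'g \<Rightarrow> 'p \<Rightarrow> 'p"
  assumes action: "isometric_action G X d act"
begin

lemma act_X: "g \<in> carrier G \<Longrightarrow> x \<in> X \<Longrightarrow> act g x \<in> X"
  and act_dist: "g \<in> carrier G \<Longrightarrow> x \<in> X \<Longrightarrow> y \<in> X \<Longrightarrow> d (act g x) (act g y) = d x y"
  and act_one: "x \<in> X \<Longrightarrow> act \<one> x = x"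
  and act_mult: "g \<in> carrier G \<Longrightarrow> h \<in> carrier G \<Longrightarrow> x \<in> X \<Longrightarrow> act (g \<otimes> h) x = act g (act h x)"
  using action unfolding isometric_action_def by blast+

lemma act_inv_cancel:
  assumes "g \<in> carrier G" "x \<in> X"
  shows "act (inv g) (act g x) = x" "act g (act (inv g) x) = x"
  using act_mult[of "inv g" g x] act_mult[of g "inv g" x] assms act_one by simp_all

lemma act_surj: "g \<in> carrier G \<Longrightarrow> act g ` X = X"
  using act_X act_inv_cancel(2) by (intro equalityI subsetI) (auto simp: image_iff intro!: bexI[of _ "act (inv g) _"])

lemma act_btw:
  assumes "g \<in> carrier G" "x \<in> X" "y \<in> X" "T.btw x m y"
  shows "T.btw (act g x) (act g m) (act g y)"
  using assms act_X act_dist unfolding T.btw_def by simp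

lemma act_gated: "T.gated C \<Longrightarrow> g \<in> carrier G \<Longrightarrow> T.gated (act g ` C)"
  by (rule T.gated_image[OF _ act_dist act_surj])

end

text \<open>An axiomatic form of an admissible finite subtree: gates, a fixed point of each G_i in
  K, and overlaps with the b_j-translates are what the gluing construction draws on.\<close>

locale geometric_data = tree_action G Gs bs X d act
  for G :: "('g, 'm) monoid_scheme" (structure) and Gs bs and X :: "'p set" and d act +
  fixes K :: "'p set"
  assumes K_gated: "T.gated K"
    and K_fix: "i < length Gs \<Longrightarrow> \<exists>p\<in>K. fixes_point act (Gs ! i) p"
    and K_basis: "j < length bs \<Longrightarrow> K \<inter> act (bs ! j) ` K \<noteq> {}"
begin

abbreviation Kv where "Kv \<equiv> K_at act K"

lemma K_X: "x \<in> K \<Longrightarrow> x \<in> X"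
  using K_gated unfolding T.gated_def by blast

lemma Kv_simps: "Kv (Inl g) = act g ` K" "Kv (Inr (i, C)) = (\<Union>h\<in>C. act h ` K)"
  by (simp_all add: K_at_def)

lemma coset_carrier:
  assumes "i < k" "g \<in> carrier G" "h \<in> g <# (Gs ! i)"
  shows "h \<in> carrier G" "\<exists>l\<in>Gs ! i. h = g \<otimes> l"
  using assms Gs_carrier[OF assms(1)] unfolding l_coset_def by auto

lemma Kv_X:
  assumes "v \<in> V"
  shows "Kv v \<subseteq> X"
proof -
  from assms show ?thesis
  proof (cases rule: V_cases)
    case (g g) then show ?thesis using act_X K_X by (auto simp: Kv_simps)
  next
    case (c i g) then show ?thesis using act_X K_X coset_carrier(1)[OF c(2,3)] by (auto simp: Kv_simps)
  qed
qed

lemma self_coset: "i < k \<Longrightarrow> g \<in> carrier G \<Longrightarrow> g \<in> g <# (Gs ! i)"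
  unfolding l_coset_def using subgroup.one_closed[OF Gs_subgroup] by force

text \<open>Along a coset edge the tree of the coset vertex contains gK, so the intersection is gK
  itself. Along a basis edge it is an intersection of two gated translates, nonempty by
  \<open>K_basis\<close>.\<close>

lemma edge_gated: "adj v w \<Longrightarrow> T.gated (Kv v \<inter> Kv w)"
proof (erule adj_cases)
  fix g i assume a: "g \<in> carrier G" "i < k" "{v, w} = {Inl g, Inr (i, g <# (Gs ! i))}"
  have "Kv (Inl g) \<inter> Kv (Inr (i, g <# (Gs ! i))) = act g ` K"
    using self_coset[OF a(2,1)] by (auto simp: Kv_simps)
  then have "Kv v \<inter> Kv w = act g ` K" using a(3) by (auto simp: doubleton_eq_iff)
  then show "T.gated (Kv v \<inter> Kv w)" using act_gated K_gated a by simp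
next
  fix g j assume a: "g \<in> carrier G" "j < length bs" "{v, w} = {Inl g, Inl (g \<otimes> bs ! j)}"
  have b: "bs ! j \<in> carrier G" using bs_carrier a by blast
  obtain x where x: "x \<in> K" "x \<in> act (bs ! j) ` K" using K_basis a by blast
  then obtain y where y: "y \<in> K" "x = act (bs ! j) y" by blast
  then have "act g x \<in> act g ` K" "act g x \<in> act (g \<otimes> bs ! j) ` K"
    using x a b act_mult[of g "bs ! j" y] K_X by (auto intro!: image_eqI[of _ _ y])
  then have "Kv (Inl g) \<inter> Kv (Inl (g \<otimes> bs ! j)) \<noteq> {}" by (auto simp: Kv_simps)
  then have "T.gated (Kv (Inl g) \<inter> Kv (Inl (g \<otimes> bs ! j)))"
    using a b act_gated K_gated by (intro T.gated_inter) (auto simp: Kv_simps)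
  moreover have "Kv v \<inter> Kv w = Kv (Inl g) \<inter> Kv (Inl (g \<otimes> bs ! j))" using a(3) by (auto simp: doubleton_eq_iff)
  ultimately show "T.gated (Kv v \<inter> Kv w)" by simp
qed

sublocale Gl: tree_of_trees X d V hgt par Kv
proof
  fix v w assume v: "v \<in> V"
  show "Kv v \<subseteq> X" using Kv_X v .
  show "par v \<in> V" "hgt (par v) < hgt v" "T.gated (Kv v \<inter> Kv (par v))" if "0 < hgt v"
    using par_hgt_adj[OF v that] adj_V adj_sym edge_gated by auto
  show "v = w" if "w \<in> V" "hgt v = 0" "hgt w = 0" using hgt_zero[OF v that(2)] hgt_zero[OF that(1,3)] by simp
qed

declare Gl.D.simps [simp del]

abbreviation D where "D \<equiv> Gl.D"
abbreviation M where "M \<equiv> Gl.M"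

lemma M_iff: "(x, v) \<in> M \<longleftrightarrow> v \<in> V \<and> x \<in> Kv v"
  by (simp add: Gl.M_def)

lemma D_adj:
  assumes "adj v w" "z \<in> Kv v" "z \<in> Kv w"
  shows "D (z, v) (z, w) = 0"
proof -
  have V: "v \<in> V" "w \<in> V" using assms adj_V adj_sym by blast+
  then have m: "(z, v) \<in> M" "(z, w) \<in> M" using assms by (simp_all add: M_iff)
  from adj_par[OF assms(1)] show ?thesis
  proof (elim disjE conjE)
    assume 1: "0 < hgt v" "par v = w"
    show ?thesis by (rule Gl.D_edge[OF V(1) 1(1) assms(2), unfolded 1(2), OF assms(3)])
  next
    assume 2: "0 < hgt w" "par w = v"
    have "D (z, w) (z, v) = 0" by (rule Gl.D_edge[OF V(2) 2(1) assms(3), unfolded 2(2), OF assms(2)])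
    then show ?thesis unfolding Gl.D_sym[OF m] .
  qed
qed

definition translate :: "'g \<Rightarrow> 'g vertex \<Rightarrow> 'g vertex" where
  "translate h v = (case v of Inl g \<Rightarrow> Inl (h \<otimes> g) | Inr (i, C) \<Rightarrow> Inr (i, h <# C))"

lemma l_coset_translate: "i < k \<Longrightarrow> g \<in> carrier G \<Longrightarrow> h \<in> carrier G \<Longrightarrow> h <# (g <# (Gs ! i)) = (h \<otimes> g) <# (Gs ! i)"
  using lcos_m_assoc[of "Gs ! i" h g] subgroup.subset[OF Gs_subgroup] by blast

lemma translate_V: "h \<in> carrier G \<Longrightarrow> v \<in> V \<Longrightarrow> translate h v \<in> V"
proof -
  assume h: "h \<in> carrier G" and v: "v \<in> V"
  from v show ?thesis
  proof (cases rule: V_cases)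
    case (g g) then show ?thesis using h by (simp add: translate_def S_vertices_def)
  next
    case (c i g)
    then have "translate h v = Inr (i, (h \<otimes> g) <# (Gs ! i))" using l_coset_translate h by (simp add: translate_def)
    moreover have "h \<otimes> g \<in> carrier G" using c h by simp
    ultimately show ?thesis using c(2) unfolding S_vertices_def by blast
  qed
qed

lemma translate_Kv:
  assumes h: "h \<in> carrier G" and v: "v \<in> V"
  shows "Kv (translate h v) = act h ` Kv v"
proof -
  from v show ?thesis
  proof (cases rule: V_cases)
    case (g g) then show ?thesis using act_mult[OF h] K_X by (auto simp: Kv_simps translate_def image_image)
  next
    case (c i g)
    have e: "act (h \<otimes> l) ` K = act h ` act l ` K" if "l \<in> g <# (Gs ! i)" for l
      using act_mult[OF h coset_carrier(1)[OF c(2,3) that]] K_X unfolding image_image by (intro image_cong) auto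
    have "Kv (translate h v) = (\<Union>l\<in>g <# (Gs ! i). act (h \<otimes> l) ` K)"
      using c unfolding translate_def l_coset_def by (auto simp: Kv_simps)
    also have "\<dots> = (\<Union>l\<in>g <# (Gs ! i). act h ` act l ` K)" using e by (intro SUP_cong) auto
    also have "\<dots> = act h ` Kv v" using c by (auto simp: Kv_simps)
    finally show ?thesis .
  qed
qed

lemma translate_adj:
  assumes "h \<in> carrier G" "adj v w"
  shows "adj (translate h v) (translate h w)"
  using assms(2)
proof (cases rule: adj_cases)
  case (coset g i)
  have "{translate h v, translate h w} = translate h ` {v, w}" by simp
  also have "\<dots> = {Inl (h \<otimes> g), Inr (i, (h \<otimes> g) <# (Gs ! i))}"
    unfolding coset(3) using l_coset_translate[OF coset(2,1) assms(1)] by (simp add: translate_def)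
  finally show ?thesis using assms coset unfolding S_adj_def by blast
next
  case (basis g j)
  have "{translate h v, translate h w} = translate h ` {v, w}" by simp
  also have "\<dots> = {Inl (h \<otimes> g), Inl ((h \<otimes> g) \<otimes> bs ! j)}"
    unfolding basis(3) using m_assoc[OF assms(1) basis(1) bs_carrier[OF basis(2)]] by (simp add: translate_def)
  finally show ?thesis using assms basis unfolding S_adj_def by blast
qed

definition mv :: "'g \<Rightarrow> 'p \<times> 'g vertex \<Rightarrow> 'p \<times> 'g vertex" where
  "mv h p = (act h (fst p), translate h (snd p))"

lemma mv_M: "h \<in> carrier G \<Longrightarrow> p \<in> M \<Longrightarrow> mv h p \<in> M"
  using translate_V translate_Kv by (cases p) (auto simp: mv_def M_iff)

text \<open>Heights, parents and gates refer to the root v_0, which translation moves, so the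
  recursion itself is not equivariant. A path realising \<open>D p q\<close> can be translated, and
  its translate has the same cost.\<close>

lemma D_mv_le:
  assumes h: "h \<in> carrier G" and p: "p \<in> M" and q: "q \<in> M"
  shows "D (mv h p) (mv h q) \<le> D p q"
proof -
  let ?R = "\<lambda>p q c. mv h p \<in> M \<and> mv h q \<in> M \<and> D (mv h p) (mv h q) \<le> c"
  have e: "?R (z, v) (z, w) 0" if "adj v w" "z \<in> Kv v" "z \<in> Kv w" for v w z
  proof -
    have V: "v \<in> V" "w \<in> V" using that adj_V adj_sym by blast+
    have "D (act h z, translate h v) (act h z, translate h w) = 0"
      using D_adj[OF translate_adj[OF h that(1)]] translate_Kv[OF h] V that by simp
    then show ?thesis using mv_M[OF h] V that by (simp add: M_iff mv_def translate_V[OF h] translate_Kv[OF h])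
  qed
  have "?R p q (D p q)"
  proof (rule Gl.D_attained[where R = ?R, OF _ _ _ _ p q])
    fix x y v assume v: "v \<in> V" "x \<in> Kv v" "y \<in> Kv v"
    then have "x \<in> X" "y \<in> X" using Kv_X by blast+
    moreover have "D (mv h (x, v)) (mv h (y, v)) = d (act h x) (act h y)"
      by (subst Gl.D_same) (simp_all add: mv_def)
    ultimately show "?R (x, v) (y, v) (d x y)" using mv_M[OF h] v act_dist[OF h] by (simp add: M_iff)
  next
    fix z v assume v: "v \<in> V" "0 < hgt v" "z \<in> Kv v" "z \<in> Kv (par v)"
    then show "?R (z, v) (z, par v) 0" "?R (z, par v) (z, v) 0"
      using e[of v "par v" z] e[of "par v" v z] par_hgt_adj(1) adj_sym by blast+
  next
    fix p q r a b assume "?R p q a" "?R q r b"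
    then show "?R p r (a + b)" using Gl.D_tri[of "mv h p" "mv h q" "mv h r"] by linarith
  qed
  then show ?thesis by blast
qed

lemma translate_inv:
  assumes "h \<in> carrier G" "v \<in> V"
  shows "translate (inv h) (translate h v) = v"
proof -
  consider (g) g where "v = Inl g" "g \<in> carrier G" | (c) i g where "v = Inr (i, g <# (Gs ! i))" "i < k" "g \<in> carrier G"
    using assms unfolding S_vertices_def by blast
  then show ?thesis
    using assms(1) l_coset_translate by cases (simp_all add: translate_def m_assoc[symmetric])
qed

lemma D_mv:
  assumes h: "h \<in> carrier G" and p: "p \<in> M" and q: "q \<in> M"
  shows "D (mv h p) (mv h q) = D p q"
proof (rule antisym)
  have i: "mv (inv h) (mv h u) = u" if "u \<in> M" for u
    using that translate_inv[OF h] act_inv_cancel(1)[OF h] Gl.M_D[OF that] by (simp add: mv_def)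
  show "D p q \<le> D (mv h p) (mv h q)"
    using D_mv_le[of "inv h" "mv h p" "mv h q"] mv_M h p q i by simp
qed (rule D_mv_le[OF assms])

lemma const_step_D:
  assumes "(const_step G Gs bs act K)\<^sup>*\<^sup>* u w" "u \<in> M"
  shows "w \<in> M \<and> D u w = 0"
  using assms
proof (induction rule: rtranclp_induct)
  case base then show ?case using Gl.D_self by blast
next
  case (step y z)
  then have s: "fst y = fst z" "adj (snd y) (snd z)" "fst y \<in> Kv (snd y)" "fst y \<in> Kv (snd z)"
    by (auto simp: const_step_def)
  have yz: "y = (fst y, snd y)" "z = (fst y, snd z)" using s(1) by (auto simp: prod_eq_iff)
  have z: "z \<in> M" using s adj_V adj_sym yz(2) M_iff by metis
  have "D y z = 0" using D_adj[OF s(2,3,4)] yz by simp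
  have u: "u \<in> M" and y: "y \<in> M" "D u y = 0" using step.IH step.prems by blast+
  have "0 \<le> d (fst u) (fst z)" by (rule T.nonneg[OF Gl.M_D(3)[OF u] Gl.M_D(3)[OF z]])
  then have "D u z = 0"
    using Gl.D_tri[OF u y(1) z] Gl.d_le_D[OF u z] y(2) \<open>D y z = 0\<close> by linarith
  then show ?case using z by blast
qed

abbreviation S0 where "S0 \<equiv> Sigma0 G act K"

definition emb :: "'p \<times> 'g \<Rightarrow> 'p \<times> 'g vertex" where
  "emb p = (fst p, Inl (snd p))"

lemma S0_iff: "(x, g) \<in> S0 \<longleftrightarrow> g \<in> carrier G \<and> x \<in> act g ` K"
  by (simp add: Sigma0_def)

lemma emb_M: "p \<in> S0 \<Longrightarrow> emb p \<in> M"
  unfolding Gl.M_def emb_def by (cases p) (auto simp: S0_iff Kv_simps S_vertices_def)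

abbreviation cost :: "('g vertex \<times> 'p \<times> 'p) list \<Rightarrow> real" where
  "cost js \<equiv> sum_list (map (\<lambda>(v, a, b). d a b) js)"

definition linked :: "'g vertex \<times> 'p \<times> 'p \<Rightarrow> 'g vertex \<times> 'p \<times> 'p \<Rightarrow> bool" where
  "linked j j' \<longleftrightarrow> (const_step G Gs bs act K)\<^sup>*\<^sup>*
     (case j of (v, a, b) \<Rightarrow> (b, v)) (case j' of (v, a, b) \<Rightarrow> (a, v))"

text \<open>\<open>admissible_chain\<close> with endpoints over arbitrary vertices of S:
  concatenation and induction have to pass through coset vertices.\<close>

definition chain :: "'p \<times> 'g vertex \<Rightarrow> 'p \<times> 'g vertex \<Rightarrow> ('g vertex \<times> 'p \<times> 'p) list \<Rightarrow> bool" where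
  "chain p q js \<longleftrightarrow> js \<noteq> [] \<and>
     (\<forall>(v, a, b)\<in>set js. v \<in> V \<and> a \<in> Kv v \<and> b \<in> Kv v) \<and>
     (case hd js of (v, a, b) \<Rightarrow> (a, v)) = p \<and> (case last js of (v, a, b) \<Rightarrow> (b, v)) = q \<and>
     successively linked js"

lemma admissible_iff_chain: "admissible_chain G Gs bs act K p q js \<longleftrightarrow> chain (emb p) (emb q) js"
  unfolding admissible_chain_def chain_def emb_def linked_def successively_conv_nth
  by (auto split: prod.splits)

lemma chain_ge: "chain p q js \<Longrightarrow> p \<in> M \<and> q \<in> M \<and> D p q \<le> cost js"
proof (induction js arbitrary: p)
  case Nil then show ?case by (simp add: chain_def)
next
  case (Cons j js)
  obtain v a b where j: "j = (v, a, b)" by (cases j) auto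
  have v: "v \<in> V" "a \<in> Kv v" "b \<in> Kv v" and p: "p = (a, v)" using Cons.prems j by (auto simp: chain_def)
  then have m: "(a, v) \<in> M" "(b, v) \<in> M" by (simp_all add: M_iff)
  have dj: "D (a, v) (b, v) = d a b" by (subst Gl.D_same) simp_all
  show ?case
  proof (cases js)
    case Nil then show ?thesis using Cons.prems j p m dj by (simp add: chain_def)
  next
    case (Cons j' js')
    let ?p' = "case j' of (v, a, b) \<Rightarrow> (a, v)"
    have "chain ?p' q js" using Cons.prems Cons by (auto simp: chain_def)
    then have IH: "?p' \<in> M" "q \<in> M" "D ?p' q \<le> cost js" using Cons.IH by auto
    have "linked j j'" using Cons.prems Cons by (simp add: chain_def)
    then have "D (b, v) ?p' = 0" using const_step_D m j by (auto simp: linked_def)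
    then have "D p q \<le> d a b + D ?p' q"
      using Gl.D_tri[OF m(1,2) IH(2)] Gl.D_tri[OF m(2) IH(1,2)] dj p by simp
    then show ?thesis using IH p m j by simp
  qed
qed

lemma chain_append:
  assumes "chain p q js" "chain q r js'"
  shows "chain p r (js @ js')"
proof -
  have "linked (last js) (hd js')"
    using assms by (auto simp: chain_def linked_def split: prod.splits)
  then show ?thesis using assms by (auto simp: chain_def successively_append_iff)
qed

lemma chain_exists:
  assumes "p \<in> M" "q \<in> M"
  shows "\<exists>js. chain p q js \<and> cost js = D p q"
proof (rule Gl.D_attained[where R = "\<lambda>p q c. \<exists>js. chain p q js \<and> cost js = c", OF _ _ _ _ assms])
  fix x y v assume v: "v \<in> V" "x \<in> Kv v" "y \<in> Kv v"
  then show "\<exists>js. chain (x, v) (y, v) js \<and> cost js = d x y"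
    by (intro exI[of _ "[(v, x, y)]"]) (simp add: chain_def)
next
  fix z v assume v: "v \<in> V" "0 < hgt v" "z \<in> Kv v" "z \<in> Kv (par v)"
  have a: "adj v (par v)" "par v \<in> V" using par_hgt_adj v Gl.par_V by auto
  have "const_step G Gs bs act K (z, v) (z, par v)" "const_step G Gs bs act K (z, par v) (z, v)"
    using a adj_sym v by (auto simp: const_step_def)
  then have "linked (v, z, z) (par v, z, z)" "linked (par v, z, z) (v, z, z)" by (auto simp: linked_def)
  moreover have "d z z = 0" using T.refl0 Kv_X v by blast
  ultimately show "\<exists>js. chain (z, v) (z, par v) js \<and> cost js = 0" "\<exists>js. chain (z, par v) (z, v) js \<and> cost js = 0"
    using v a by (auto simp: chain_def intro: exI[of _ "[(v, z, z), (par v, z, z)]"] exI[of _ "[(par v, z, z), (v, z, z)]"])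
next
  fix p q r a b assume "\<exists>js. chain p q js \<and> cost js = a" "\<exists>js. chain q r js \<and> cost js = b"
  then show "\<exists>js. chain p r js \<and> cost js = a + b"
    using chain_append by (metis map_append sum_list_append)
qed

text \<open>\<open>chain_ge\<close> bounds all chains from below and \<open>chain_exists\<close>
  attains the bound, so the infimum is a minimum.\<close>

lemma delta_eq:
  assumes "p \<in> S0" "q \<in> S0"
  shows "delta G Gs bs d act K p q = D (emb p) (emb q)"
  unfolding delta_def admissible_iff_chain
proof (rule cInf_eq_minimum)
  show "D (emb p) (emb q) \<in> {cost js |js. chain (emb p) (emb q) js}"
    using chain_exists[OF emb_M[OF assms(1)] emb_M[OF assms(2)]] by force
  show "D (emb p) (emb q) \<le> x" if "x \<in> {cost js |js. chain (emb p) (emb q) js}" for x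
    using that chain_ge by blast
qed

definition pt :: "'p \<Rightarrow> 'g \<Rightarrow> ('p \<times> 'g) set" where
  "pt x g = {q \<in> S0. D (emb (x, g)) (emb q) = 0}"

abbreviation Y where "Y \<equiv> TK_carrier G Gs bs d act K"
abbreviation dY where "dY \<equiv> TK_dist G Gs bs d act K"
abbreviation actY where "actY \<equiv> TK_act G act"

lemma Y_eq: "Y = {pt x g | x g. (x, g) \<in> S0}"
proof -
  let ?r = "{(p, q). p \<in> S0 \<and> q \<in> S0 \<and> delta G Gs bs d act K p q = 0}"
  have "?r `` {p} = pt (fst p) (snd p)" if "p \<in> S0" for p
    using that delta_eq[OF that] unfolding pt_def by auto
  then have "?r `` {(x, g)} = pt x g" if "(x, g) \<in> S0" for x g using that by force
  note pt = this
  show ?thesis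
  proof (intro equalityI subsetI)
    fix C assume "C \<in> Y"
    then obtain x g where "(x, g) \<in> S0" "C = ?r `` {(x, g)}"
      unfolding TK_carrier_def by (auto elim!: quotientE)
    then show "C \<in> {pt x g | x g. (x, g) \<in> S0}" using pt by blast
  next
    fix C assume "C \<in> {pt x g | x g. (x, g) \<in> S0}"
    then obtain x g where "(x, g) \<in> S0" "C = ?r `` {(x, g)}" using pt by blast
    then show "C \<in> Y" unfolding TK_carrier_def using quotientI[of "(x, g)" S0 ?r] by simp
  qed
qed

lemma Y_cases:
  assumes "C \<in> Y"
  obtains x g where "(x, g) \<in> S0" "C = pt x g"
  using assms unfolding Y_eq by blast

lemma Y_I: "(x, g) \<in> S0 \<Longrightarrow> pt x g \<in> Y"
  unfolding Y_eq by blast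

lemma D_zero_cong:
  assumes "p \<in> M" "p' \<in> M" "q \<in> M" "D p p' = 0"
  shows "D p q = D p' q"
  using Gl.D_tri[OF assms(1,2,3)] Gl.D_tri[OF assms(2,1,3)] Gl.D_sym[OF assms(1,2)] assms(4) by simp

lemma mem_pt: "(x, g) \<in> S0 \<Longrightarrow> (x, g) \<in> pt x g"
  using Gl.D_self emb_M by (auto simp: pt_def)

lemma dY_pt:
  assumes "(x, g) \<in> S0" "(y, h) \<in> S0"
  shows "dY (pt x g) (pt y h) = D (emb (x, g)) (emb (y, h))"
proof -
  define p where "p = (SOME p. p \<in> pt x g)"
  define q where "q = (SOME q. q \<in> pt y h)"
  have "p \<in> pt x g" "q \<in> pt y h" unfolding p_def q_def
    by (rule someI, rule mem_pt, rule assms)+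
  then have pq: "p \<in> S0" "q \<in> S0" "D (emb (x, g)) (emb p) = 0" "D (emb (y, h)) (emb q) = 0" by (auto simp: pt_def)
  note m = emb_M[OF pq(1)] emb_M[OF pq(2)] emb_M[OF assms(1)] emb_M[OF assms(2)]
  have "dY (pt x g) (pt y h) = D (emb p) (emb q)"
    unfolding TK_dist_def p_def[symmetric] q_def[symmetric] by (rule delta_eq[OF pq(1,2)])
  also have "\<dots> = D (emb (x, g)) (emb q)" using D_zero_cong[OF m(3,1,2) pq(3)] by simp
  also have "\<dots> = D (emb q) (emb (x, g))" using Gl.D_sym m by simp
  also have "\<dots> = D (emb (y, h)) (emb (x, g))" using D_zero_cong[OF m(4,2,3) pq(4)] by simp
  also have "\<dots> = D (emb (x, g)) (emb (y, h))" using Gl.D_sym m by simp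
  finally show ?thesis .
qed

lemma pt_eq_iff:
  assumes "(x, g) \<in> S0" "(y, h) \<in> S0"
  shows "pt x g = pt y h \<longleftrightarrow> D (emb (x, g)) (emb (y, h)) = 0"
proof
  assume "pt x g = pt y h"
  then show "D (emb (x, g)) (emb (y, h)) = 0" using mem_pt[OF assms(2)] by (auto simp: pt_def)
next
  assume "D (emb (x, g)) (emb (y, h)) = 0"
  then show "pt x g = pt y h"
    using D_zero_cong[OF emb_M[OF assms(1)] emb_M[OF assms(2)] emb_M] unfolding pt_def by auto
qed

lemma dY_same:
  assumes "(x, g) \<in> S0" "(y, g) \<in> S0"
  shows "dY (pt x g) (pt y g) = d x y"
  using dY_pt[OF assms] Gl.D_same[of "emb (x, g)" "emb (y, g)"] by (simp add: emb_def)

lemma d_le_dY: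
  assumes "(x, g) \<in> S0" "(y, h) \<in> S0"
  shows "d x y \<le> dY (pt x g) (pt y h)"
  using dY_pt[OF assms] Gl.d_le_D[OF emb_M[OF assms(1)] emb_M[OF assms(2)]] by (simp add: emb_def)

lemma S0_X: "(x, g) \<in> S0 \<Longrightarrow> x \<in> X" "(x, g) \<in> S0 \<Longrightarrow> g \<in> carrier G"
  using act_X K_X by (auto simp: S0_iff)

lemma S0_act: "(x, g) \<in> S0 \<Longrightarrow> h \<in> carrier G \<Longrightarrow> (act h x, h \<otimes> g) \<in> S0"
  using act_mult K_X by (auto simp: S0_iff)

lemma pt_fst:
  assumes "(x, g) \<in> S0" "(y, h) \<in> S0" "pt x g = pt y h"
  shows "x = y"
proof -
  have i: "x \<in> X" "y \<in> X" by (rule S0_X(1), rule assms)+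
  have "dY (pt x g) (pt y h) = 0"
    unfolding assms(3) dY_same[OF assms(2,2)] by (rule T.refl0[OF i(2)])
  then have "d x y \<le> 0" using d_le_dY[OF assms(1,2)] by simp
  then show ?thesis using T.nonneg[OF i] T.zero[OF i] by simp
qed

lemma act_pt:
  assumes "(x, g) \<in> S0" and h: "h \<in> carrier G"
  shows "actY h (pt x g) = pt (act h x) (h \<otimes> g)"
proof -
  have *: "(act h' y, h' \<otimes> g') \<in> pt (act h' x) (h' \<otimes> g)"
    if "(y, g') \<in> pt x g" "(x, g) \<in> S0" "h' \<in> carrier G" for y g' h' x g
  proof -
    have m: "(y, g') \<in> S0" "D (emb (x, g)) (emb (y, g')) = 0"
      using that(1) unfolding pt_def mem_Collect_eq by (rule conjunct1, rule conjunct2)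
    have "D (mv h' (emb (x, g))) (mv h' (emb (y, g'))) = 0"
      using D_mv[OF that(3) emb_M[OF that(2)] emb_M[OF m(1)]] m by simp
    then show ?thesis using S0_act[OF m(1) that(3)] by (simp add: pt_def emb_def mv_def translate_def)
  qed
  show ?thesis
  proof
    show "actY h (pt x g) \<subseteq> pt (act h x) (h \<otimes> g)"
      unfolding TK_act_def using *[OF _ assms] by auto
    show "pt (act h x) (h \<otimes> g) \<subseteq> actY h (pt x g)"
    proof
      fix u assume u: "u \<in> pt (act h x) (h \<otimes> g)"
      obtain y g' where y: "u = (y, g')" by (cases u)
      have s: "(y, g') \<in> S0" using u y by (auto simp: pt_def)
      have "(act (inv h) y, inv h \<otimes> g') \<in> pt (act (inv h) (act h x)) (inv h \<otimes> (h \<otimes> g))"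
        using *[OF _ S0_act[OF assms], of y g' "inv h"] u y h by simp
      then have "(act (inv h) y, inv h \<otimes> g') \<in> pt x g"
        using act_inv_cancel(1)[OF h] S0_X[OF assms(1)] h by (simp add: m_assoc[symmetric])
      moreover have "u = (act h (act (inv h) y), h \<otimes> (inv h \<otimes> g'))"
        using y act_inv_cancel(2)[OF h] S0_X[OF s] h by (simp add: m_assoc[symmetric])
      ultimately show "u \<in> actY h (pt x g)" unfolding TK_act_def by force
    qed
  qed
qed

text \<open>The constant path runs from g v_0 to g l v_0 through the coset vertex g v_i, which is
  adjacent to both and whose tree contains gK.\<close>

lemma pt_peripheral:
  assumes "(x, g) \<in> S0" "i < k" "l \<in> Gs ! i" "(x, g \<otimes> l) \<in> S0"
  shows "pt x g = pt x (g \<otimes> l)"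
proof -
  have c: "g \<in> carrier G" "l \<in> carrier G" by (rule S0_X(2)[OF assms(1)], rule Gs_carrier[OF assms(2,3)])
  let ?w = "Inr (i, g <# (Gs ! i))"
  have e: "(g \<otimes> l) <# (Gs ! i) = g <# (Gs ! i)"
  proof -
    have "g \<otimes> l \<in> g <# (Gs ! i)" using assms(3) unfolding l_coset_def by blast
    from l_repr_independence[OF this c(1) Gs_subgroup[OF assms(2)]] show ?thesis by simp
  qed
  have a: "adj (Inl g) ?w" using c assms unfolding S_adj_def by blast
  have "adj (Inl (g \<otimes> l)) (Inr (i, (g \<otimes> l) <# (Gs ! i)))" using m_closed[OF c] assms unfolding S_adj_def by blast
  then have a2: "adj ?w (Inl (g \<otimes> l))" using adj_sym e by simp
  have k: "x \<in> Kv (Inl g)" "x \<in> Kv (Inl (g \<otimes> l))" using assms by (auto simp: S0_iff Kv_simps)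
  have w: "x \<in> Kv ?w" using self_coset[OF assms(2) c(1)] k(1) by (auto simp: Kv_simps)
  have "D (emb (x, g)) (x, ?w) = 0" "D (x, ?w) (emb (x, g \<otimes> l)) = 0"
    using D_adj[OF a k(1) w] D_adj[OF a2 w k(2)] by (simp_all add: emb_def)
  moreover have "(x, ?w) \<in> M" using w adj_V[OF a2] by (simp add: M_iff)
  ultimately have "D (emb (x, g)) (emb (x, g \<otimes> l)) = 0"
    using D_zero_cong[OF emb_M[OF assms(1)] _ emb_M[OF assms(4)]] by simp
  then show ?thesis using pt_eq_iff assms by blast
qed

lemma pt_basis:
  assumes "(x, g) \<in> S0" "j < length bs" "(x, g \<otimes> bs ! j) \<in> S0"
  shows "pt x g = pt x (g \<otimes> bs ! j)"
proof -
  have g: "g \<in> carrier G" by (rule S0_X(2)[OF assms(1)])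
  have "adj (Inl g) (Inl (g \<otimes> bs ! j))" using assms(2) g unfolding S_adj_def by blast
  then have "D (emb (x, g)) (emb (x, g \<otimes> bs ! j)) = 0"
    unfolding emb_def fst_conv snd_conv
    by (rule D_adj) (use assms(1,3) in \<open>simp_all add: S0_iff Kv_simps\<close>)
  then show ?thesis using pt_eq_iff assms by blast
qed

lemma pt_basis_inv:
  assumes "(x, g) \<in> S0" "j < length bs" "(x, g \<otimes> inv (bs ! j)) \<in> S0"
  shows "pt x g = pt x (g \<otimes> inv (bs ! j))"
  using pt_basis[OF assms(3,2)] assms bs_carrier[OF assms(2)] S0_X(2)[OF assms(1)] by (simp add: m_assoc)

end

text \<open>All representatives of a point of T_K have the same T-coordinate, by
  \<open>pt_fst\<close>, so the choice is immaterial. As K does not occur, one map serves for every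
  tree of the sequence.\<close>

definition proj :: "('p \<times> 'g) set \<Rightarrow> 'p" where
  "proj C = fst (SOME p. p \<in> C)"

section \<open>The quotient T_K as a real tree over T\<close>

context geometric_data begin

lemma Y_metric: "is_metric Y dY"
  unfolding is_metric_def
proof (intro conjI ballI)
  fix C C' assume "C \<in> Y" "C' \<in> Y"
  then obtain x g y h where p: "(x, g) \<in> S0" "C = pt x g" "(y, h) \<in> S0" "C' = pt y h" by (elim Y_cases)
  note m = emb_M[OF p(1)] emb_M[OF p(3)]
  show "dY C C' = dY C' C" unfolding p dY_pt[OF p(1,3)] dY_pt[OF p(3,1)] by (rule Gl.D_sym[OF m])
  show "dY C C' = 0 \<longleftrightarrow> C = C'" unfolding p dY_pt[OF p(1,3)] pt_eq_iff[OF p(1,3)] ..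
  fix C'' assume "C'' \<in> Y"
  then obtain z l where q: "(z, l) \<in> S0" "C'' = pt z l" by (elim Y_cases)
  show "dY C C'' \<le> dY C C' + dY C' C''"
    unfolding p q dY_pt[OF p(1,3)] dY_pt[OF p(3) q(1)] dY_pt[OF p(1) q(1)]
    by (rule Gl.D_tri[OF m emb_M[OF q(1)]])
qed

sublocale Yh: hyperbolic0 Y dY
proof
  show "is_metric Y dY" by (rule Y_metric)
  fix A B C E assume "A \<in> Y" "B \<in> Y" "C \<in> Y" "E \<in> Y"
  then obtain a a' b b' c c' e e' where p: "(a, a') \<in> S0" "A = pt a a'" "(b, b') \<in> S0" "B = pt b b'"
    "(c, c') \<in> S0" "C = pt c c'" "(e, e') \<in> S0" "E = pt e e'" by (elim Y_cases)
  show "dY A B + dY C E \<le> max (dY A C + dY B E) (dY A E + dY B C)"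
    unfolding p dY_pt[OF p(1,3)] dY_pt[OF p(5,7)] dY_pt[OF p(1,5)] dY_pt[OF p(3,7)] dY_pt[OF p(1,7)] dY_pt[OF p(3,5)]
    using Gl.Q_holds[OF emb_M[OF p(1)] emb_M[OF p(3)] emb_M[OF p(5)] emb_M[OF p(7)]] unfolding Gl.Q_def by blast
qed

lemma Y_action: "isometric_action G Y dY actY"
  unfolding isometric_action_def
proof (intro conjI ballI)
  fix C assume "C \<in> Y"
  then obtain x g where p: "(x, g) \<in> S0" "C = pt x g" by (elim Y_cases)
  note xg = S0_X[OF p(1)]
  show "actY \<one> C = C" unfolding p act_pt[OF p(1) one_closed] using xg act_one by simp
  fix h assume h: "h \<in> carrier G"
  show "actY h C \<in> Y" unfolding p act_pt[OF p(1) h] by (rule Y_I[OF S0_act[OF p(1) h]])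
  {
    fix C' assume "C' \<in> Y"
    then obtain y l where q: "(y, l) \<in> S0" "C' = pt y l" by (elim Y_cases)
    have "dY (actY h C) (actY h C') = D (mv h (emb (x, g))) (mv h (emb (y, l)))"
      unfolding p q act_pt[OF p(1) h] act_pt[OF q(1) h] dY_pt[OF S0_act[OF p(1) h] S0_act[OF q(1) h]]
      by (simp add: emb_def mv_def translate_def)
    then show "dY (actY h C) (actY h C') = dY C C'"
      unfolding p q dY_pt[OF p(1) q(1)] D_mv[OF h emb_M[OF p(1)] emb_M[OF q(1)]] .
  }
  fix l assume l: "l \<in> carrier G"
  show "actY (h \<otimes> l) C = actY h (actY l C)"
    unfolding p act_pt[OF p(1) l] act_pt[OF S0_act[OF p(1) l] h] act_pt[OF p(1) m_closed[OF h l]]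
    using act_mult[OF h l] xg h l by (simp add: m_assoc)
qed

text \<open>Both points lie in the copy of one translate gK, where the distances of T_K are those of
  T (\<open>dY_same\<close>).\<close>

definition link :: "('p \<times> 'g) set \<Rightarrow> ('p \<times> 'g) set \<Rightarrow> bool" where
  "link C C' \<longleftrightarrow> (\<exists>g x y. (x, g) \<in> S0 \<and> (y, g) \<in> S0 \<and> C = pt x g \<and> C' = pt y g)"

lemma link_I: "(x, g) \<in> S0 \<Longrightarrow> (y, g) \<in> S0 \<Longrightarrow> link (pt x g) (pt y g)"
  unfolding link_def by blast

lemma link_Y: "link C C' \<Longrightarrow> C \<in> Y \<and> C' \<in> Y"
  unfolding link_def using Y_I by blast

lemma link_act:
  assumes "h \<in> carrier G" "link C C'"
  shows "link (actY h C) (actY h C')"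
proof -
  obtain g x y where p: "(x, g) \<in> S0" "(y, g) \<in> S0" "C = pt x g" "C' = pt y g" using assms(2) unfolding link_def by blast
  show ?thesis unfolding p(3,4) act_pt[OF p(1) assms(1)] act_pt[OF p(2) assms(1)]
    by (rule link_I[OF S0_act[OF p(1) assms(1)] S0_act[OF p(2) assms(1)]])
qed

lemma links_act:
  assumes h: "h \<in> carrier G" and "link\<^sup>*\<^sup>* C C'"
  shows "link\<^sup>*\<^sup>* (actY h C) (actY h C')"
  using assms(2)
proof (induction rule: rtranclp_induct)
  case base show ?case by simp
next
  case (step y z)
  show ?case by (rule rtranclp.rtrancl_into_rtrancl[OF step.IH link_act[OF h step.hyps(2)]])
qed

lemma K_S0: "x \<in> K \<longleftrightarrow> (x, \<one>) \<in> S0"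
proof -
  have "act \<one> ` K = K" using act_one K_X by (force simp: image_iff)
  then show ?thesis by (simp add: S0_iff)
qed

lemma shared_peripheral:
  assumes "i < k" "l \<in> Gs ! i"
  shows "\<exists>z. (z, \<one>) \<in> S0 \<and> (z, l) \<in> S0 \<and> pt z \<one> = pt z l"
proof -
  obtain p where p: "p \<in> K" "fixes_point act (Gs ! i) p" using K_fix assms by blast
  have l: "l \<in> carrier G" using Gs_carrier assms by blast
  have "p = act l p" using p assms unfolding fixes_point_def by simp
  then have s: "(p, \<one>) \<in> S0" "(p, l) \<in> S0" using p(1) l K_S0 unfolding S0_iff by blast+
  then show ?thesis using pt_peripheral[of p \<one> i l] assms l by auto
qed

lemma shared_basis:
  assumes "j < length bs"
  shows "\<exists>z. (z, \<one>) \<in> S0 \<and> (z, bs ! j) \<in> S0 \<and> pt z \<one> = pt z (bs ! j)"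
    "\<exists>z. (z, \<one>) \<in> S0 \<and> (z, inv (bs ! j)) \<in> S0 \<and> pt z \<one> = pt z (inv (bs ! j))"
proof -
  have b: "bs ! j \<in> carrier G" using bs_carrier assms by blast
  obtain x where x: "x \<in> K" "x \<in> act (bs ! j) ` K" using K_basis assms by blast
  then obtain y where y: "y \<in> K" "x = act (bs ! j) y" by blast
  have s: "(x, \<one>) \<in> S0" "(x, bs ! j) \<in> S0" using x b K_S0 unfolding S0_iff by blast+
  then show "\<exists>z. (z, \<one>) \<in> S0 \<and> (z, bs ! j) \<in> S0 \<and> pt z \<one> = pt z (bs ! j)"
    using pt_basis[of x \<one> j] assms b by auto
  have "y = act (inv (bs ! j)) x" using act_inv_cancel(1)[OF b K_X[OF y(1)]] y by simp
  then have "y \<in> act (inv (bs ! j)) ` K" using x(1) by (rule image_eqI)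
  then have s2: "(y, inv (bs ! j)) \<in> S0" using inv_closed[OF b] unfolding S0_iff by (rule conjI[rotated])
  have s1: "(y, \<one>) \<in> S0" using y(1) K_S0 by (rule iffD1[rotated])
  show "\<exists>z. (z, \<one>) \<in> S0 \<and> (z, inv (bs ! j)) \<in> S0 \<and> pt z \<one> = pt z (inv (bs ! j))"
    using pt_basis_inv[of y \<one> j] assms b s1 s2 by auto
qed

text \<open>Induction on g by prepended letters l: in T_K the copies of K and lK share a point, and
  a chain from K to gK, translated by l, leads from lK to lgK.\<close>

lemma links_from_one:
  assumes "g \<in> carrier G" "(x, \<one>) \<in> S0" "(y, g) \<in> S0"
  shows "link\<^sup>*\<^sup>* (pt x \<one>) (pt y g)"
proof -
  have step: "\<forall>x y. (x, \<one>) \<in> S0 \<longrightarrow> (y, l \<otimes> g) \<in> S0 \<longrightarrow> link\<^sup>*\<^sup>* (pt x \<one>) (pt y (l \<otimes> g))"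
    if g: "g \<in> carrier G" and l: "l \<in> carrier G"
      and IH: "\<forall>x y. (x, \<one>) \<in> S0 \<longrightarrow> (y, g) \<in> S0 \<longrightarrow> link\<^sup>*\<^sup>* (pt x \<one>) (pt y g)"
      and shared: "\<exists>z. (z, \<one>) \<in> S0 \<and> (z, l) \<in> S0 \<and> pt z \<one> = pt z l" for g l
  proof (intro allI impI)
    fix x y assume xy: "(x, \<one>) \<in> S0" "(y, l \<otimes> g) \<in> S0"
    obtain z where z: "(z, \<one>) \<in> S0" "(z, l) \<in> S0" "pt z \<one> = pt z l" using shared by blast
    have li: "inv l \<in> carrier G" using l by simp
    have z': "(act (inv l) z, \<one>) \<in> S0" using S0_act[OF z(2) li] l by simp
    have y': "(act (inv l) y, g) \<in> S0" using S0_act[OF xy(2) li] l g by (simp add: m_assoc[symmetric])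
    have "link\<^sup>*\<^sup>* (pt (act (inv l) z) \<one>) (pt (act (inv l) y) g)" using IH z' y' by blast
    from links_act[OF l this] have "link\<^sup>*\<^sup>* (pt z l) (pt y (l \<otimes> g))"
      unfolding act_pt[OF z' l] act_pt[OF y' l] using act_inv_cancel(2)[OF l] S0_X(1)[OF z(2)] S0_X(1)[OF xy(2)] l
      by simp
    then show "link\<^sup>*\<^sup>* (pt x \<one>) (pt y (l \<otimes> g))"
      using link_I[OF xy(1) z(1)] z(3) by (metis converse_rtranclp_into_rtranclp)
  qed
  have "\<forall>x y. (x, \<one>) \<in> S0 \<longrightarrow> (y, g) \<in> S0 \<longrightarrow> link\<^sup>*\<^sup>* (pt x \<one>) (pt y g)"
    using assms(1)
  proof (induction rule: free_product_induct)
    case one then show ?case using link_I by blast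
  next
    case (peripheral g i h)
    show ?case
      by (rule step[OF peripheral.hyps(1) Gs_carrier[OF peripheral.hyps(2,3)] peripheral.IH
          shared_peripheral[OF peripheral.hyps(2,3)]])
  next
    case (basis g j)
    show ?case by (rule step[OF basis.hyps(1) bs_carrier[OF basis.hyps(2)] basis.IH shared_basis(1)[OF basis.hyps(2)]])
  next
    case (basis_inv g j)
    show ?case by (rule step[OF basis_inv.hyps(1) inv_closed[OF bs_carrier[OF basis_inv.hyps(2)]] basis_inv.IH
          shared_basis(2)[OF basis_inv.hyps(2)]])
  qed
  then show ?thesis using assms by blast
qed

lemma links_all:
  assumes "C \<in> Y" "C' \<in> Y"
  shows "link\<^sup>*\<^sup>* C C'"
proof -
  obtain x g y h where p: "(x, g) \<in> S0" "C = pt x g" "(y, h) \<in> S0" "C' = pt y h" using assms by (elim Y_cases)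
  have g: "g \<in> carrier G" and h: "h \<in> carrier G" using S0_X(2) p by blast+
  have gi: "inv g \<in> carrier G" using g by simp
  have a: "(act (inv g) x, \<one>) \<in> S0" using S0_act[OF p(1) gi] g by simp
  have b: "(act (inv g) y, inv g \<otimes> h) \<in> S0" using S0_act[OF p(3) gi] .
  have "link\<^sup>*\<^sup>* (pt (act (inv g) x) \<one>) (pt (act (inv g) y) (inv g \<otimes> h))"
    using links_from_one[OF _ a b] g h by simp
  from links_act[OF g this] show ?thesis
    unfolding act_pt[OF a g] act_pt[OF b g] p
    using act_inv_cancel(2)[OF g] S0_X(1)[OF p(1)] S0_X(1)[OF p(3)] g h by (simp add: m_assoc[symmetric])
qed

lemma S0_convex:
  assumes "(x, g) \<in> S0" "(y, g) \<in> S0" "T.btw x m y"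
  shows "(m, g) \<in> S0"
proof -
  have g: "g \<in> carrier G" by (rule S0_X(2)[OF assms(1)])
  show ?thesis
    using T.gated_convex[OF act_gated[OF K_gated g]] assms g unfolding T.convex_in_def S0_iff by blast
qed

lemma link_geod:
  assumes "link C C'"
  shows "Yh.geod C C'"
  unfolding Yh.geod_def
proof (intro allI impI)
  fix t assume t: "0 \<le> t \<and> t \<le> dY C C'"
  obtain g x y where p: "(x, g) \<in> S0" "(y, g) \<in> S0" "C = pt x g" "C' = pt y g" using assms unfolding link_def by blast
  have d: "dY C C' = d x y" unfolding p(3,4) by (rule dY_same[OF p(1,2)])
  obtain m where m: "T.btw x m y" "d x m = t" "d m y = d x y - t"
    using T.intermediate[OF S0_X(1)[OF p(1)] S0_X(1)[OF p(2)], of t] t d by auto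
  have s: "(m, g) \<in> S0" by (rule S0_convex[OF p(1,2) m(1)])
  show "\<exists>m\<in>Y. dY C m = t \<and> dY m C' = dY C C' - t"
    by (rule bexI[OF _ Y_I[OF s]]) (simp add: p(3,4) dY_same[OF p(1) s] dY_same[OF s p(2)] dY_same[OF p(1,2)] m)
qed

lemma Y_geod:
  assumes "C \<in> Y" "C' \<in> Y"
  shows "Yh.geod C C'"
proof -
  have "C' \<in> Y \<and> Yh.geod C C'"
    using links_all[OF assms]
  proof (induction rule: rtranclp_induct)
    case base
    have "Yh.geod C C" unfolding Yh.geod_def
      using Yh.refl0[OF assms(1)] by (auto intro!: bexI[OF _ assms(1)])
    then show ?case using assms(1) by blast
  next
    case (step y z)
    then have "y \<in> Y" "z \<in> Y" "Yh.geod C y" "Yh.geod y z" using link_Y link_geod by blast+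
    then show ?case using Yh.geod_trans[OF assms(1)] by blast
  qed
  then show ?thesis ..
qed

lemma K_nonempty: "\<exists>x. (x, \<one>) \<in> S0"
  using K_gated K_S0 unfolding T.gated_def by blast

sublocale Yt: ztree Y dY
proof
  show "Y \<noteq> {}" using K_nonempty Y_I by blast
qed (rule Y_geod)

sublocale Ya: tree_action G Gs bs Y dY actY
  by unfold_locales (rule Y_action)

text \<open>The copy of [x,y] is a geodesic of T_K, and in a 0-hyperbolic space a point between two
  given ones is determined by its distance to one of them.\<close>

lemma btw_link:
  assumes "(x, g) \<in> S0" "(y, g) \<in> S0" "Yh.btw (pt x g) m (pt y g)"
  obtains z where "(z, g) \<in> S0" "T.btw x z y" "m = pt z g"
proof -
  note i = S0_X(1)[OF assms(1)] S0_X(1)[OF assms(2)] and Yi = Y_I[OF assms(1)] Y_I[OF assms(2)]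
  have mY: "m \<in> Y" by (rule Yh.btw_in[OF assms(3)])
  have "dY (pt x g) m + dY m (pt y g) = d x y"
    using Yh.btw_eq[OF assms(3)] unfolding dY_same[OF assms(1,2)] .
  then have t: "0 \<le> dY (pt x g) m" "dY (pt x g) m \<le> d x y"
    using Yh.nonneg[OF Yi(1) mY] Yh.nonneg[OF mY Yi(2)] by linarith+
  obtain z where z: "T.btw x z y" "d x z = dY (pt x g) m" "d z y = d x y - dY (pt x g) m"
    by (rule T.intermediate[OF i t])
  have s: "(z, g) \<in> S0" by (rule S0_convex[OF assms(1,2) z(1)])
  have "Yh.btw (pt x g) (pt z g) (pt y g)"
    unfolding Yh.btw_def using Y_I[OF s] z dY_same[OF assms(1) s] dY_same[OF s assms(2)] dY_same[OF assms(1,2)] by simp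
  moreover have "dY (pt x g) m = dY (pt x g) (pt z g)" using z(2) dY_same[OF assms(1) s] by simp
  ultimately have "m = pt z g" by (rule Yh.btw_unique[OF Yi assms(3)])
  then show ?thesis using that s z(1) by blast
qed

lemma link_list:
  assumes "C \<in> Y" "C' \<in> Y"
  obtains qs where "set qs \<subseteq> Y" "length qs \<ge> 2" "hd qs = C" "last qs = C'"
    "\<And>i. Suc i < length qs \<Longrightarrow> link (qs ! i) (qs ! Suc i)"
proof -
  have "\<exists>qs. qs \<noteq> [] \<and> set qs \<subseteq> Y \<and> hd qs = C \<and> last qs = C' \<and> successively link qs"
    using links_all[OF assms]
  proof (induction rule: rtranclp_induct)
    case base then show ?case using assms(1) by (intro exI[of _ "[C]"]) simp
  next
    case (step y z)
    then obtain qs where qs: "qs \<noteq> []" "set qs \<subseteq> Y" "hd qs = C" "last qs = y" "successively link qs" by blast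
    then have "successively link (qs @ [z])" using step(2) by (simp add: successively_append_iff)
    then show ?case using qs link_Y[OF step(2)] by (intro exI[of _ "qs @ [z]"]) simp
  qed
  then obtain qs where qs: "qs \<noteq> []" "set qs \<subseteq> Y" "hd qs = C" "last qs = C'" "successively link qs" by blast
  \<comment> \<open>The first point is repeated, so that the list has two entries even when C =
    C'.\<close>
  obtain x g where "(x, g) \<in> S0" "C = pt x g" using assms(1) by (elim Y_cases)
  then have "link C C" using link_I by blast
  then have "successively link (C # qs)" using qs by (cases qs) auto
  then have "link ((C # qs) ! i) ((C # qs) ! Suc i)" if "Suc i < length (C # qs)" for i
    using that unfolding successively_conv_nth by blast
  then show ?thesis using that[of "C # qs"] qs assms(1) by (cases qs) auto
qed

lemma tree_morphism_from_Y:
  assumes met: "is_metric X' d'" and f: "f ` Y \<subseteq> X'"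
    and iso: "\<And>x y g. (x, g) \<in> S0 \<Longrightarrow> (y, g) \<in> S0 \<Longrightarrow> d' (f (pt x g)) (f (pt y g)) = d x y"
  shows "tree_morphism Y dY X' d' f"
  unfolding tree_morphism_def
proof (intro conjI ballI)
  show "f ` Y \<subseteq> X'" by (rule f)
  fix C C' assume C: "C \<in> Y" "C' \<in> Y"
  obtain qs where qs: "set qs \<subseteq> Y" "length qs \<ge> 2" "hd qs = C" "last qs = C'"
    "\<And>i. Suc i < length qs \<Longrightarrow> link (qs ! i) (qs ! Suc i)" by (rule link_list[OF C]) blast
  have "isometric_on dY d' f (seg Y dY (qs ! i) (qs ! Suc i))" if ii: "Suc i < length qs" for i
  proof -
    obtain g x y where p: "(x, g) \<in> S0" "(y, g) \<in> S0" "qs ! i = pt x g" "qs ! Suc i = pt y g"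
      using qs(5)[OF ii] unfolding link_def by blast
    show ?thesis
      unfolding isometric_on_def p(3,4) Yt.seg_eq[OF Y_I[OF p(1)] Y_I[OF p(2)]]
    proof (intro ballI)
      fix u w assume "u \<in> {m. Yh.btw (pt x g) m (pt y g)}" "w \<in> {m. Yh.btw (pt x g) m (pt y g)}"
      then obtain a b where ab: "(a, g) \<in> S0" "u = pt a g" "(b, g) \<in> S0" "w = pt b g"
        using btw_link[OF p(1,2)] by (metis mem_Collect_eq)
      show "d' (f u) (f w) = dY u w" unfolding ab(2,4) iso[OF ab(1,3)] dY_same[OF ab(1,3)] ..
    qed
  qed
  from Yt.subdivision_of_chain[OF f met qs(1,2) this] show
    "\<exists>ps. ps \<noteq> [] \<and> hd ps = C \<and> last ps = C' \<and> set ps \<subseteq> seg Y dY C C' \<and>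
        seg Y dY C C' = (\<Union>i\<in>{i. Suc i < length ps}. seg Y dY (ps ! i) (ps ! Suc i)) \<and>
        (\<forall>i. Suc i < length ps \<longrightarrow> isometric_on dY d' f (seg Y dY (ps ! i) (ps ! Suc i)))"
    unfolding qs(3,4) .
qed

text \<open>Prepares strong convergence: absorbing the finitely many translates indexed by F absorbs
  the whole segment.\<close>

lemma seg_finite_cover:
  assumes "C \<in> Y" "C' \<in> Y"
  obtains F where "finite F" "F \<subseteq> carrier G"
    "\<And>m. m \<in> seg Y dY C C' \<Longrightarrow> \<exists>g\<in>F. \<exists>z. (z, g) \<in> S0 \<and> m = pt z g"
proof -
  obtain qs where qs: "set qs \<subseteq> Y" "length qs \<ge> 2" "hd qs = C" "last qs = C'"
    "\<And>i. Suc i < length qs \<Longrightarrow> link (qs ! i) (qs ! Suc i)" by (rule link_list[OF assms]) blast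
  have "\<exists>g. g \<in> carrier G \<and> (\<forall>m. Yh.btw (qs ! i) m (qs ! Suc i) \<longrightarrow> (\<exists>z. (z, g) \<in> S0 \<and> m = pt z g))"
    if ii: "Suc i < length qs" for i
  proof -
    obtain g x y where p: "(x, g) \<in> S0" "(y, g) \<in> S0" "qs ! i = pt x g" "qs ! Suc i = pt y g"
      using qs(5)[OF ii] unfolding link_def by blast
    have "\<exists>z. (z, g) \<in> S0 \<and> m = pt z g" if "Yh.btw (qs ! i) m (qs ! Suc i)" for m
      using btw_link[OF p(1,2), of m] that unfolding p(3,4) by metis
    then show ?thesis using S0_X(2)[OF p(1)] by blast
  qed
  then obtain \<gamma> where \<gamma>: "\<And>i. Suc i < length qs \<Longrightarrow> \<gamma> i \<in> carrier G"
    "\<And>i m. Suc i < length qs \<Longrightarrow> Yh.btw (qs ! i) m (qs ! Suc i) \<Longrightarrow> \<exists>z. (z, \<gamma> i) \<in> S0 \<and> m = pt z (\<gamma> i)"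
    by metis
  let ?F = "\<gamma> ` {i. Suc i < length qs}"
  have "finite {i. Suc i < length qs}" by (rule finite_subset[of _ "{..<length qs}"]) auto
  then have "finite ?F" by simp
  moreover have "?F \<subseteq> carrier G" using \<gamma>(1) by blast
  moreover have "\<exists>g\<in>?F. \<exists>z. (z, g) \<in> S0 \<and> m = pt z g" if m: "m \<in> seg Y dY C C'" for m
  proof -
    have "Yh.btw (hd qs) m (last qs)" using m unfolding Yt.seg_eq[OF assms] qs(3,4) by simp
    then obtain i where "Suc i < length qs" "Yh.btw (qs ! i) m (qs ! Suc i)"
      using Yt.seg_cover_list[OF qs(1,2)] by blast
    then show ?thesis using \<gamma>(2) by blast
  qed
  ultimately show ?thesis by (rule that)
qed

lemma proj_rep:
  assumes "(x, g) \<in> S0"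
  obtains h where "(SOME p. p \<in> pt x g) = (x, h)" "(x, h) \<in> S0" "pt x h = pt x g"
proof -
  define p where "p = (SOME p. p \<in> pt x g)"
  have "p \<in> pt x g" unfolding p_def by (rule someI, rule mem_pt, rule assms)
  then have p: "(fst p, snd p) \<in> S0" "D (emb (x, g)) (emb (fst p, snd p)) = 0" by (auto simp: pt_def)
  then have e: "pt x g = pt (fst p) (snd p)" using pt_eq_iff[OF assms p(1)] by blast
  then have x: "x = fst p" by (rule pt_fst[OF assms p(1)])
  have "p = (x, snd p)" using x by (simp add: prod_eq_iff)
  then show ?thesis using that[of "snd p"] p(1) e x unfolding p_def[symmetric] by simp
qed

lemma proj_pt: "(x, g) \<in> S0 \<Longrightarrow> proj (pt x g) = x"
  by (erule proj_rep) (simp add: proj_def)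

lemma proj_X: "C \<in> Y \<Longrightarrow> proj C \<in> X"
  by (elim Y_cases) (simp add: proj_pt S0_X)

lemma proj_act:
  assumes "C \<in> Y" "h \<in> carrier G"
  shows "proj (actY h C) = act h (proj C)"
proof -
  obtain x g where p: "(x, g) \<in> S0" "C = pt x g" using assms(1) by (elim Y_cases)
  show ?thesis unfolding p act_pt[OF p(1) assms(2)] proj_pt[OF p(1)] proj_pt[OF S0_act[OF p(1) assms(2)]] ..
qed

lemma proj_morphism: "tree_morphism Y dY X d proj"
  by (rule tree_morphism_from_Y[OF T.metric]) (auto simp: proj_pt proj_X)

lemma conj_carrier: "i < k \<Longrightarrow> g \<in> carrier G \<Longrightarrow> h \<in> conj_set G g (Gs ! i) \<Longrightarrow> h \<in> carrier G"
  unfolding conj_set_def using Gs_carrier by auto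

text \<open>A nondegenerate segment fixed by a peripheral subgroup would contain a nondegenerate subsegment
  on which the projection is injective.\<close>

lemma Y_GF_tree:
  assumes GF: "GF_tree G Gs X d act"
  shows "GF_tree G Gs Y dY actY"
  unfolding GF_tree_def
proof (intro conjI allI impI ballI)
  show "R_tree Y dY" by (rule Yt.R_tree)
  show "isometric_action G Y dY actY" by (rule Y_action)
  fix i g assume i: "i < length Gs" and g: "g \<in> carrier G"
  let ?A = "conj_set G g (Gs ! i)"
  obtain p where p: "p \<in> K" "fixes_point act (Gs ! i) p" using K_fix i by blast
  have pX: "p \<in> X" by (rule K_X[OF p(1)])
  have s: "(act g p, g) \<in> S0" using p(1) g by (simp add: S0_iff)
  have fixp: "actY a (pt (act g p) g) = pt (act g p) g" if a: "a \<in> ?A" for a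
  proof -
    obtain h where h: "h \<in> Gs ! i" "a = g \<otimes> h \<otimes> inv g" using a unfolding conj_set_def by blast
    have hc: "h \<in> carrier G" using Gs_carrier i h by blast
    have ac: "a \<in> carrier G" by (rule conj_carrier[OF i g a])
    have hp: "act h p = p" using p(2) h(1) unfolding fixes_point_def by blast
    have e: "a \<otimes> g = g \<otimes> h" using h(2) g hc by (simp add: m_assoc)
    have "act a (act g p) = act (a \<otimes> g) p" using act_mult[OF ac g pX] by simp
    also have "\<dots> = act g p" unfolding e act_mult[OF g hc pX] hp ..
    finally have e2: "act a (act g p) = act g p" .
    have s2: "(act g p, g \<otimes> h) \<in> S0" using S0_act[OF s ac] unfolding e e2 .
    show ?thesis unfolding act_pt[OF s ac] e e2 by (rule pt_peripheral[OF s i h(1) s2, symmetric])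
  qed
  show "\<exists>!x. x \<in> Y \<and> fixes_point actY ?A x"
  proof (rule ex1I)
    show "pt (act g p) g \<in> Y \<and> fixes_point actY ?A (pt (act g p) g)"
      using Y_I[OF s] fixp unfolding fixes_point_def by blast
    fix C assume C: "C \<in> Y \<and> fixes_point actY ?A C"
    let ?P = "pt (act g p) g"
    show "C = ?P"
    proof (rule ccontr)
      assume ne: "C \<noteq> ?P"
      have CY: "C \<in> Y" "?P \<in> Y" using C Y_I[OF s] by blast+
      have fixm: "actY a m = m" if a: "a \<in> ?A" and m: "Yh.btw C m ?P" for a m
      proof -
        have ac: "a \<in> carrier G" by (rule conj_carrier[OF i g a])
        have fC: "actY a C = C" "actY a ?P = ?P" using C a fixp unfolding fixes_point_def by blast+
        have mY: "m \<in> Y" by (rule Yh.btw_in[OF m])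
        have "Yh.btw C (actY a m) ?P" using Ya.act_btw[OF ac CY m] unfolding fC .
        moreover have "dY C m = dY C (actY a m)" using Ya.act_dist[OF ac CY(1) mY] unfolding fC by simp
        ultimately show ?thesis using Yh.btw_unique[OF CY m, of "actY a m"] by simp
      qed
      obtain ps where ps: "ps \<noteq> []" "hd ps = C" "last ps = ?P" "set ps \<subseteq> seg Y dY C ?P"
        "\<forall>i. Suc i < length ps \<longrightarrow> isometric_on dY d proj (seg Y dY (ps ! i) (ps ! Suc i))"
        using bspec[OF bspec[OF conjunct2[OF proj_morphism[unfolded tree_morphism_def]] CY(1)] CY(2)] by blast
      have "\<exists>i. Suc i < length ps \<and> ps ! i \<noteq> ps ! Suc i"
      proof (rule ccontr)
        assume "\<not> ?thesis"
        then have eq: "\<And>i. Suc i < length ps \<Longrightarrow> ps ! Suc i = ps ! i" by metis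
        have "j < length ps \<Longrightarrow> ps ! j = ps ! 0" for j
          by (induction j) (use eq Suc_lessD in \<open>auto simp del: nth.simps\<close>)
        from this[of "length ps - 1"] have "last ps = hd ps" using ps(1) by (simp add: last_conv_nth hd_conv_nth)
        then show False using ps ne by simp
      qed
      then obtain i' where i': "Suc i' < length ps" "ps ! i' \<noteq> ps ! Suc i'" by blast
      let ?u = "ps ! i'" and ?w = "ps ! Suc i'"
      have "?u \<in> set ps" "?w \<in> set ps" using i'(1) by (simp_all only: nth_mem Suc_lessD)
      then have "?u \<in> seg Y dY C ?P" "?w \<in> seg Y dY C ?P" using ps(4) by blast+
      then have b: "Yh.btw C ?u ?P" "Yh.btw C ?w ?P" unfolding Yt.seg_eq[OF CY] by simp_all
      have uw: "?u \<in> Y" "?w \<in> Y" using Yh.btw_in b by blast+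
      have "?u \<in> seg Y dY ?u ?w" "?w \<in> seg Y dY ?u ?w"
        unfolding Yt.seg_eq[OF uw] using Yh.btw_left Yh.btw_right uw by blast+
      then have dd: "d (proj ?u) (proj ?w) = dY ?u ?w" using ps(5) i'(1) unfolding isometric_on_def by blast
      have fx: "proj m \<in> X \<and> fixes_point act ?A (proj m)" if m: "Yh.btw C m ?P" for m
      proof -
        have mY: "m \<in> Y" by (rule Yh.btw_in[OF m])
        have "act a (proj m) = proj m" if a: "a \<in> ?A" for a
          using proj_act[OF mY conj_carrier[OF i g a]] unfolding fixm[OF a m] by simp
        then show ?thesis using proj_X[OF mY] unfolding fixes_point_def by blast
      qed
      have "\<exists>!x. x \<in> X \<and> fixes_point act ?A x" using GF i g unfolding GF_tree_def by blast
      then have "proj ?u = proj ?w" using fx[OF b(1)] fx[OF b(2)] by blast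
      then have "dY ?u ?w = 0" using dd T.refl0[OF proj_X[OF uw(1)]] by simp
      then show False using i'(2) Yh.zero[OF uw] by blast
    qed
  qed
qed

text \<open>An invariant subtree through the point over x0 contains, by \<open>eqW\<close>, the
  points over w x0 with second coordinate 1. These span the copy of K, whose translates fill T_K.
  The hypothesis \<open>base\<close> leaves room for the axis argument.\<close>

lemma Y_minimal:
  assumes W: "W \<subseteq> carrier G" "K = T.tree_hull ((\<lambda>w. act w x0) ` W)" and x0: "x0 \<in> K"
    and eqW: "\<And>w. w \<in> W \<Longrightarrow> pt (act w x0) w = pt (act w x0) \<one>"
    and base: "\<And>Z. subtree Y dY Z \<Longrightarrow> (\<And>g. g \<in> carrier G \<Longrightarrow> actY g ` Z \<subseteq> Z) \<Longrightarrow> pt x0 \<one> \<in> Z"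
  shows "minimal_tree G Y dY actY"
  unfolding minimal_tree_def
proof (intro allI impI)
  fix Z assume Z: "subtree Y dY Z \<and> (\<forall>g\<in>carrier G. actY g ` Z \<subseteq> Z)"
  then have inv: "actY g C \<in> Z" if "g \<in> carrier G" "C \<in> Z" for g C using that by blast
  have ZY: "Z \<subseteq> Y" using Z unfolding subtree_def by blast
  have x0Z: "pt x0 \<one> \<in> Z" using base Z by blast
  have s0: "(x0, \<one>) \<in> S0" using x0 K_S0 by blast
  have wX: "(\<lambda>w. act w x0) ` W \<subseteq> X" using act_X K_X[OF x0] W by blast
  have W': "(act w x0, \<one>) \<in> S0 \<and> pt (act w x0) \<one> \<in> Z" if w: "w \<in> W" for w
  proof -
    have wc: "w \<in> carrier G" using w W by blast
    have "act w x0 \<in> K" using T.tree_hull_superset[OF wX] w unfolding W(2) by blast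
    moreover have "pt (act w x0) w \<in> Z"
      using inv[OF wc x0Z] unfolding act_pt[OF s0 wc] using wc by simp
    ultimately show ?thesis using eqW[OF w] K_S0 by simp
  qed
  have K': "pt z \<one> \<in> Z" if z: "(z, \<one>) \<in> S0" for z
  proof -
    have "z \<in> K" using z K_S0 by blast
    then obtain a b where ab: "a \<in> W" "b \<in> W" "T.btw (act a x0) z (act b x0)"
      unfolding W(2) using T.tree_hull_iff[OF wX, of z] by blast
    note a = W'[OF ab(1)] and b = W'[OF ab(2)]
    have "Yh.btw (pt (act a x0) \<one>) (pt z \<one>) (pt (act b x0) \<one>)"
      unfolding Yh.btw_def using dY_same a b z T.btw_eq[OF ab(3)] Y_I[OF z] by simp
    then have "pt z \<one> \<in> seg Y dY (pt (act a x0) \<one>) (pt (act b x0) \<one>)"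
      using Yt.seg_eq a b ZY by blast
    then show ?thesis using Z a b unfolding subtree_def by blast
  qed
  show "Z = Y"
  proof
    show "Y \<subseteq> Z"
    proof
      fix C assume "C \<in> Y"
      then obtain x g where p: "(x, g) \<in> S0" "C = pt x g" by (elim Y_cases)
      have g: "g \<in> carrier G" by (rule S0_X(2)[OF p(1)])
      have s: "(act (inv g) x, \<one>) \<in> S0" using S0_act[OF p(1) inv_closed[OF g]] g by simp
      have "actY g (pt (act (inv g) x) \<one>) = C"
        unfolding act_pt[OF s g] p using act_inv_cancel(2)[OF g S0_X(1)[OF p(1)]] g by simp
      then show "C \<in> Z" using inv[OF g K'[OF s]] by simp
    qed
  qed (rule ZY)
qed

lemma elliptic_stabilizer:
  assumes "(x, \<one>) \<in> S0"
  shows "subgroup {h \<in> carrier G. actY h (pt x \<one>) = pt x \<one>} G"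
proof -
  let ?p = "pt x \<one>"
  have p: "?p \<in> Y" by (rule Y_I[OF assms])
  show ?thesis
  proof
    show "{h \<in> carrier G. actY h ?p = ?p} \<subseteq> carrier G" by blast
    show "\<one> \<in> {h \<in> carrier G. actY h ?p = ?p}" using Ya.act_one[OF p] by simp
  next
    fix a b assume "a \<in> {h \<in> carrier G. actY h ?p = ?p}" "b \<in> {h \<in> carrier G. actY h ?p = ?p}"
    then show "a \<otimes> b \<in> {h \<in> carrier G. actY h ?p = ?p}" using Ya.act_mult[OF _ _ p] by simp
  next
    fix a assume "a \<in> {h \<in> carrier G. actY h ?p = ?p}"
    then have a: "a \<in> carrier G" "actY a ?p = ?p" by blast+
    have "actY (inv a) ?p = ?p" using Ya.act_inv_cancel(1)[OF a(1) p] unfolding a(2) .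
    then show "inv a \<in> {h \<in> carrier G. actY h ?p = ?p}" using a by simp
  qed
qed

end

section \<open>Elliptic and hyperbolic elements\<close>

context tree_action begin

lemma fix_segment:
  assumes g: "g \<in> carrier G" and xy: "x \<in> X" "y \<in> X" "act g x = x" "act g y = y" and m: "T.btw x m y"
  shows "act g m = m"
proof -
  have "T.btw x (act g m) y" using act_btw[OF g xy(1,2) m] unfolding xy(3,4) .
  moreover have "d x m = d x (act g m)" using act_dist[OF g xy(1) T.btw_in[OF m]] unfolding xy(3) by simp
  ultimately show ?thesis using T.btw_unique[OF xy(1,2) m, of "act g m"] by simp
qed

text \<open>This says that g is hyperbolic with x on its axis. Only x, gx and g^2 x occur, so the
  condition transfers to T_K as soon as these three points lie in the copy of K.\<close>

definition on_axis :: "'g \<Rightarrow> 'p \<Rightarrow> bool" where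
  "on_axis g x \<longleftrightarrow> d x (act g (act g x)) = 2 * d x (act g x) \<and> 0 < d x (act g x)"

text \<open>The midpoint m of [x,gx] works. The geodesics from gx back to x and on to g^2 x share an
  initial piece of length s, ending in c. Without a fixed point s < L/2, and then m, c, gm, gc, g^2
  m lie in this order on a geodesic.\<close>

lemma elliptic_or_axis:
  assumes g: "g \<in> carrier G" and nofix: "\<And>x. x \<in> X \<Longrightarrow> act g x \<noteq> x"
  shows "\<exists>m\<in>X. on_axis g m"
proof -
  obtain x where x: "x \<in> X" using T.nonempty by blast
  let ?x1 = "act g x" let ?x2 = "act g ?x1"
  have x12: "?x1 \<in> X" "?x2 \<in> X" using act_X g x by auto
  define L where "L = d x ?x1"
  have L12: "d ?x1 ?x2 = L" unfolding L_def by (rule act_dist[OF g x x12(1)])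
  have L0: "0 \<le> L" unfolding L_def by (rule T.nonneg[OF x x12(1)])
  obtain m where m: "T.btw x m ?x1" "d x m = L / 2" "d m ?x1 = L / 2"
    using T.intermediate[OF x x12(1), of "L / 2"] L0 unfolding L_def by (auto simp: field_simps)
  have mX: "m \<in> X" by (rule T.btw_in[OF m(1)])
  let ?gm = "act g m"
  have gmX: "?gm \<in> X" by (rule act_X[OF g mX])
  have gm: "T.btw ?x1 ?gm ?x2" "d ?x1 ?gm = L / 2" "d ?gm ?x2 = L / 2"
    using act_btw[OF g x x12(1) m(1)] act_dist[OF g x mX] act_dist[OF g mX x12(1)] m by simp_all
  have ne: "?gm \<noteq> m" by (rule nofix[OF mX])
  obtain c where c: "T.btw x c ?x1" "T.btw ?x1 c ?x2" "T.btw x c ?x2" using T.median[OF x x12] by blast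
  have cX: "c \<in> X" by (rule T.btw_in[OF c(1)])
  define s where "s = d ?x1 c"
  have c1: "T.btw ?x1 c x" and m1: "T.btw ?x1 m x" using c m T.btw_sym x x12 by blast+
  have dm1: "d ?x1 m = L / 2" using m(3) T.sym[OF mX x12(1)] by simp
  have dmc: "d m c = \<bar>L / 2 - s\<bar>" using T.btw_dist[OF x12(1) x m1 c1] dm1 by (simp add: s_def)
  \<comment> \<open>Otherwise the shared piece has length at least L/2, and m and gm both are its
    point at distance L/2 from gx.\<close>
  have "s < L / 2"
  proof (rule ccontr)
    assume "\<not> s < L / 2"
    then have "T.btw ?x1 m c" using dmc dm1 mX by (simp add: T.btw_def s_def)
    then have "T.btw ?x1 m ?x2" by (rule T.btw_inner(1)[OF x12 c(2)])
    then have "m = ?gm" using T.btw_unique[OF x12 _ gm(1)] dm1 gm(2) by simp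
    then show False using ne by simp
  qed
  have cgm: "d c ?gm = L / 2 - s" using T.btw_dist[OF x12 c(2) gm(1)] gm(2) \<open>s < L / 2\<close> by (simp add: s_def)
  let ?gc = "act g c"
  have gcX: "?gc \<in> X" by (rule act_X[OF g cX])
  have gc: "T.btw ?x1 ?gc ?x2" by (rule act_btw[OF g x x12(1) c(1)])
  have "d ?gc ?x2 = s" using act_dist[OF g cX x12(1)] T.sym[OF cX x12(1)] by (simp add: s_def)
  then have d1gc: "d ?x1 ?gc = L - s" using T.btw_eq[OF gc] L12 by simp
  have cgc: "d c ?gc = L - 2 * s" using T.btw_dist[OF x12 c(2) gc] d1gc \<open>s < L / 2\<close> by (simp add: s_def)
  have gmgc: "d ?gm ?gc = L / 2 - s" using T.btw_dist[OF x12 gm(1) gc] d1gc gm(2) \<open>s < L / 2\<close> by simp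
  have A: "T.btw c ?gm ?gc" using cgm cgc gmgc gmX by (simp add: T.btw_def)
  have ne2: "c \<noteq> ?gm" "?gm \<noteq> ?gc"
    using cgm gmgc \<open>s < L / 2\<close> T.refl0[OF gmX] by auto
  have B: "T.btw m c ?gm"
  proof -
    have "d x c = L - s" using T.btw_eq[OF c(1)] T.sym[OF cX x12(1)] by (simp add: s_def L_def)
    then have "T.btw x m c" using dmc m(2) mX \<open>s < L / 2\<close> by (simp add: T.btw_def)
    then have "T.btw m c ?x2" by (rule T.btw_inner(2)[OF x x12(2) c(3)])
    then have 1: "T.btw ?x2 c m" using T.btw_sym x12 mX by blast
    have "T.btw ?x1 c ?gm" using cgm gm(2) cX by (simp add: T.btw_def s_def)
    then have "T.btw c ?gm ?x2" by (rule T.btw_inner(2)[OF x12 gm(1)])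
    then have 2: "T.btw ?x2 ?gm c" using T.btw_sym x12 cX by blast
    have "T.btw ?gm c m" by (rule T.btw_inner(2)[OF x12(2) mX 1 2])
    then show ?thesis using T.btw_sym gmX mX by blast
  qed
  have C: "T.btw m ?gm ?gc" by (rule T.btw_local_to_global(3)[OF mX gcX cX B A ne2(1)])
  have B': "T.btw ?gm ?gc (act g ?gm)" by (rule act_btw[OF g mX gmX B])
  have "T.btw m ?gm (act g ?gm)"
    by (rule T.btw_local_to_global(2)[OF mX act_X[OF g gmX] gmX C B' ne2(2)])
  then have "d m (act g ?gm) = 2 * d m ?gm" using T.btw_eq act_dist[OF g mX gmX] by fastforce
  moreover have "0 < d m ?gm" using T.nonneg[OF mX gmX] T.zero[OF mX gmX] ne by force
  ultimately show ?thesis using mX unfolding on_axis_def by blast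
qed

text \<open>If \<open>a\<close> and \<open>b\<close> fix \<open>p\<close> and \<open>q\<close> and \<open>ab\<close> fixes \<open>z\<close>, then \<open>z\<close> and \<open>bz\<close> are equidistant from \<open>p\<close> and
  from \<open>q\<close>, so the midpoint of \<open>[z,bz]\<close> is fixed by both \<open>a\<close> and \<open>b\<close>.\<close>

lemma elliptic_product:
  assumes a: "a \<in> carrier G" and b: "b \<in> carrier G" and X: "p \<in> X" "q \<in> X" "z \<in> X"
    and fx: "act a p = p" "act b q = q" "act (a \<otimes> b) z = z" and m: "T.btw p m q"
  shows "act a m = m \<or> act b m = m"
proof -
  let ?w = "act b z"
  have w: "?w \<in> X" by (rule act_X[OF b X(3)])
  have aw: "act a ?w = z" using fx(3) act_mult[OF a b X(3)] by simp
  obtain c where c: "T.btw p c z" "T.btw z c ?w" "T.btw p c ?w" using T.median[OF X(1,3) w] by blast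
  obtain e where e: "T.btw q e z" "T.btw z e ?w" "T.btw q e ?w" using T.median[OF X(2,3) w] by blast
  have i: "c \<in> X" "e \<in> X" using T.btw_in c e by blast+
  have "d p z = d p ?w" using act_dist[OF a X(1) w] unfolding fx(1) aw .
  then have "d c z = d c ?w" using T.btw_eq[OF c(1)] T.btw_eq[OF c(3)] by simp
  then have mc: "d z c = d z ?w / 2" using T.btw_eq[OF c(2)] T.sym[OF i(1) X(3)] by simp
  have "d q ?w = d q z" using act_dist[OF b X(2,3)] unfolding fx(2) .
  then have "d e z = d e ?w" using T.btw_eq[OF e(1)] T.btw_eq[OF e(3)] by simp
  then have me: "d z e = d z ?w / 2" using T.btw_eq[OF e(2)] T.sym[OF i(2) X(3)] by simp
  have ce: "c = e" by (rule T.btw_unique[OF X(3) w c(2) e(2)]) (simp add: mc me)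
  have "T.btw p (act a c) z" using act_btw[OF a X(1) w c(3)] unfolding fx(1) aw .
  moreover have "d p c = d p (act a c)" using act_dist[OF a X(1) i(1)] unfolding fx(1) by simp
  ultimately have ac: "act a c = c" using T.btw_unique[OF X(1,3) c(1), of "act a c"] by simp
  have "T.btw q (act b e) ?w" using act_btw[OF b X(2,3) e(1)] unfolding fx(2) .
  moreover have "d q e = d q (act b e)" using act_dist[OF b X(2) i(2)] unfolding fx(2) by simp
  ultimately have be: "act b c = c" using T.btw_unique[OF X(2) w e(3), of "act b e"] ce by simp
  consider "T.btw p m c" | "T.btw c m q" using T.btw_cover[OF X(1,2) i(1) m] by blast
  then show ?thesis
    using fix_segment[OF a X(1) i(1) fx(1) ac] fix_segment[OF b i(1) X(2) be fx(2)] by cases blast+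
qed

text \<open>By \<open>elliptic_product\<close> each point of [p,q] is fixed by all of A or by all of
  B. Both fixed sets are closed and [p,q] is connected.\<close>

lemma common_fixed_point:
  assumes A: "A \<subseteq> carrier G" and B: "B \<subseteq> carrier G"
    and p: "p \<in> X" "fixes_point act A p" and q: "q \<in> X" "fixes_point act B q"
    and ell: "\<And>a b. a \<in> A \<Longrightarrow> b \<in> B \<Longrightarrow> \<exists>z\<in>X. act (a \<otimes> b) z = z"
  shows "\<exists>c\<in>X. fixes_point act A c \<and> fixes_point act B c"
proof -
  have alt: "fixes_point act A m \<or> fixes_point act B m" if m: "T.btw p m q" for m
  proof (rule ccontr)
    assume "\<not> ?thesis"
    then obtain a b where ab: "a \<in> A" "act a m \<noteq> m" "b \<in> B" "act b m \<noteq> m" unfolding fixes_point_def by blast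
    obtain z where z: "z \<in> X" "act (a \<otimes> b) z = z" using ell ab by blast
    have "a \<in> carrier G" "b \<in> carrier G" "act a p = p" "act b q = q"
      using ab A B p q unfolding fixes_point_def by blast+
    then show False using elliptic_product[OF _ _ p(1) q(1) z(1) _ _ z(2) m] ab by blast
  qed
  let ?L = "d p q"
  have L0: "0 \<le> ?L" by (rule T.nonneg[OF p(1) q(1)])
  have "\<exists>m. T.btw p m q \<and> d p m = t" if "0 \<le> t" "t \<le> ?L" for t
    using T.intermediate[OF p(1) q(1) that] by blast
  then obtain \<gamma> where \<gamma>: "\<And>t. 0 \<le> t \<Longrightarrow> t \<le> ?L \<Longrightarrow> T.btw p (\<gamma> t) q"
    "\<And>t. 0 \<le> t \<Longrightarrow> t \<le> ?L \<Longrightarrow> d p (\<gamma> t) = t" by metis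
  have \<gamma>X: "\<gamma> t \<in> X" if "0 \<le> t" "t \<le> ?L" for t by (rule T.btw_in[OF \<gamma>(1)[OF that]])
  have \<gamma>d: "d (\<gamma> s) (\<gamma> t) = \<bar>s - t\<bar>" if "0 \<le> t" "t \<le> ?L" "0 \<le> s" "s \<le> ?L" for s t
    using T.btw_dist[OF p(1) q(1) \<gamma>(1)[OF that(3,4)] \<gamma>(1)[OF that(1,2)]] \<gamma>(2) that by simp
  have lim: "act h (\<gamma> t) = \<gamma> t"
    if h: "h \<in> carrier G" and t: "0 \<le> t" "t \<le> ?L"
      and near: "\<And>e. 0 < e \<Longrightarrow> \<exists>s. 0 \<le> s \<and> s \<le> ?L \<and> \<bar>s - t\<bar> < e \<and> act h (\<gamma> s) = \<gamma> s" for h t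
  proof -
    note hX = act_X[OF h \<gamma>X[OF t]]
    have "d (act h (\<gamma> t)) (\<gamma> t) \<le> 0 + e" if "0 < e" for e
    proof -
      obtain s where s: "0 \<le> s" "s \<le> ?L" "\<bar>s - t\<bar> < e / 2" "act h (\<gamma> s) = \<gamma> s" using near[of "e/2"] \<open>0 < e\<close> by auto
      have "d (act h (\<gamma> t)) (\<gamma> s) = d (\<gamma> t) (\<gamma> s)" using act_dist[OF h \<gamma>X[OF t] \<gamma>X[OF s(1,2)]] unfolding s(4) .
      then show ?thesis
        using T.tri[OF hX \<gamma>X[OF s(1,2)] \<gamma>X[OF t]] \<gamma>d[OF s(1,2) t] \<gamma>d[OF t s(1,2)] s(3) by linarith
    qed
    then have "d (act h (\<gamma> t)) (\<gamma> t) \<le> 0" by (rule field_le_epsilon)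
    then show ?thesis using T.nonneg[OF hX \<gamma>X[OF t]] T.zero[OF hX \<gamma>X[OF t]] by simp
  qed
  define S where "S = {t. 0 \<le> t \<and> t \<le> ?L \<and> fixes_point act A (\<gamma> t)}"
  have "d p (\<gamma> 0) = 0" using \<gamma>(2) L0 by simp
  then have "\<gamma> 0 = p" using T.zero[OF p(1) \<gamma>X] L0 by simp
  then have S0: "0 \<in> S" using p(2) L0 by (simp add: S_def)
  have bdd: "bdd_above S" by (rule bdd_aboveI[of _ ?L]) (simp add: S_def)
  \<comment> \<open>The last parameter at which A fixes the point. Beyond it the points are fixed by
    B, which passes to the limit; if there is nothing beyond, the point is q.\<close>
  define t where "t = Sup S"
  have t: "0 \<le> t" unfolding t_def by (rule cSup_upper[OF S0 bdd])
  have t2: "t \<le> ?L" unfolding t_def by (rule cSup_least) (use S0 in \<open>auto simp: S_def\<close>)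
  note t = t t2
  have "act a (\<gamma> t) = \<gamma> t" if a: "a \<in> A" for a
  proof (rule lim[OF _ t])
    show "a \<in> carrier G" using a A by blast
    fix e :: real assume "0 < e"
    then obtain s where s: "s \<in> S" "t - e < s" using less_cSup_iff[OF _ bdd, of "t - e"] S0 unfolding t_def by auto
    moreover have "s \<le> t" unfolding t_def by (rule cSup_upper[OF s(1) bdd])
    ultimately show "\<exists>s. 0 \<le> s \<and> s \<le> ?L \<and> \<bar>s - t\<bar> < e \<and> act a (\<gamma> s) = \<gamma> s"
      using a unfolding S_def fixes_point_def by (intro exI[of _ s]) auto
  qed
  then have fA: "fixes_point act A (\<gamma> t)" unfolding fixes_point_def by blast
  have "act b (\<gamma> t) = \<gamma> t" if b: "b \<in> B" for b
  proof (cases "t = ?L")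
    case True
    have "d p (\<gamma> t) = ?L" using \<gamma>(2)[OF t] True by simp
    then have "d (\<gamma> t) q = 0" using T.btw_eq[OF \<gamma>(1)[OF t]] by simp
    then have "\<gamma> t = q" using T.zero[OF \<gamma>X[OF t] q(1)] by simp
    then show ?thesis using q(2) b unfolding fixes_point_def by simp
  next
    case False
    show ?thesis
    proof (rule lim[OF _ t])
      show "b \<in> carrier G" using b B by blast
      fix e :: real assume e: "0 < e"
      define s where "s = min ?L (t + e / 2)"
      have s: "0 \<le> s" "s \<le> ?L" "t < s" "\<bar>s - t\<bar> < e" using t False e by (auto simp: s_def)
      have "s \<notin> S"
      proof
        assume "s \<in> S"
        then have "s \<le> t" unfolding t_def by (rule cSup_upper[OF _ bdd])
        then show False using s(3) by simp
      qed
      then have "\<not> fixes_point act A (\<gamma> s)" using s unfolding S_def by blast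
      then have "fixes_point act B (\<gamma> s)" using alt[OF \<gamma>(1)[OF s(1,2)]] by blast
      then show "\<exists>s. 0 \<le> s \<and> s \<le> ?L \<and> \<bar>s - t\<bar> < e \<and> act b (\<gamma> s) = \<gamma> s"
        using s b unfolding fixes_point_def by blast
    qed
  qed
  then have "fixes_point act B (\<gamma> t)" unfolding fixes_point_def by blast
  then show ?thesis using fA \<gamma>X[OF t] by blast
qed

text \<open>Serre's argument: the pieces G_1, ..., G_k, {b_1}, ..., {b_N} generate G and each has a
  fixed point. They are added one at a time with \<open>common_fixed_point\<close>, the products
  being elliptic by hypothesis.\<close>

lemma global_fixed_point:
  assumes per: "\<And>i. i < k \<Longrightarrow> \<exists>x\<in>X. fixes_point act (Gs ! i) x"
    and ell: "\<And>g. g \<in> carrier G \<Longrightarrow> \<exists>x\<in>X. act g x = x"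
  shows "\<exists>c\<in>X. \<forall>g\<in>carrier G. act g c = c"
proof -
  let ?Ls = "Gs @ map (\<lambda>b. {b}) bs"
  have Lc: "?Ls ! i \<subseteq> carrier G \<and> (\<exists>x\<in>X. fixes_point act (?Ls ! i) x)" if i: "i < length ?Ls" for i
  proof (cases "i < k")
    case True then show ?thesis using per Gs_carrier by (auto simp: nth_append)
  next
    case False
    then have j: "i - k < length bs" "?Ls ! i = {bs ! (i - k)}" using i by (auto simp: nth_append)
    then show ?thesis using ell[OF bs_carrier[OF j(1)]] bs_carrier[OF j(1)] unfolding fixes_point_def by auto
  qed
  have "\<exists>c\<in>X. \<forall>i<n. fixes_point act (?Ls ! i) c" if "n \<le> length ?Ls" for n
    using that
  proof (induction n)
    case 0 then show ?case using T.nonempty by auto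
  next
    case (Suc n)
    then obtain p where p: "p \<in> X" "\<forall>i<n. fixes_point act (?Ls ! i) p" by auto
    obtain q where q: "q \<in> X" "fixes_point act (?Ls ! n) q" using Lc[of n] Suc.prems by auto
    let ?A = "\<Union>i<n. ?Ls ! i"
    have A: "?A \<subseteq> carrier G"
    proof (rule UN_least)
      fix i assume "i \<in> {..<n}"
      then show "?Ls ! i \<subseteq> carrier G" using Lc[of i] Suc.prems by simp
    qed
    have B: "?Ls ! n \<subseteq> carrier G" using Lc[of n] Suc.prems by simp
    have fp: "fixes_point act ?A p" using p(2) unfolding fixes_point_def by blast
    have "\<exists>z\<in>X. act (a \<otimes> b) z = z" if "a \<in> ?A" "b \<in> ?Ls ! n" for a b
    proof -
      have "a \<in> carrier G" "b \<in> carrier G" using that A B by blast+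
      then show ?thesis using ell by simp
    qed
    then obtain c where c: "c \<in> X" "fixes_point act ?A c" "fixes_point act (?Ls ! n) c"
      using common_fixed_point[OF A B p(1) fp q] by blast
    have "fixes_point act (?Ls ! i) c" if "i < Suc n" for i
      using c that unfolding fixes_point_def by (cases "i = n") auto
    then show ?case using c(1) by blast
  qed
  from this[of "length ?Ls"] obtain c where c: "c \<in> X" "\<forall>i<length ?Ls. fixes_point act (?Ls ! i) c" by auto
  have fG: "act h c = c" if "i < k" "h \<in> Gs ! i" for i h
    using c(2)[rule_format, of i] that unfolding fixes_point_def by (simp add: nth_append)
  have fb: "act (bs ! j) c = c" if "j < length bs" for j
    using c(2)[rule_format, of "k + j"] that unfolding fixes_point_def by (simp add: nth_append)
  have "act g c = c" if "g \<in> carrier G" for g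
    using that
  proof (induction rule: free_product_induct)
    case one show ?case by (rule act_one[OF c(1)])
  next
    case (peripheral g i h)
    show ?case using act_mult[OF Gs_carrier[OF peripheral.hyps(2,3)] peripheral.hyps(1) c(1)]
      peripheral.IH fG[OF peripheral.hyps(2,3)] by simp
  next
    case (basis g j)
    show ?case using act_mult[OF bs_carrier[OF basis.hyps(2)] basis.hyps(1) c(1)] basis.IH fb[OF basis.hyps(2)] by simp
  next
    case (basis_inv g j)
    note b = bs_carrier[OF basis_inv.hyps(2)]
    have "act (inv (bs ! j)) c = c" using act_inv_cancel(1)[OF b c(1)] unfolding fb[OF basis_inv.hyps(2)] .
    then show ?case using act_mult[OF inv_closed[OF b] basis_inv.hyps(1) c(1)] basis_inv.IH by simp
  qed
  then show ?thesis using c(1) by blast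
qed

text \<open>Consecutive triples of orbit points are geodesic with nondegenerate overlap, so
  \<open>btw_local_to_global\<close> prolongs the geodesic from x step by step.\<close>

lemma axis_power:
  assumes g: "g \<in> carrier G" and x: "x \<in> X"
    and axis: "on_axis g x"
  shows "d x (act (g [^] n) x) = real n * d x (act g x)"
proof -
  note ax = axis[unfolded on_axis_def, THEN conjunct1] axis[unfolded on_axis_def, THEN conjunct2]
  let ?x = "\<lambda>n::nat. act (g [^] n) x" let ?l = "d x (act g x)"
  have xX: "?x n \<in> X" for n using act_X g x by simp
  have suc: "?x (Suc n) = act (g [^] n) (act g x)" for n
    using act_mult[of "g [^] n" g x] g x by simp
  have suc2: "?x (Suc (Suc n)) = act (g [^] n) (act g (act g x))" for n
  proof -
    have "g [^] Suc (Suc n) = g [^] n \<otimes> (g \<otimes> g)" using g by (simp add: m_assoc)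
    then show ?thesis using act_mult[of "g [^] n" "g \<otimes> g" x] act_mult[OF g g x] g x by simp
  qed
  have d1: "d (?x n) (?x (Suc n)) = ?l" for n
    unfolding suc using act_dist[of "g [^] n"] g x act_X by simp
  have d2: "d (?x n) (?x (Suc (Suc n))) = 2 * ?l" for n
    unfolding suc2 using act_dist[of "g [^] n"] g x act_X ax(1) by simp
  have "d x (?x (Suc n)) = real (Suc n) * ?l \<and> T.btw x (?x n) (?x (Suc n))" for n
  proof (induction n)
    case 0 then show ?case using g x act_one T.btw_left[OF x] by simp
  next
    case (Suc n)
    have b: "T.btw (?x n) (?x (Suc n)) (?x (Suc (Suc n)))"
      unfolding T.btw_def using d1[of n] d1[of "Suc n"] d2[of n] xX[of "Suc n"] by simp
    have ne: "?x n \<noteq> ?x (Suc n)"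
    proof
      assume e: "?x n = ?x (Suc n)"
      have "d (?x n) (?x n) = ?l" using d1[of n] unfolding e[symmetric] .
      then show False using T.refl0[OF xX] ax(2) by simp
    qed
    have "T.btw x (?x (Suc n)) (?x (Suc (Suc n)))"
      by (rule T.btw_local_to_global(3)[OF x xX xX _ b ne]) (use Suc.IH in blast)
    moreover from T.btw_eq[OF this] have "d x (?x (Suc (Suc n))) = real (Suc (Suc n)) * ?l"
      using d1[of "Suc n"] Suc.IH by (simp add: algebra_simps)
    ultimately show ?case by blast
  qed
  then show ?thesis using g x act_one T.refl0[OF x] by (cases n) auto
qed

text \<open>For large n the translates of a point y of Z by g^n and g^-n are closer to the
  translates of x than those are to x. Replacing both ends with \<open>btw_replace_end\<close> keeps
  x on the segment, which lies in Z.\<close>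

lemma axis_in_subtree:
  assumes g: "g \<in> carrier G" and x: "x \<in> X"
    and ax: "on_axis g x"
    and Z: "subtree X d Z" and inv: "\<And>h. h \<in> carrier G \<Longrightarrow> act h ` Z \<subseteq> Z"
  shows "x \<in> Z"
proof -
  obtain y where y: "y \<in> Z" "y \<in> X" using Z unfolding subtree_def by blast
  obtain n :: nat where n: "d x y < real n * d x (act g x)" using reals_Archimedean3[OF ax[unfolded on_axis_def, THEN conjunct2]] by blast
  let ?h = "g [^] n"
  have h: "?h \<in> carrier G" "inv ?h \<in> carrier G" using g by auto
  let ?a = "act (inv ?h) x" and ?b = "act ?h x"
  have ab: "?a \<in> X" "?b \<in> X" using act_X h x by auto
  have "d ?a x = d (act ?h ?a) (act ?h x)" using act_dist[OF h(1) ab(1) x] by simp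
  also have "\<dots> = d x ?b" using act_inv_cancel(2)[OF h(1) x] by simp
  finally have ax1: "d ?a x = d x ?b" .
  have "d ?a ?b = d (act ?h ?a) (act ?h ?b)" using act_dist[OF h(1) ab] by simp
  also have "\<dots> = d x (act (?h \<otimes> ?h) x)" using act_inv_cancel(2)[OF h(1) x] act_mult[OF h(1) h(1) x] by simp
  also have "\<dots> = 2 * d x ?b"
    using axis_power[OF g x ax, of "n + n"] axis_power[OF g x ax, of n] g by (simp add: nat_pow_mult)
  finally have "T.btw ?a x ?b" using ax1 x by (simp add: T.btw_def)
  moreover have dn: "d x y < d x ?b" using n axis_power[OF g x ax, of n] by simp
  have "d ?a (act (inv ?h) y) = d x y" "d ?b (act ?h y) = d x y" using act_dist[OF h(2) x y(2)] act_dist[OF h(1) x y(2)] .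
  moreover have yX: "act (inv ?h) y \<in> X" "act ?h y \<in> X" using act_X h y by auto
  ultimately have "T.btw (act (inv ?h) y) x ?b"
    using T.btw_replace_end[OF ab yX(1)] dn ax1 by simp
  then have "T.btw ?b x (act (inv ?h) y)" using T.btw_sym[OF ab(2) yX(1)] by blast
  moreover have "d ?b (act ?h y) < d ?b x" using \<open>d ?b (act ?h y) = d x y\<close> dn T.sym[OF ab(2) x] by simp
  ultimately have "T.btw (act ?h y) x (act (inv ?h) y)" using T.btw_replace_end[OF ab(2) yX(1) yX(2)] by blast
  then have "x \<in> seg X d (act ?h y) (act (inv ?h) y)" using T.seg_eq[OF yX(2,1)] by blast
  moreover have "act ?h y \<in> Z" "act (inv ?h) y \<in> Z" using inv h y(1) by blast+
  ultimately show ?thesis using Z unfolding subtree_def by blast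
qed

end

section \<open>Identifications in T_K and enlargement of K\<close>

context geometric_data begin

lemma pt_delta: "(x, g) \<in> S0 \<Longrightarrow> pt x g = {q \<in> S0. delta G Gs bs d act K (x, g) q = 0}"
  unfolding pt_def using delta_eq[of "(x, g)"] by (intro Collect_cong) auto

lemma pt_translate:
  assumes "(x, g) \<in> S0" "(x, g') \<in> S0" "pt x g = pt x g'" "h \<in> carrier G"
  shows "pt (act h x) (h \<otimes> g) = pt (act h x) (h \<otimes> g')"
  using act_pt[OF assms(1,4)] act_pt[OF assms(2,4)] assms(3) by simp

lemma pt_letter:
  assumes "x \<in> K" "(x, l) \<in> S0"
    and "(\<exists>i<k. l \<in> Gs ! i) \<or> (\<exists>j<length bs. l = bs ! j \<or> l = inv (bs ! j))"
  shows "pt x l = pt x \<one>"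
proof -
  have 1: "(x, \<one>) \<in> S0" using assms(1) K_S0 by blast
  have l: "l \<in> carrier G" by (rule S0_X(2)[OF assms(2)])
  have 2: "(x, \<one> \<otimes> l) \<in> S0" using assms(2) l by simp
  have "pt x \<one> = pt x (\<one> \<otimes> l)"
    using assms(3)
  proof (elim disjE exE conjE)
    fix i assume "i < k" "l \<in> Gs ! i"
    then show ?thesis using pt_peripheral[OF 1 _ _ 2] by blast
  next
    fix j assume "j < length bs" "l = bs ! j"
    then show ?thesis using pt_basis[OF 1, of j] 2 by blast
  next
    fix j assume "j < length bs" "l = inv (bs ! j)"
    then show ?thesis using pt_basis_inv[OF 1, of j] 2 by blast
  qed
  then show ?thesis using l by simp
qed

text \<open>Here e maps (x, g v_0) to (x, g l v_0), and both are joined through the vertex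
  stabilised by g G_i g^-1. The single identification of g with the unit over x serves every element
  of the conjugate that fixes x.\<close>

lemma fix_conjugate:
  assumes x: "(x, \<one>) \<in> S0" "(x, g) \<in> S0" "pt x g = pt x \<one>"
    and l: "i < k" "l \<in> Gs ! i" and e: "e = g \<otimes> l \<otimes> inv g" "act e x = x"
  shows "actY e (pt x \<one>) = pt x \<one>"
proof -
  have g: "g \<in> carrier G" by (rule S0_X(2)[OF x(2)])
  have lc: "l \<in> carrier G" by (rule Gs_carrier[OF l])
  have ec: "e \<in> carrier G" using e(1) g lc by simp
  have eg: "e \<otimes> g = g \<otimes> l" unfolding e(1) using g lc by (simp add: m_assoc)
  have s: "(x, g \<otimes> l) \<in> S0" using S0_act[OF x(2) ec] unfolding eg e(2) .
  have "actY e (pt x \<one>) = actY e (pt x g)" unfolding x(3) ..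
  also have "\<dots> = pt x (g \<otimes> l)" unfolding act_pt[OF x(2) ec] eg e(2) ..
  also have "\<dots> = pt x g" by (rule pt_peripheral[OF x(2) l s, symmetric])
  finally show ?thesis unfolding x(3) .
qed

end

context tree_action begin

text \<open>The gates for K and K' differ, so the two recursions cannot be compared step by step. A
  path realising the distance for K lies in the larger Sigma as well.\<close>

lemma D_mono:
  assumes A: "geometric_data G Gs bs X d act K" and B: "geometric_data G Gs bs X d act K'" and sub: "K \<subseteq> K'"
    and pq: "p \<in> Sigma0 G act K" "q \<in> Sigma0 G act K" and z: "delta G Gs bs d act K p q = 0"
  shows "delta G Gs bs d act K' p q = 0"
proof -
  interpret A: geometric_data G Gs bs X d act K by (rule A)
  interpret B: geometric_data G Gs bs X d act K' by (rule B)
  have KvS: "A.Kv v \<subseteq> B.Kv v" for v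
    using sub by (auto simp: K_at_def split: sum.splits)
  have S: "A.S0 \<subseteq> B.S0" using sub by (auto simp: Sigma0_def)
  let ?R = "\<lambda>p q c. p \<in> B.M \<and> q \<in> B.M \<and> B.D p q \<le> c"
  have m: "A.emb p \<in> A.M" "A.emb q \<in> A.M" using A.emb_M pq by blast+
  have "?R (A.emb p) (A.emb q) (A.D (A.emb p) (A.emb q))"
  proof (rule A.Gl.D_attained[where R = ?R, OF _ _ _ _ m])
    fix x y v assume v: "v \<in> V" "x \<in> A.Kv v" "y \<in> A.Kv v"
    then have "x \<in> B.Kv v" "y \<in> B.Kv v" using KvS by blast+
    moreover have "B.D (x, v) (y, v) = d x y" by (subst B.Gl.D_same) simp_all
    ultimately show "?R (x, v) (y, v) (d x y)" using v by (simp add: B.M_iff)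
  next
    fix z v assume v: "v \<in> V" "0 < hgt v" "z \<in> A.Kv v" "z \<in> A.Kv (par v)"
    have a: "adj v (par v)" "adj (par v) v" "par v \<in> V" using par_hgt_adj(1)[OF v(1,2)] adj_sym adj_V by blast+
    have zB: "z \<in> B.Kv v" "z \<in> B.Kv (par v)" using v KvS by blast+
    show "?R (z, v) (z, par v) 0" "?R (z, par v) (z, v) 0"
      using B.D_adj[OF a(1) zB] B.D_adj[OF a(2) zB(2,1)] v(1) a(3) zB by (simp_all add: B.M_iff)
  next
    fix p q r a b assume "?R p q a" "?R q r b"
    then show "?R p r (a + b)" using B.Gl.D_tri[of p q r] by linarith
  qed
  moreover have "A.D (A.emb p) (A.emb q) = 0" using A.delta_eq[OF pq] z by simp
  moreover have emb: "A.emb = B.emb" by (simp add: A.emb_def B.emb_def fun_eq_iff)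
  moreover have "0 \<le> B.D (B.emb p) (B.emb q)"
  proof -
    have mB: "B.emb p \<in> B.M" "B.emb q \<in> B.M" using B.emb_M pq S by blast+
    show ?thesis using B.Gl.d_le_D[OF mB] T.nonneg[OF B.Gl.M_D(3)[OF mB(1)] B.Gl.M_D(3)[OF mB(2)]] by linarith
  qed
  ultimately have "B.D (B.emb p) (B.emb q) = 0" by simp
  moreover have "p \<in> B.S0" "q \<in> B.S0" using pq S by blast+
  ultimately show ?thesis using B.delta_eq[of p q] by simp
qed

end

text \<open>Independence of the chosen representative comes from \<open>pt_mono\<close>. Only the
  target subtree K' is a parameter.\<close>

definition class_map ::
  "('g, 'm) monoid_scheme \<Rightarrow> 'g set list \<Rightarrow> 'g list \<Rightarrow> ('p \<Rightarrow> 'p \<Rightarrow> real) \<Rightarrow> ('g \<Rightarrow> 'p \<Rightarrow> 'p) \<Rightarrow> 'p set \<Rightarrow>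
     ('p \<times> 'g) set \<Rightarrow> ('p \<times> 'g) set" where
  "class_map G Gs bs d act K' C =
     {q \<in> Sigma0 G act K'. delta G Gs bs d act K' (SOME p. p \<in> C) q = 0}"

section \<open>Approximation by geometric trees\<close>

locale nested_data = A: geometric_data G Gs bs X d act K + B: geometric_data G Gs bs X d act K'
  for G :: "('g, 'm) monoid_scheme" (structure) and Gs bs and X :: "'p set" and d act K K' +
  assumes K_sub: "K \<subseteq> K'"
begin

lemma S0_mono: "p \<in> A.S0 \<Longrightarrow> p \<in> B.S0"
  using K_sub by (auto simp: Sigma0_def)

lemma pt_mono:
  assumes "(x, g) \<in> A.S0" "(y, h) \<in> A.S0" "A.pt x g = A.pt y h"
  shows "B.pt x g = B.pt y h"
proof -
  have "delta G Gs bs d act K (x, g) (y, h) = 0"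
    using A.pt_eq_iff[OF assms(1,2)] A.delta_eq[OF assms(1,2)] assms(3) by simp
  then have "delta G Gs bs d act K' (x, g) (y, h) = 0"
    using A.D_mono[OF A.geometric_data_axioms B.geometric_data_axioms K_sub assms(1,2)] by blast
  then show ?thesis
    using B.pt_eq_iff[OF S0_mono[OF assms(1)] S0_mono[OF assms(2)]]
      B.delta_eq[OF S0_mono[OF assms(1)] S0_mono[OF assms(2)]] by simp
qed

abbreviation j where "j \<equiv> class_map G Gs bs d act K'"

lemma j_pt:
  assumes "(x, g) \<in> A.S0"
  shows "j (A.pt x g) = B.pt x g"
proof -
  obtain h where h: "(SOME p. p \<in> A.pt x g) = (x, h)" "(x, h) \<in> A.S0" "A.pt x h = A.pt x g"
    by (rule A.proj_rep[OF assms]) blast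
  show ?thesis unfolding class_map_def h(1) B.pt_delta[OF S0_mono[OF h(2)], symmetric]
    by (rule pt_mono[OF h(2) assms h(3)])
qed

lemma j_morphism: "tree_morphism A.Y A.dY B.Y B.dY j"
proof (rule A.tree_morphism_from_Y[OF B.Y_metric])
  show "j ` A.Y \<subseteq> B.Y"
  proof
    fix C' assume "C' \<in> j ` A.Y"
    then obtain C where C: "C \<in> A.Y" "C' = j C" by blast
    obtain x g where p: "(x, g) \<in> A.S0" "C = A.pt x g" using C(1) by (elim A.Y_cases)
    show "C' \<in> B.Y" unfolding C p j_pt[OF p(1)] by (rule B.Y_I[OF S0_mono[OF p(1)]])
  qed
  fix x y g assume p: "(x, g) \<in> A.S0" "(y, g) \<in> A.S0"
  show "B.dY (j (A.pt x g)) (j (A.pt y g)) = d x y"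
    unfolding j_pt[OF p(1)] j_pt[OF p(2)] by (rule B.dY_same[OF S0_mono[OF p(1)] S0_mono[OF p(2)]])
qed

lemma j_equivariant: "equivariant_on G A.Y A.actY B.actY j"
  unfolding equivariant_on_def
proof (intro ballI)
  fix h C assume h: "h \<in> carrier G" and C: "C \<in> A.Y"
  obtain x g where p: "(x, g) \<in> A.S0" "C = A.pt x g" using C by (elim A.Y_cases)
  show "j (A.actY h C) = B.actY h (j C)"
    unfolding p A.act_pt[OF p(1) h] j_pt[OF p(1)] j_pt[OF A.S0_act[OF p(1) h]] B.act_pt[OF S0_mono[OF p(1)] h] ..
qed

lemma proj_j:
  assumes "C \<in> A.Y"
  shows "proj (j C) = proj C"
proof -
  obtain x g where p: "(x, g) \<in> A.S0" "C = A.pt x g" using assms by (elim A.Y_cases)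
  show ?thesis unfolding p j_pt[OF p(1)] A.proj_pt[OF p(1)] B.proj_pt[OF S0_mono[OF p(1)]] ..
qed

end

locale exhaustion = tree_action G Gs bs X d act
  for G :: "('g, 'm) monoid_scheme" (structure) and Gs bs and X :: "'p set" and d act +
  fixes x0 :: 'p
  assumes GF: "GF_tree G Gs X d act" and min: "minimal_tree G X d act"
    and countable_G: "countable (carrier G)"
    and x0: "x0 \<in> X"
    and axis: "X = {x0} \<or> (\<exists>g\<in>carrier G. on_axis g x0)"
begin

abbreviation geom where "geom \<equiv> geometric_data G Gs bs X d act"
abbreviation \<delta> where "\<delta> \<equiv> delta G Gs bs d act"
abbreviation TKc where "TKc \<equiv> TK_carrier G Gs bs d act"
abbreviation TKd where "TKd \<equiv> TK_dist G Gs bs d act"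
abbreviation TKp where "TKp \<equiv> geometric_data.pt G Gs bs d act"

text \<open>In \<open>T\<^sub>K\<close> the point over \<open>w x\<^sub>0 \<in> K\<close> is the translate by \<open>w\<close> of the point over \<open>x\<^sub>0\<close>, for all \<open>w \<in> W\<close>.\<close>

definition coherent :: "'g set \<Rightarrow> bool" where
  "coherent W \<longleftrightarrow> finite W \<and> W \<subseteq> carrier G \<and> \<one> \<in> W \<and>
     (\<forall>K. geom K \<and> (\<lambda>w. act w x0) ` W \<subseteq> K \<longrightarrow>
        (\<forall>w\<in>W. \<delta> K (act w x0, w) (act w x0, \<one>) = 0))"

lemma coherent_Un: "coherent W \<Longrightarrow> coherent W' \<Longrightarrow> coherent (W \<union> W')"
  unfolding coherent_def by blast

lemma coherent_UN: "finite I \<Longrightarrow> I \<noteq> {} \<Longrightarrow> (\<And>i. i \<in> I \<Longrightarrow> coherent (W i)) \<Longrightarrow> coherent (\<Union>i\<in>I. W i)"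
  by (induction rule: finite_ne_induct) (auto intro: coherent_Un)

text \<open>Translating the identification of g with the unit over g x0 by l identifies
  \<open>l \<otimes> g\<close> with l over l g x0, and \<open>pt_letter\<close> leads from l to the
  unit. The old identifications persist, since coherence quantifies over all K containing the orbit
  points.\<close>

lemma coherent_extend:
  assumes W: "coherent W" "g \<in> W" and l: "l \<in> carrier G"
    "(\<exists>i<k. l \<in> Gs ! i) \<or> (\<exists>j<length bs. l = bs ! j \<or> l = inv (bs ! j))"
  shows "coherent (insert (l \<otimes> g) W)"
  unfolding coherent_def
proof (intro conjI allI impI ballI)
  show "finite (insert (l \<otimes> g) W)" "insert (l \<otimes> g) W \<subseteq> carrier G" "\<one> \<in> insert (l \<otimes> g) W"
    using W l unfolding coherent_def by auto
  fix K w assume K: "geom K \<and> (\<lambda>w. act w x0) ` insert (l \<otimes> g) W \<subseteq> K"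
    and w: "w \<in> insert (l \<otimes> g) W"
  interpret A: geometric_data G Gs bs X d act K using K by blast
  have old: "\<delta> K (act w x0, w) (act w x0, \<one>) = 0" if "w \<in> W" for w
  proof -
    have "(\<lambda>w. act w x0) ` W \<subseteq> K" using K by blast
    then show ?thesis using W(1) that A.geometric_data_axioms unfolding coherent_def by blast
  qed
  show "\<delta> K (act w x0, w) (act w x0, \<one>) = 0"
  proof (cases "w \<in> W")
    case True then show ?thesis by (rule old)
  next
    case False
    then have w: "w = l \<otimes> g" using w by blast
    have g: "g \<in> carrier G" using W unfolding coherent_def by blast
    have one: "\<one> \<in> W" using W unfolding coherent_def by blast
    let ?y = "act g x0"
    have y: "?y \<in> K" "act l ?y \<in> K" "x0 \<in> K"
      using K W(2) one act_mult[OF l(1) g x0] act_one[OF x0] by auto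
    have s: "(?y, g) \<in> A.S0" "(?y, \<one>) \<in> A.S0" using y g A.K_S0 unfolding A.S0_iff by blast+
    have "A.pt ?y g = A.pt ?y \<one>" using old[OF W(2)] A.pt_eq_iff[OF s] A.delta_eq[OF s] by simp
    from A.pt_translate[OF s this l(1)] have 1: "A.pt (act l ?y) (l \<otimes> g) = A.pt (act l ?y) l" using l by simp
    have s2: "(act l ?y, l) \<in> A.S0" using A.S0_act[OF s(2) l(1)] l by simp
    have 2: "A.pt (act l ?y) l = A.pt (act l ?y) \<one>" by (rule A.pt_letter[OF y(2) s2 l(2)])
    have s3: "(act l ?y, l \<otimes> g) \<in> A.S0" by (rule A.S0_act[OF s(1) l(1)])
    have s4: "(act l ?y, \<one>) \<in> A.S0" using y A.K_S0 by blast
    have "\<delta> K (act l ?y, l \<otimes> g) (act l ?y, \<one>) = 0"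
      using 1 2 A.pt_eq_iff[OF s3 s4] A.delta_eq[OF s3 s4] by simp
    then show ?thesis unfolding w act_mult[OF l(1) g x0] .
  qed
qed

lemma coherent_exists:
  assumes "g \<in> carrier G"
  shows "\<exists>W. coherent W \<and> g \<in> W"
  using assms
proof (induction rule: free_product_induct)
  case one
  have "\<delta> K (act \<one> x0, \<one>) (act \<one> x0, \<one>) = 0"
    if K: "geom K" "act \<one> x0 \<in> K" for K
  proof -
    interpret A: geometric_data G Gs bs X d act K by (rule K(1))
    have s: "(act \<one> x0, \<one>) \<in> A.S0" using K(2) A.K_S0 by blast
    show ?thesis using A.delta_eq[OF s s] A.pt_eq_iff[OF s s] by simp
  qed
  then have "coherent {\<one>}" unfolding coherent_def by auto
  then show ?case by blast
next
  case (peripheral g i h)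
  then show ?case using coherent_extend[OF _ _ Gs_carrier[OF peripheral.hyps(2,3)]] by blast
next
  case (basis g j)
  then show ?case using coherent_extend[OF _ _ bs_carrier[OF basis.hyps(2)]] by blast
next
  case (basis_inv g j)
  then show ?case using coherent_extend[OF _ _ inv_closed[OF bs_carrier[OF basis_inv.hyps(2)]]] by blast
qed

definition W1 :: "'g \<Rightarrow> 'g set" where "W1 g = (SOME W. coherent W \<and> g \<in> W)"

definition Wn :: "nat \<Rightarrow> 'g set" where "Wn n = (\<Union>m\<le>n. W1 (from_nat_into (carrier G) m))"

definition Kn :: "nat \<Rightarrow> 'p set" where "Kn n = T.tree_hull ((\<lambda>w. act w x0) ` Wn n)"

lemma W1: "g \<in> carrier G \<Longrightarrow> coherent (W1 g)" "g \<in> carrier G \<Longrightarrow> g \<in> W1 g"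
  using someI_ex[OF coherent_exists] unfolding W1_def by blast+

lemma Wn_coherent: "coherent (Wn n)"
  unfolding Wn_def
proof (rule coherent_UN)
  fix i
  have "carrier G \<noteq> {}" using one_closed by blast
  then show "coherent (W1 (from_nat_into (carrier G) i))" by (rule W1(1)[OF from_nat_into])
qed auto

lemma Wn_props: "finite (Wn n)" "Wn n \<subseteq> carrier G" "\<one> \<in> Wn n"
  using Wn_coherent unfolding coherent_def by blast+

lemma Wn_mono: "n \<le> m \<Longrightarrow> Wn n \<subseteq> Wn m"
  unfolding Wn_def by (rule UN_mono) auto

lemma eventually_Wn:
  assumes "g \<in> carrier G"
  shows "\<forall>\<^sub>F n in sequentially. g \<in> Wn n"
proof -
  obtain m where m: "from_nat_into (carrier G) m = g"
    using from_nat_into_surj[OF countable_G assms] by blast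
  have "g \<in> Wn n" if "m \<le> n" for n
    using W1(2)[OF assms] m that unfolding Wn_def by blast
  then show ?thesis unfolding eventually_sequentially by blast
qed

lemma orbit_X: "(\<lambda>w. act w x0) ` Wn n \<subseteq> X"
  using Wn_props(2) act_X x0 by blast

lemma Kn_iff: "z \<in> Kn n \<longleftrightarrow> (\<exists>v\<in>Wn n. \<exists>w\<in>Wn n. T.btw (act v x0) z (act w x0))"
  unfolding Kn_def T.tree_hull_iff[OF orbit_X] by blast

lemma Kn_mono: "n \<le> m \<Longrightarrow> Kn n \<subseteq> Kn m"
  unfolding Kn_def by (intro T.tree_hull_mono image_mono Wn_mono)

lemma orbit_Kn: "w \<in> Wn n \<Longrightarrow> act w x0 \<in> Kn n"
  unfolding Kn_def using T.tree_hull_superset[OF orbit_X] by blast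

lemma x0_Kn: "x0 \<in> Kn n"
  using orbit_Kn[OF Wn_props(3)] act_one[OF x0] by simp

lemma Kn_gated: "T.gated (Kn n)"
  unfolding Kn_def
  by (rule T.finite_tree_hull_gated[OF orbit_X]) (use Wn_props[of n] in auto)

text \<open>The hull of the orbit of x0 is an invariant subtree, so minimality of T leaves nothing
  outside it. This is what makes the \<open>Kn\<close> exhaust T.\<close>

lemma tree_is_hull:
  assumes "z \<in> X"
  shows "\<exists>v\<in>carrier G. \<exists>w\<in>carrier G. T.btw (act v x0) z (act w x0)"
proof -
  let ?O = "(\<lambda>g. act g x0) ` carrier G"
  have O: "?O \<subseteq> X" using act_X x0 by blast
  note iff = T.tree_hull_iff[OF O]
  have conv: "T.convex_in (T.tree_hull ?O)" by (rule T.tree_hull_convex[OF O])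
  then have HX: "T.tree_hull ?O \<subseteq> X" unfolding T.convex_in_def by blast
  have "x0 \<in> ?O" using act_one[OF x0] one_closed by (intro image_eqI[of _ _ \<one>]) simp_all
  then have ne: "T.tree_hull ?O \<noteq> {}" using T.tree_hull_superset[OF O] by blast
  have "subtree X d (T.tree_hull ?O)"
    unfolding subtree_def
  proof (intro conjI ballI ne HX)
    fix x y assume xy: "x \<in> T.tree_hull ?O" "y \<in> T.tree_hull ?O"
    then have "x \<in> X" "y \<in> X" using HX by blast+
    then show "seg X d x y \<subseteq> T.tree_hull ?O" using T.seg_eq conv xy unfolding T.convex_in_def by blast
  qed
  moreover have "act g ` T.tree_hull ?O \<subseteq> T.tree_hull ?O" if g: "g \<in> carrier G" for g
  proof
    fix y assume "y \<in> act g ` T.tree_hull ?O"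
    then obtain x where "x \<in> T.tree_hull ?O" "y = act g x" by (rule imageE)
    then obtain v w where p: "y = act g x" "v \<in> carrier G" "w \<in> carrier G" "T.btw (act v x0) x (act w x0)"
      using iff[of x] by blast
    have "T.btw (act g (act v x0)) y (act g (act w x0))"
      unfolding p(1) by (rule act_btw[OF g act_X[OF p(2) x0] act_X[OF p(3) x0] p(4)])
    then have "T.btw (act (g \<otimes> v) x0) y (act (g \<otimes> w) x0)" using act_mult[OF g _ x0] p(2,3) by simp
    then show "y \<in> T.tree_hull ?O" unfolding iff using g p(2,3) m_closed by blast
  qed
  ultimately have "T.tree_hull ?O = X" using min unfolding minimal_tree_def by blast
  then show ?thesis using assms iff by blast
qed

lemma eventually_Kn:
  assumes "z \<in> X"
  shows "\<forall>\<^sub>F n in sequentially. z \<in> Kn n"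
proof -
  obtain v w where p: "v \<in> carrier G" "w \<in> carrier G" "T.btw (act v x0) z (act w x0)"
    using tree_is_hull[OF assms] by blast
  show ?thesis
    using eventually_Wn[OF p(1)] eventually_Wn[OF p(2)]
    by eventually_elim (use p(3) Kn_iff in blast)
qed

lemma eventually_translate_Kn:
  assumes g: "g \<in> carrier G"
  shows "\<forall>\<^sub>F m in sequentially. act g ` Kn n \<subseteq> Kn m"
proof -
  have "\<forall>\<^sub>F m in sequentially. \<forall>w\<in>Wn n. g \<otimes> w \<in> Wn m"
    using Wn_props g by (intro eventually_ball_finite ballI eventually_Wn) auto
  then show ?thesis
  proof eventually_elim
    case (elim m)
    show ?case
    proof
      fix y assume "y \<in> act g ` Kn n"
      then obtain x where "x \<in> Kn n" "y = act g x" by (rule imageE)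
      then obtain v w where p: "y = act g x" "v \<in> Wn n" "w \<in> Wn n" "T.btw (act v x0) x (act w x0)"
        using Kn_iff[of x n] by blast
      have c: "v \<in> carrier G" "w \<in> carrier G" using p Wn_props by blast+
      have "T.btw (act g (act v x0)) y (act g (act w x0))"
        unfolding p(1) by (rule act_btw[OF g act_X[OF c(1) x0] act_X[OF c(2) x0] p(4)])
      then have "T.btw (act (g \<otimes> v) x0) y (act (g \<otimes> w) x0)" using act_mult[OF g _ x0] c by simp
      then show "y \<in> Kn m" unfolding Kn_iff using elim p(2,3) by blast
    qed
  qed
qed

lemma fixed_unique:
  assumes "i < k"
  shows "\<exists>!x. x \<in> X \<and> fixes_point act (Gs ! i) x"
proof -
  show ?thesis using GF assms one_closed conj_set_one[OF assms] unfolding GF_tree_def by metis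
qed

lemma eventually_admissible:
  "\<forall>\<^sub>F n in sequentially. geom (Kn n) \<and> admissible_K G Gs bs X d act (Kn n)"
proof -
  have "\<forall>\<^sub>F n in sequentially. \<forall>i\<in>{..<k}. \<forall>x\<in>X. fixes_point act (Gs ! i) x \<longrightarrow> x \<in> Kn n"
  proof (rule eventually_ball_finite[OF finite_lessThan], rule ballI)
    fix i assume "i \<in> {..<k}"
    then obtain p where p: "p \<in> X" "\<And>x. x \<in> X \<Longrightarrow> fixes_point act (Gs ! i) x \<Longrightarrow> x = p"
      using fixed_unique[of i] by auto
    show "\<forall>\<^sub>F n in sequentially. \<forall>x\<in>X. fixes_point act (Gs ! i) x \<longrightarrow> x \<in> Kn n"
      using eventually_Kn[OF p(1)] by eventually_elim (use p(2) in blast)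
  qed
  moreover have "\<forall>\<^sub>F n in sequentially. \<forall>j\<in>{..<length bs}. bs ! j \<in> Wn n"
    by (rule eventually_ball_finite[OF finite_lessThan]) (use bs_carrier eventually_Wn in blast)
  ultimately show ?thesis
  proof eventually_elim
    case (elim n)
    have fin: "finite_subtree X d (Kn n)"
      unfolding finite_subtree_def Kn_def T.tree_hull_def
      by (rule exI[of _ "(\<lambda>w. act w x0) ` Wn n"]) (use Wn_props[of n] orbit_X[of n] in auto)
    have b: "Kn n \<inter> act (bs ! j) ` Kn n \<noteq> {}" if "j < length bs" for j
    proof -
      have "act (bs ! j) x0 \<in> Kn n" using elim(2) that orbit_Kn by blast
      then show ?thesis using x0_Kn by blast
    qed
    have p: "\<exists>p\<in>Kn n. fixes_point act (Gs ! i) p" if "i < k" for i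
      using elim(1) that fixed_unique[OF that] by blast
    have "geom (Kn n)"
      by unfold_locales (use Kn_gated p b in auto)
    moreover have "admissible_K G Gs bs X d act (Kn n)"
      unfolding admissible_K_def using fin elim(1) b by blast
    ultimately show ?case ..
  qed
qed

lemma Wn_coherent_pt:
  assumes "geom (Kn n)" "w \<in> Wn n"
  shows "TKp (Kn n) (act w x0) w
    = TKp (Kn n) (act w x0) \<one>"
proof -
  interpret A: geometric_data G Gs bs X d act "Kn n" by (rule assms(1))
  have z: "\<delta> (Kn n) (act w x0, w) (act w x0, \<one>) = 0"
    using Wn_coherent[of n] assms orbit_Kn unfolding coherent_def by blast
  have w: "w \<in> carrier G" using assms(2) Wn_props by blast
  have s: "(act w x0, w) \<in> A.S0" "(act w x0, \<one>) \<in> A.S0"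
    using x0_Kn[of n] w orbit_Kn[OF assms(2)] A.K_S0 unfolding A.S0_iff by blast+
  show ?thesis using z A.pt_eq_iff[OF s] A.delta_eq[OF s] by simp
qed

text \<open>Once g and g^2 lie in \<open>Wn n\<close>, the point over x0 and its translates by g and
  g^2 are in the copy of K, where distances are those of T. So \<open>on_axis\<close> passes to T_K,
  and \<open>axis_in_subtree\<close> yields the hypothesis \<open>base\<close> of
  \<open>Y_minimal\<close>.\<close>

lemma eventually_minimal:
  "\<forall>\<^sub>F n in sequentially. minimal_tree G (TKc (Kn n)) (TKd (Kn n)) (TK_act G act)"
proof -
  have crit: "minimal_tree G (TKc (Kn n)) (TKd (Kn n)) (TK_act G act)"
    if A: "geom (Kn n)"
      and ax: "X = {x0} \<or> (\<exists>g\<in>carrier G. g \<in> Wn n \<and> g \<otimes> g \<in> Wn n \<and> on_axis g x0)" for n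
  proof -
    interpret A: geometric_data G Gs bs X d act "Kn n" by (rule A)
    have s0: "(x0, \<one>) \<in> A.S0" using x0_Kn A.K_S0 by blast
    show ?thesis
    proof (rule A.Y_minimal[OF Wn_props(2) Kn_def x0_Kn Wn_coherent_pt[OF A]])
      fix Z assume Z: "subtree A.Y A.dY Z" and inv: "\<And>g. g \<in> carrier G \<Longrightarrow> A.actY g ` Z \<subseteq> Z"
      from ax show "A.pt x0 \<one> \<in> Z"
      proof (elim disjE bexE conjE)
        \<comment> \<open>Over a one-point tree every class is a translate of the point over x0, so
          any point of Z can be moved there.\<close>
        assume X: "X = {x0}"
        obtain C where C: "C \<in> Z" "C \<in> A.Y" using Z unfolding subtree_def by blast
        obtain x g where p: "(x, g) \<in> A.S0" "C = A.pt x g" using C(2) by (elim A.Y_cases)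
        have g: "g \<in> carrier G" by (rule A.S0_X(2)[OF p(1)])
        have "act (inv g) x \<in> X" by (rule act_X[OF inv_closed[OF g] A.S0_X(1)[OF p(1)]])
        then have "A.actY (inv g) C = A.pt x0 \<one>"
          unfolding p(2) A.act_pt[OF p(1) inv_closed[OF g]] using X g by simp
        then show ?thesis using inv[OF inv_closed[OF g]] C(1) by blast
      next
        fix g assume g: "g \<in> carrier G" "g \<in> Wn n" "g \<otimes> g \<in> Wn n"
          and ax: "on_axis g x0"
        have s1: "(act g x0, \<one>) \<in> A.S0" "(act (g \<otimes> g) x0, \<one>) \<in> A.S0"
          using orbit_Kn g A.K_S0 by blast+
        have 1: "A.actY g (A.pt x0 \<one>) = A.pt (act g x0) \<one>"
          unfolding A.act_pt[OF s0 g(1)] using Wn_coherent_pt[OF A g(2)] g by simp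
        have "A.actY g (A.actY g (A.pt x0 \<one>)) = A.actY (g \<otimes> g) (A.pt x0 \<one>)"
          using A.Ya.act_mult[OF g(1,1) A.Y_I[OF s0]] by simp
        also have "\<dots> = A.pt (act (g \<otimes> g) x0) \<one>"
          unfolding A.act_pt[OF s0 m_closed[OF g(1,1)]] using Wn_coherent_pt[OF A g(3)] g by simp
        finally have 2: "A.actY g (A.actY g (A.pt x0 \<one>)) = A.pt (act (g \<otimes> g) x0) \<one>" .
        show ?thesis
        proof (rule A.Ya.axis_in_subtree[OF g(1) A.Y_I[OF s0] _ Z inv])
          show "A.Ya.on_axis g (A.pt x0 \<one>)"
            using ax unfolding A.Ya.on_axis_def on_axis_def 2 A.dY_same[OF s0 s1(2)]
            unfolding 1 A.dY_same[OF s0 s1(1)] act_mult[OF g(1,1) x0] .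
        qed
      qed
    qed
  qed
  from axis show ?thesis
  proof (elim disjE bexE conjE)
    assume X: "X = {x0}"
    show ?thesis
      by (rule eventually_mono[OF eventually_admissible], rule crit, erule conjunct1, rule disjI1[OF X])
  next
    fix g assume g: "g \<in> carrier G" "on_axis g x0"
    show ?thesis
      using eventually_admissible eventually_Wn[OF g(1)] eventually_Wn[OF m_closed[OF g(1,1)]]
      by eventually_elim (rule crit, use g in blast, use g in blast)
  qed
qed

text \<open>\<open>TKp (Kn n)\<close> has its intended meaning under \<open>geom (Kn n)\<close>,
  which is therefore included.\<close>

definition tied :: "nat \<Rightarrow> 'p \<Rightarrow> 'g \<Rightarrow> 'g \<Rightarrow> bool" where
  "tied n x g h \<longleftrightarrow> geom (Kn n) \<and>
     (x, g) \<in> Sigma0 G act (Kn n) \<and> (x, h) \<in> Sigma0 G act (Kn n) \<and>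
     TKp (Kn n) x g = TKp (Kn n) x h"

text \<open>Induction over prepended letters l. If g x is tied, translation identifies
  \<open>l \<otimes> g\<close> with l over z = l g x, and \<open>pt_letter\<close> leads from l to
  the unit as soon as z is in K_m. The latter holds eventually for all of l g K_n at once.\<close>

lemma eventually_tied:
  assumes "g \<in> carrier G"
  shows "\<forall>\<^sub>F m in sequentially. \<forall>z\<in>act g ` Kn n. tied m z g \<one>"
proof -
  have step: "\<forall>\<^sub>F m in sequentially. \<forall>z\<in>act (l \<otimes> g) ` Kn n. tied m z (l \<otimes> g) \<one>"
    if g: "g \<in> carrier G" and l: "l \<in> carrier G"
      "(\<exists>i<k. l \<in> Gs ! i) \<or> (\<exists>j<length bs. l = bs ! j \<or> l = inv (bs ! j))"
      and IH: "\<forall>\<^sub>F m in sequentially. \<forall>z\<in>act g ` Kn n. tied m z g \<one>" for g l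
    using IH eventually_translate_Kn[OF m_closed[OF l(1) g], of n]
  proof eventually_elim
    case (elim m)
    show ?case
    proof
      fix z assume z: "z \<in> act (l \<otimes> g) ` Kn n"
      then obtain x where x: "x \<in> Kn n" "z = act (l \<otimes> g) x" by blast
      have xX: "x \<in> X" using x(1) Kn_gated unfolding T.gated_def by blast
      let ?u = "act g x"
      have zu: "z = act l ?u" unfolding x(2) by (rule act_mult[OF l(1) g xX])
      have t: "tied m ?u g \<one>" using elim(1) x(1) by blast
      then interpret A: geometric_data G Gs bs X d act "Kn m" unfolding tied_def by blast
      have s: "(?u, g) \<in> A.S0" "(?u, \<one>) \<in> A.S0" "A.pt ?u g = A.pt ?u \<one>" using t unfolding tied_def by blast+
      have 1: "A.pt z (l \<otimes> g) = A.pt z l" using A.pt_translate[OF s l(1)] l(1) unfolding zu by simp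
      have s2: "(z, l \<otimes> g) \<in> A.S0" "(z, l) \<in> A.S0"
        using A.S0_act[OF s(1) l(1)] A.S0_act[OF s(2) l(1)] l(1) unfolding zu by simp_all
      have zK: "z \<in> Kn m" using elim(2) z by blast
      have "A.pt z l = A.pt z \<one>" by (rule A.pt_letter[OF zK s2(2) l(2)])
      then show "tied m z (l \<otimes> g) \<one>"
        unfolding tied_def using A.geometric_data_axioms s2(1) zK A.K_S0 1 by simp
    qed
  qed
  show ?thesis
    using assms
  proof (induction rule: free_product_induct)
    case one
    have "\<forall>\<^sub>F m in sequentially. n \<le> m" by (rule eventually_ge_at_top)
    with eventually_admissible show ?case
    proof eventually_elim
      case (elim m)
      then interpret A: geometric_data G Gs bs X d act "Kn m" by blast
      show ?case
      proof
        fix z assume "z \<in> act \<one> ` Kn n"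
        then obtain x where x: "x \<in> Kn n" "z = act \<one> x" by blast
        have "x \<in> X" using x(1) Kn_gated unfolding T.gated_def by blast
        then have "z \<in> Kn m" using x Kn_mono[OF elim(2)] act_one by auto
        then show "tied m z \<one> \<one>" unfolding tied_def using A.geometric_data_axioms A.K_S0 by blast
      qed
    qed
  next
    case (peripheral g i h)
    show ?case by (rule step[OF peripheral.hyps(1) Gs_carrier[OF peripheral.hyps(2,3)] _ peripheral.IH]) (use peripheral.hyps in blast)
  next
    case (basis g j)
    show ?case by (rule step[OF basis.hyps(1) bs_carrier[OF basis.hyps(2)] _ basis.IH]) (use basis.hyps in blast)
  next
    case (basis_inv g j)
    show ?case by (rule step[OF basis_inv.hyps(1) inv_closed[OF bs_carrier[OF basis_inv.hyps(2)]] _ basis_inv.IH])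
      (use basis_inv.hyps in blast)
  qed
qed

lemma eventually_tied_point:
  assumes "x \<in> X" "g \<in> carrier G"
  shows "\<forall>\<^sub>F m in sequentially. tied m x g \<one>"
proof -
  obtain n where n: "act (inv g) x \<in> Kn n"
    using eventually_Kn[OF act_X[OF inv_closed[OF assms(2)] assms(1)]] by (auto simp: eventually_sequentially)
  then have "x \<in> act g ` Kn n"
    using act_inv_cancel(2)[OF assms(2,1)] by (metis imageI)
  with eventually_tied[OF assms(2), of n] show ?thesis by (auto elim!: eventually_mono)
qed

text \<open>A Kurosh decomposition leaves finitely many identifications over the fixed point x: one
  for each conjugator, which handles its whole conjugate by \<open>fix_conjugate\<close>, and one
  for each free generator f, which maps (x, v_0) to (x, f v_0).\<close>

lemma eventually_elliptic:
  assumes H: "finite_kurosh_rank G Gs H" and ell: "elliptic X act H"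
  shows "\<forall>\<^sub>F n in sequentially. elliptic (TKc (Kn n)) (TK_act G act) H"
proof -
  obtain x where x: "x \<in> X" "fixes_point act H x" using ell unfolding elliptic_def by blast
  obtain cs fs where dec: "kurosh_decomp G Gs H cs fs" and sub: "subgroup H G" using H unfolding finite_kurosh_rank_def by blast
  have cs: "\<forall>(g, i, Hj)\<in>set cs. g \<in> carrier G \<and> i < k \<and> subgroup Hj G \<and> Hj \<subseteq> Gs ! i \<and> Hj \<noteq> {\<one>}"
    and fs: "\<forall>f\<in>set fs. infinite_order G f"
    using dec unfolding kurosh_decomp_def by blast+
  let ?L = "map (\<lambda>(g, i, Hj). conj_set G g Hj) cs @ map (cyc G) fs"
  have fp: "is_free_product G ?L H" using dec unfolding kurosh_decomp_def by blast
  have LH: "h \<in> H" if h: "A \<in> set ?L" "h \<in> A" for A h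
  proof (cases "h = \<one>")
    case True then show ?thesis using subgroup.one_closed[OF sub] by simp
  next
    case False
    obtain i where i: "i < length ?L" "?L ! i = A" using h(1) by (metis in_set_conv_nth)
    have "reduced_word G ?L [(i, h)]" using i h False unfolding reduced_word_def by simp
    then have "word_prod G [(i, h)] \<in> H" using fp unfolding is_free_product_def by blast
    moreover have "subgroup A G" using fp h(1) unfolding is_free_product_def by blast
    then have "h \<in> carrier G" using h(2) subgroup.mem_carrier by metis
    ultimately show ?thesis by (simp add: word_prod_def)
  qed
  have fixH: "act h x = x" if "h \<in> H" for h using x(2) that unfolding fixes_point_def by blast
  have "\<forall>\<^sub>F n in sequentially. \<forall>c\<in>set cs. tied n x (fst c) \<one>"
    using cs x(1) by (intro eventually_ball_finite finite_set ballI eventually_tied_point) auto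
  moreover have "\<forall>\<^sub>F n in sequentially. \<forall>f\<in>set fs. tied n x f \<one>"
    using fs x(1) by (intro eventually_ball_finite finite_set ballI eventually_tied_point) (auto simp: infinite_order_def)
  moreover note eventually_Kn[OF x(1)] eventually_admissible
  ultimately show ?thesis
  proof eventually_elim
    case (elim n)
    then interpret A: geometric_data G Gs bs X d act "Kn n" by blast
    have s: "(x, \<one>) \<in> A.S0" using elim(3) A.K_S0 by blast
    let ?S = "{h \<in> carrier G. A.actY h (A.pt x \<one>) = A.pt x \<one>}"
    have S: "subgroup ?S G" by (rule A.elliptic_stabilizer[OF s])
    have LS: "A \<subseteq> ?S" if A: "A \<in> set ?L" for A
    proof -
      consider (c) g i Hj where "(g, i, Hj) \<in> set cs" "A = conj_set G g Hj" | (f) f where "f \<in> set fs" "A = cyc G f"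
        using A by auto
      then show ?thesis
      proof cases
        case c
        have ci: "g \<in> carrier G" "i < k" "Hj \<subseteq> Gs ! i" using cs c(1) by blast+
        have t: "tied n x g \<one>" using elim(1) c(1) by fastforce
        show ?thesis
        proof
          fix e assume e: "e \<in> A"
          then obtain l where l: "l \<in> Hj" "e = g \<otimes> l \<otimes> inv g" unfolding c(2) conj_set_def by blast
          have lG: "l \<in> Gs ! i" using l ci by blast
          have "act e x = x" by (rule fixH[OF LH[OF A e]])
          then have "A.actY e (A.pt x \<one>) = A.pt x \<one>"
            using A.fix_conjugate[OF s _ _ ci(2) lG l(2)] t unfolding tied_def by blast
          moreover have "e \<in> carrier G" using l(2) ci(1) Gs_carrier[OF ci(2) lG] by simp
          ultimately show "e \<in> ?S" by blast
        qed
      next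
        case f
        have fc: "f \<in> carrier G" using fs f(1) unfolding infinite_order_def by blast
        have "f [^] (1::int) = f" using fc by (simp add: int_pow_1)
        then have "f \<in> A" unfolding f(2) cyc_def by (metis (mono_tags, lifting) mem_Collect_eq)
        then have "act f x = x" by (rule fixH[OF LH[OF A]])
        moreover have "A.pt x f = A.pt x \<one>" using elim(2) f(1) unfolding tied_def by blast
        ultimately have "f \<in> ?S" using A.act_pt[OF s fc] fc by simp
        then have "f [^] (m::int) \<in> ?S" for m
          using group.int_pow_closed[OF subgroup.subgroup_is_group[OF S is_group], of f m]
            int_pow_consistent[OF S, of f m] by simp
        then show ?thesis unfolding f(2) cyc_def by blast
      qed
    qed
    have prod: "word_prod G w \<in> ?S" if "\<forall>(i, h)\<in>set w. i < length ?L \<and> h \<in> ?L ! i" for w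
      using that
    proof (induction w)
      case Nil show ?case using subgroup.one_closed[OF S] by (simp add: word_prod_def)
    next
      case (Cons a w)
      obtain i h where a: "a = (i, h)" by (cases a)
      have "h \<in> ?S" using LS[of "?L ! i"] Cons.prems a nth_mem[of i ?L] by auto
      moreover have "word_prod G w \<in> ?S" using Cons by simp
      ultimately have "h \<otimes> word_prod G w \<in> ?S" by (rule subgroup.m_closed[OF S])
      then show ?case unfolding a by (simp add: word_prod_def)
    qed
    have "A.actY h (A.pt x \<one>) = A.pt x \<one>" if h: "h \<in> H" for h
    proof -
      have "\<forall>x\<in>H. \<exists>!w. reduced_word G ?L w \<and> word_prod G w = x" using fp unfolding is_free_product_def by blast
      from ex1_implies_ex[OF bspec[OF this h]] obtain w where w: "reduced_word G ?L w" "word_prod G w = h" by blast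
      have "\<forall>(i, h)\<in>set w. i < length ?L \<and> h \<in> ?L ! i" using w(1) unfolding reduced_word_def by blast
      from prod[OF this] show ?thesis unfolding w(2) by blast
    qed
    then have "fixes_point A.actY H (A.pt x \<one>)" unfolding fixes_point_def by blast
    then show ?case unfolding elliptic_def using A.Y_I[OF s] by blast
  qed
qed

lemma resolution:
  assumes N: "\<And>n. N \<le> n \<Longrightarrow> geom (Kn n) \<and> admissible_K G Gs bs X d act (Kn n)"
  defines "Xs \<equiv> \<lambda>n. TKc (Kn (N + n))"
    and "ds \<equiv> \<lambda>n. TKd (Kn (N + n))"
    and "acts \<equiv> \<lambda>n. TK_act G act"
  shows "GF_tree G Gs (Xs n) (ds n) (acts n)" "geometric G Gs bs TYPE('p) (Xs n) (ds n) (acts n)"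
    "strongly_converges G Xs ds acts X d act"
proof -
  have gd: "geom (Kn (N + n))" and ad: "admissible_K G Gs bs X d act (Kn (N + n))" for n
    using N by simp_all
  show "GF_tree G Gs (Xs n) (ds n) (acts n)" unfolding Xs_def ds_def acts_def
    by (rule geometric_data.Y_GF_tree[OF gd GF])
  show "geometric G Gs bs TYPE('p) (Xs n) (ds n) (acts n)"
    unfolding geometric_def Xs_def ds_def acts_def
    by (intro exI[of _ X] exI[of _ d] exI[of _ act] exI[of _ "Kn (N + n)"] exI[of _ id]) (use GF ad in auto)
  have nested: "nested_data G Gs bs X d act (Kn (N + n)) (Kn (N + n'))" if "n \<le> n'" for n n'
  proof -
    interpret A: geometric_data G Gs bs X d act "Kn (N + n)" by (rule gd)
    interpret B: geometric_data G Gs bs X d act "Kn (N + n')" by (rule gd)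
    show ?thesis by unfold_locales (rule Kn_mono, use that in simp)
  qed
  define jj where "jj n n' = class_map G Gs bs d act (Kn (N + n'))" for n n' :: nat
  show "strongly_converges G Xs ds acts X d act"
    unfolding strongly_converges_def
  proof (intro exI[of _ jj] exI[of _ "\<lambda>n. proj"] conjI allI impI ballI)
    fix n n' :: nat assume le: "n \<le> n'"
    interpret J: nested_data G Gs bs X d act "Kn (N + n)" "Kn (N + n')" by (rule nested[OF le])
    show "tree_morphism (Xs n) (ds n) (Xs n') (ds n') (jj n n')"
      unfolding Xs_def ds_def jj_def by (rule J.j_morphism)
    show "equivariant_on G (Xs n) (acts n) (acts n') (jj n n')"
      unfolding Xs_def acts_def jj_def by (rule J.j_equivariant)
    show "proj (jj n n' C) = proj C" if "C \<in> Xs n" for C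
      using that unfolding Xs_def jj_def by (rule J.proj_j)
  next
    fix n
    interpret A: geometric_data G Gs bs X d act "Kn (N + n)" by (rule gd)
    show "tree_morphism (Xs n) (ds n) X d proj" unfolding Xs_def ds_def by (rule A.proj_morphism)
    show "equivariant_on G (Xs n) (acts n) act proj"
      unfolding equivariant_on_def Xs_def acts_def using A.proj_act by blast
    fix C C' assume "C \<in> Xs n" "C' \<in> Xs n"
    then have C: "C \<in> A.Y" "C' \<in> A.Y" unfolding Xs_def by auto
    obtain F where F: "finite F" "F \<subseteq> carrier G"
      "\<And>m. m \<in> seg A.Y A.dY C C' \<Longrightarrow> \<exists>g\<in>F. \<exists>z. (z, g) \<in> A.S0 \<and> m = A.pt z g"
      by (rule A.seg_finite_cover[OF C]) blast
    have "\<forall>\<^sub>F m in sequentially. \<forall>g\<in>F. \<forall>z\<in>act g ` Kn (N + n). tied m z g \<one>"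
      using F(1,2) by (intro eventually_ball_finite ballI eventually_tied) auto
    then obtain M where M: "\<And>m. M \<le> m \<Longrightarrow> \<forall>g\<in>F. \<forall>z\<in>act g ` Kn (N + n). tied m z g \<one>"
      unfolding eventually_sequentially by blast
    \<comment> \<open>At this index every point of the image of the segment has a representative
      over v_0, i.e. lies in the copy of K, on which \<open>proj\<close> is isometric.\<close>
    let ?n' = "max n M"
    interpret J: nested_data G Gs bs X d act "Kn (N + n)" "Kn (N + ?n')" by (rule nested) simp
    have key: "\<exists>z. (z, \<one>) \<in> J.B.S0 \<and> u = J.B.pt z \<one>" if u: "u \<in> jj n ?n' ` seg (Xs n) (ds n) C C'" for u
    proof -
      obtain m where m: "m \<in> seg A.Y A.dY C C'" "u = jj n ?n' m" using u unfolding Xs_def ds_def by blast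
      obtain g z where z: "g \<in> F" "(z, g) \<in> A.S0" "m = A.pt z g" using F(3)[OF m(1)] by blast
      have "z \<in> act g ` Kn (N + n)" using z(2) unfolding A.S0_iff by blast
      moreover have "M \<le> N + ?n'" by simp
      ultimately have "tied (N + ?n') z g \<one>" using M z(1) by blast
      then have t: "(z, \<one>) \<in> J.B.S0" "J.B.pt z g = J.B.pt z \<one>" unfolding tied_def by blast+
      have "u = J.B.pt z g" unfolding m(2) z(3) jj_def by (rule J.j_pt[OF z(2)])
      then show ?thesis using t by auto
    qed
    have "isometric_on (ds ?n') d proj (jj n ?n' ` seg (Xs n) (ds n) C C')"
      unfolding isometric_on_def
    proof (intro ballI)
      fix u v assume u: "u \<in> jj n ?n' ` seg (Xs n) (ds n) C C'" and v: "v \<in> jj n ?n' ` seg (Xs n) (ds n) C C'"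
      obtain z where z: "(z, \<one>) \<in> J.B.S0" "u = J.B.pt z \<one>" using key[OF u] by blast
      obtain w where w: "(w, \<one>) \<in> J.B.S0" "v = J.B.pt w \<one>" using key[OF v] by blast
      show "d (proj u) (proj v) = ds ?n' u v"
        unfolding z(2) w(2) J.B.proj_pt[OF z(1)] J.B.proj_pt[OF w(1)] ds_def by (rule J.B.dY_same[OF z(1) w(1), symmetric])
    qed
    then show "\<exists>n'\<ge>n. isometric_on (ds n') d proj (jj n n' ` seg (Xs n) (ds n) C C')"
      by (intro exI[of _ ?n']) simp
  qed
qed

text \<open>The predicate \<open>P\<close> covers both claims: it is trivial for the first and
  ellipticity of H for the second. All conditions hold for large n only, hence the shift of the
  sequence by N.\<close>

lemma resolution_exists:
  assumes "\<forall>\<^sub>F n in sequentially. P (TKc (Kn n))"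
  shows "\<exists>(Xs :: nat \<Rightarrow> ('p \<times> 'g) set set) ds acts.
            (\<forall>n. GF_tree G Gs (Xs n) (ds n) (acts n) \<and> minimal_tree G (Xs n) (ds n) (acts n) \<and>
                 geometric G Gs bs TYPE('p) (Xs n) (ds n) (acts n)) \<and>
            strongly_converges G Xs ds acts X d act \<and> (\<forall>n. acts n = TK_act G act \<and> P (Xs n))"
proof -
  have "\<forall>\<^sub>F n in sequentially. (geom (Kn n) \<and> admissible_K G Gs bs X d act (Kn n)) \<and>
    minimal_tree G (TKc (Kn n)) (TKd (Kn n)) (TK_act G act) \<and>
    P (TKc (Kn n))"
    using eventually_admissible eventually_minimal assms by eventually_elim blast
  then obtain N where N: "\<And>n. N \<le> n \<Longrightarrow> (geom (Kn n) \<and> admissible_K G Gs bs X d act (Kn n)) \<and>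
    minimal_tree G (TKc (Kn n)) (TKd (Kn n)) (TK_act G act) \<and>
    P (TKc (Kn n))"
    unfolding eventually_sequentially by blast
  have N': "N \<le> n \<Longrightarrow> geom (Kn n) \<and> admissible_K G Gs bs X d act (Kn n)" for n
    using N by blast
  show ?thesis
    by (intro exI[of _ "\<lambda>n. TKc (Kn (N + n))"] exI[of _ "\<lambda>n. TKd (Kn (N + n))"]
        exI[of _ "\<lambda>n. TK_act G act"] conjI allI resolution[OF N']) (simp_all add: N)
qed

end

text \<open>If all elements are elliptic, G has a global fixed point, which is an invariant subtree,
  and minimality makes it all of X.\<close>

lemma (in tree_action) base_point_exists:
  assumes GF: "GF_tree G Gs X d act" and min: "minimal_tree G X d act"
  shows "\<exists>x0\<in>X. X = {x0} \<or> (\<exists>g\<in>carrier G. on_axis g x0)"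
proof (cases "\<forall>g\<in>carrier G. \<exists>x\<in>X. act g x = x")
  case False
  then obtain g where g: "g \<in> carrier G" "\<And>x. x \<in> X \<Longrightarrow> act g x \<noteq> x" by blast
  then show ?thesis using elliptic_or_axis[OF g] by blast
next
  case True
  have per: "\<exists>x\<in>X. fixes_point act (Gs ! i) x" if i: "i < k" for i
    using GF i one_closed conj_set_one[OF i] unfolding GF_tree_def by metis
  obtain c where c: "c \<in> X" "\<forall>g\<in>carrier G. act g c = c" using global_fixed_point[OF per] True by blast
  have "m = c" if "T.btw c m c" for m
    using T.btw_unique[OF c(1) c(1) that T.btw_left[OF c(1)]] T.btw_eq[OF that] T.refl0[OF c(1)]
      T.sym[OF T.btw_in[OF that] c(1)] by simp
  then have "subtree X d {c}" unfolding subtree_def using c(1) T.seg_eq[OF c(1) c(1)] by auto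
  then have "{c} = X" using min c(2) unfolding minimal_tree_def by simp
  then show ?thesis using c(1) by blast
qed

theorem theorem3p3:
  fixes G :: "('g, 'm) monoid_scheme"
    and Gs :: "'g set list"  \<comment> \<open>G_1, ..., G_k\<close>
    and bs :: "'g list"      \<comment> \<open>free basis b_1, ..., b_N of F_N\<close>
    and X :: "'a set" and d :: "'a \<Rightarrow> 'a \<Rightarrow> real" and act :: "'g \<Rightarrow> 'a \<Rightarrow> 'a"
  assumes "group G"
    and "countable (carrier G)"
    and "free_product_decomp G Gs bs"
    and "GF_tree G Gs X d act"
    and "minimal_tree G X d act"
  shows "(\<exists>(Xs :: nat \<Rightarrow> ('a \<times> 'g) set set) ds acts.
            (\<forall>n. GF_tree G Gs (Xs n) (ds n) (acts n) \<and> minimal_tree G (Xs n) (ds n) (acts n) \<and>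
                 geometric G Gs bs TYPE('a) (Xs n) (ds n) (acts n)) \<and>
            strongly_converges G Xs ds acts X d act)
       \<and> (\<forall>H. finite_kurosh_rank G Gs H \<and> elliptic X act H \<longrightarrow>
            (\<exists>(Xs :: nat \<Rightarrow> ('a \<times> 'g) set set) ds acts.
               (\<forall>n. GF_tree G Gs (Xs n) (ds n) (acts n) \<and> minimal_tree G (Xs n) (ds n) (acts n) \<and>
                    geometric G Gs bs TYPE('a) (Xs n) (ds n) (acts n)) \<and>
               strongly_converges G Xs ds acts X d act \<and>
               (\<forall>n. elliptic (Xs n) (acts n) H)))"
proof -
  have tree: "R_tree X d" and action: "isometric_action G X d act"
    using assms(4) unfolding GF_tree_def by blast+
  interpret group G by (rule assms(1))
  interpret free_product G Gs bs by unfold_locales (rule assms(3))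
  interpret T: ztree X d by (rule R_tree_ztree[OF tree])
  interpret tree_action G Gs bs X d act by unfold_locales (rule action)
  obtain x0 where x0: "x0 \<in> X"
    "X = {x0} \<or> (\<exists>g\<in>carrier G. on_axis g x0)"
    using base_point_exists[OF assms(4,5)] by blast
  interpret exhaustion G Gs bs X d act x0
    by unfold_locales (fact assms(4), fact assms(5), fact assms(2), fact x0(1), fact x0(2))
  show ?thesis
  proof (intro conjI allI impI)
    show "\<exists>(Xs :: nat \<Rightarrow> ('a \<times> 'g) set set) ds acts.
            (\<forall>n. GF_tree G Gs (Xs n) (ds n) (acts n) \<and> minimal_tree G (Xs n) (ds n) (acts n) \<and>
                 geometric G Gs bs TYPE('a) (Xs n) (ds n) (acts n)) \<and>
            strongly_converges G Xs ds acts X d act"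
      using resolution_exists[of "\<lambda>_. True"] by auto
    fix H assume "finite_kurosh_rank G Gs H \<and> elliptic X act H"
    then show "\<exists>(Xs :: nat \<Rightarrow> ('a \<times> 'g) set set) ds acts.
               (\<forall>n. GF_tree G Gs (Xs n) (ds n) (acts n) \<and> minimal_tree G (Xs n) (ds n) (acts n) \<and>
                    geometric G Gs bs TYPE('a) (Xs n) (ds n) (acts n)) \<and>
               strongly_converges G Xs ds acts X d act \<and>
               (\<forall>n. elliptic (Xs n) (acts n) H)"
      using resolution_exists[OF eventually_elliptic[of H]] by metis
  qed
qed

end
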